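(* Let $P$ be reversible and ergodic with stationary distribution $\pi$, and let $(X_n)_{n\ge0}$ be a stationary Markov chain with kernel $P$. Let $h\in L^1(\pi)$ with $\pi(h)=0$ and $S_n=\sum_{k=0}^{n-1}h(X_k)$. If $(S_n/\sqrt n)_{n\ge1}$ is bounded in probability and $\inf_{x\in\mathcal X}P(x,\{x\})\ge\delta$ for some $\delta>0$, then $A<\infty$, where $A=\lim_{n\to\infty}\frac1n\operatorname{Var}_\pi(S_n)$ (that is, the limit exists and is finite).
   Context: $P$ is a Markov transition kernel on a Polish space $\mathcal X$ with its Borel sigma-algebra, with stationary probability distribution $\pi$. Ergodic means $\phi$-irreducible and aperiodic. Reversible means $\pi(dx)P(x,dy)$ is symmetric. Stationary means $X_0\sim\pi$; $\operatorname{Var}_\pi$ is variance under $X_0\sim\pi$. Bounded in probability: $\lim_{N\to\infty}\sup_n\mathbb P(|S_n/\sqrt n|\ge N)=0$. *)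

theory Defs
  imports "HOL-Probability.Probability"
begin

definition markov_kernel :: "('a::polish_space \<Rightarrow> 'a measure) \<Rightarrow> bool" where
  "markov_kernel P \<longleftrightarrow> P \<in> borel \<rightarrow>\<^sub>M prob_algebra borel"

primrec kernel_power :: "('a::polish_space \<Rightarrow> 'a measure) \<Rightarrow> nat \<Rightarrow> 'a \<Rightarrow> 'a measure" where
  "kernel_power P 0 x = return borel x"
| "kernel_power P (Suc n) x = P x \<bind> kernel_power P n"

definition stationary_distribution ::
    "('a::polish_space \<Rightarrow> 'a measure) \<Rightarrow> 'a measure \<Rightarrow> bool" where
  "stationary_distribution P \<pi> \<longleftrightarrow>
     prob_space \<pi> \<and> sets \<pi> = sets borel \<and> \<pi> \<bind> P = \<pi>"

text \<open>The first measure below is \<open>\<pi>(dx) P(x,dy)\<close> on the product space, the second one its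
  image under swapping the coordinates.\<close>

definition reversible :: "('a::polish_space \<Rightarrow> 'a measure) \<Rightarrow> 'a measure \<Rightarrow> bool" where
  "reversible P \<pi> \<longleftrightarrow>
     (\<pi> \<bind> (\<lambda>x. P x \<bind> (\<lambda>y. return (borel \<Otimes>\<^sub>M borel) (x, y)))) =
     (\<pi> \<bind> (\<lambda>x. P x \<bind> (\<lambda>y. return (borel \<Otimes>\<^sub>M borel) (y, x))))"

definition phi_irreducible :: "('a::polish_space \<Rightarrow> 'a measure) \<Rightarrow> bool" where
  "phi_irreducible P \<longleftrightarrow>
     (\<exists>\<phi>. sets \<phi> = sets borel \<and> sigma_finite_measure \<phi> \<and> emeasure \<phi> (space \<phi>) > 0 \<and>
          (\<forall>A\<in>sets borel. emeasure \<phi> A > 0 \<longrightarrow>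
             (\<forall>x. \<exists>n\<ge>1. emeasure (kernel_power P n x) A > 0)))"

text \<open>Aperiodicity of a kernel with stationary distribution \<open>\<pi>\<close>: there is no cyclic
  decomposition into at least two disjoint sets that carries positive \<open>\<pi>\<close>-mass.\<close>

definition aperiodic :: "('a::polish_space \<Rightarrow> 'a measure) \<Rightarrow> 'a measure \<Rightarrow> bool" where
  "aperiodic P \<pi> \<longleftrightarrow>
     \<not> (\<exists>d\<ge>2. \<exists>D :: nat \<Rightarrow> 'a set.
          (\<forall>i<d. D i \<in> sets borel) \<and> disjoint_family_on D {..<d} \<and> emeasure \<pi> (D 0) > 0 \<and>
          (\<forall>i<d. \<forall>x\<in>D i. emeasure (P x) (D (Suc i mod d)) = 1))"

definition ergodic :: "('a::polish_space \<Rightarrow> 'a measure) \<Rightarrow> 'a measure \<Rightarrow> bool" where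
  "ergodic P \<pi> \<longleftrightarrow> phi_irreducible P \<and> aperiodic P \<pi>"

definition past_algebra :: "'b measure \<Rightarrow> (nat \<Rightarrow> 'b \<Rightarrow> 'a::polish_space) \<Rightarrow> nat \<Rightarrow> 'b measure" where
  "past_algebra M X n =
     sigma (space M) (\<Union>k\<le>n. sets (vimage_algebra (space M) (X k) borel))"

definition markov_chain ::
    "'b measure \<Rightarrow> (nat \<Rightarrow> 'b \<Rightarrow> 'a::polish_space) \<Rightarrow> ('a \<Rightarrow> 'a measure) \<Rightarrow> bool" where
  "markov_chain M X P \<longleftrightarrow>
     prob_space M \<and> (\<forall>n. X n \<in> M \<rightarrow>\<^sub>M borel) \<and>
     (\<forall>n. \<forall>B\<in>sets borel. AE \<omega> in M.
        real_cond_exp M (past_algebra M X n) (\<lambda>\<omega>. indicator B (X (Suc n) \<omega>)) \<omega> =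
        measure (P (X n \<omega>)) B)"

definition stationary_markov_chain ::
    "'b measure \<Rightarrow> (nat \<Rightarrow> 'b \<Rightarrow> 'a::polish_space) \<Rightarrow> ('a \<Rightarrow> 'a measure) \<Rightarrow> 'a measure \<Rightarrow> bool" where
  "stationary_markov_chain M X P \<pi> \<longleftrightarrow> markov_chain M X P \<and> distr M borel (X 0) = \<pi>"

definition partial_sum :: "('a \<Rightarrow> real) \<Rightarrow> (nat \<Rightarrow> 'b \<Rightarrow> 'a) \<Rightarrow> nat \<Rightarrow> 'b \<Rightarrow> real" where
  "partial_sum h X n \<omega> = (\<Sum>k<n. h (X k \<omega>))"

definition sqrt_bounded_in_probability :: "'b measure \<Rightarrow> (nat \<Rightarrow> 'b \<Rightarrow> real) \<Rightarrow> bool" where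
  "sqrt_bounded_in_probability M S \<longleftrightarrow>
     ((\<lambda>N::real. SUP n\<in>{1..}. measure M {\<omega> \<in> space M. \<bar>S n \<omega> / sqrt (real n)\<bar> \<ge> N}) \<longlongrightarrow> 0) at_top"

text \<open>Extended-valued variance of an integrable random variable: it is \<open>\<infinity>\<close> when the variable is
  not square integrable, where the library variance (a Bochner integral) would yield \<open>0\<close>.\<close>

definition ext_variance :: "'b measure \<Rightarrow> ('b \<Rightarrow> real) \<Rightarrow> ennreal" where
  "ext_variance M Y = (\<integral>\<^sup>+\<omega>. ennreal ((Y \<omega> - (\<integral>\<omega>'. Y \<omega>' \<partial>M))\<^sup>2) \<partial>M)"

end

theory Submission
  imports Defs
begin

text \<open>Let \<open>T\<close> be the operator of \<open>P\<close> on \<open>L\<^sup>2(\<pi>)\<close>. For \<open>\<theta> = t h / \<surd>n\<close>, the average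
  \<open>G\<close> over \<open>k < n\<close> of the functions \<open>x \<mapsto> E\<^sub>x exp (i (\<theta> (X\<^sub>0) + \<dots> + \<theta> (X\<^sub>k\<^sub>-\<^sub>1)))\<close> satisfies
  \<open>G - e = exp (i \<theta>) T G\<close> with an error \<open>e\<close> of order \<open>1/n\<close>, so \<open>\<parallel>G\<parallel>\<^sup>2 - \<parallel>T G\<parallel>\<^sup>2\<close> has order
  \<open>1/n\<close>. Since \<open>P(x,{x}) \<ge> \<delta>\<close>, this difference dominates both \<open>\<delta> \<parallel>G - T G\<parallel>\<^sup>2\<close> and, up to a
  constant, the Dirichlet form of \<open>G\<close>. By ergodicity \<open>G\<close> is therefore weakly asymptotic to a constant,
  and boundedness in probability keeps the real part of that constant above \<open>1/2\<close> if \<open>t\<close> is small.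
  Now \<open>(exp (i \<theta>) - 1) G\<close> is \<open>G - T G\<close> up to rotation and errors of order \<open>1/n\<close>: taking norms and
  letting \<open>n\<close> tend to infinity gives \<open>h \<in> L\<^sup>2(\<pi>)\<close>; pairing the imaginary parts with
  \<open>g \<in> L\<^sup>2(\<pi>)\<close> gives \<open>\<langle>g, h\<rangle>\<^sup>2 \<le> C \<langle>g, g - T g\<rangle>\<close>. For \<open>g = h + T h + \<dots> + T\<^sup>2\<^sup>N\<^sup>-\<^sup>1 h\<close> this
  bounds the sums of the autocovariances \<open>\<langle>h, T\<^sup>k h\<rangle>\<close>, which are then absolutely summable.\<close>

text \<open>A priori \<open>h\<close> is only integrable, so neither the variance nor
  \<open><h, T^k h>\<close> is available; the bounded functions exp(i \<theta>) carry the argument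
  until \<open>h_L2\<close>. Averaging over k creates the small error: the functions satisfy f_(k+1)
  = exp(i \<theta>) T f_k, and in the average the shift of k leaves only two end terms divided by n.
  The scale of \<theta> matches this error, since the squared norm of (exp(i \<theta>) - 1) G also
  behaves like 1/n. In the pairing with g the right scale is sqrt n: Cauchy-Schwarz for the
  Dirichlet form keeps sqrt n <g, G - T G> bounded, while the error contributes sqrt n / n. The
  holding probability keeps the spectrum of T away from -1; without that the norm gap, which acts
  like 1 - \<lambda>^2, would not control 1 - \<lambda>. No spectral theorem is invoked: spectral
  facts appear as inequalities between integrals over pairs of successive states. For the final g,
  (I - T) g = h - T^(2N) h bounds the Dirichlet form by the very sum that stands squared on the
  left.\<close>

section \<open>Reversible kernels with holding probability\<close>

text \<open>The positive and the negative part go through \<open>nn_integral_bind\<close>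
  separately. Integrability under the composed measure makes both inner integrals finite for almost
  every \<open>x\<close>, and there their difference is the inner Bochner integral.\<close>

lemma integrable_bind:
  fixes f :: "'b \<Rightarrow> real"
  assumes K [measurable]: "K \<in> N \<rightarrow>\<^sub>M subprob_algebra B" and ne: "space N \<noteq> {}"
    and f: "integrable (N \<bind> K) f"
  shows AE_integrable_kernel: "AE x in N. integrable (K x) f"
    and integrable_integral_kernel: "integrable N (\<lambda>x. \<integral>y. f y \<partial>K x)"
    and integral_bind: "(\<integral>y. f y \<partial>(N \<bind> K)) = (\<integral>x. \<integral>y. f y \<partial>K x \<partial>N)"
proof -
  have sB [measurable_cong]: "sets (N \<bind> K) = sets B"
    using sets_kernel[OF K] ne by (rule sets_bind)
  have m [measurable]: "f \<in> borel_measurable B"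
    using borel_measurable_integrable[OF f] by simp
  define p where "p = (\<lambda>x. \<integral>\<^sup>+y. ennreal (f y) \<partial>K x)"
  define q where "q = (\<lambda>x. \<integral>\<^sup>+y. ennreal (- f y) \<partial>K x)"
  have pm [measurable]: "p \<in> borel_measurable N" "q \<in> borel_measurable N"
    unfolding p_def q_def
    by (rule measurable_compose[OF K nn_integral_measurable_subprob_algebra], simp)+
  have intp: "(\<integral>\<^sup>+x. p x \<partial>N) = (\<integral>\<^sup>+y. ennreal (f y) \<partial>(N \<bind> K))"
    and intq: "(\<integral>\<^sup>+x. q x \<partial>N) = (\<integral>\<^sup>+y. ennreal (- f y) \<partial>(N \<bind> K))"
    unfolding p_def q_def by (subst nn_integral_bind[OF _ K]; simp)+
  have finp: "(\<integral>\<^sup>+x. p x \<partial>N) < \<infinity>" and finq: "(\<integral>\<^sup>+x. q x \<partial>N) < \<infinity>"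
    using f unfolding intp intq real_integrable_def by (auto simp: less_top)
  have aep: "AE x in N. p x \<noteq> \<infinity>" and aeq: "AE x in N. q x \<noteq> \<infinity>"
    using finp finq by (auto intro!: nn_integral_PInf_AE simp del: infinity_ennreal_def)
  show aei: "AE x in N. integrable (K x) f"
    using aep aeq AE_space
  proof eventually_elim
    case (elim x)
    have [measurable]: "f \<in> borel_measurable (K x)"
      using m by (simp add: measurable_cong_sets[OF sets_kernel[OF K elim(3)] refl])
    show ?case using elim unfolding real_integrable_def p_def q_def by auto
  qed
  have Ip: "integrable N (\<lambda>x. enn2real (p x))" "(\<integral>x. enn2real (p x) \<partial>N) = enn2real (\<integral>\<^sup>+x. p x \<partial>N)"
  proof -
    have e: "(\<integral>\<^sup>+x. ennreal (enn2real (p x)) \<partial>N) = (\<integral>\<^sup>+x. p x \<partial>N)"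
      by (rule nn_integral_cong_AE) (use aep in eventually_elim, auto simp: less_top)
    show "integrable N (\<lambda>x. enn2real (p x))"
      using e finp by (intro integrableI_nonneg) auto
    show "(\<integral>x. enn2real (p x) \<partial>N) = enn2real (\<integral>\<^sup>+x. p x \<partial>N)"
      by (subst integral_eq_nn_integral) (auto simp: e)
  qed
  have Iq: "integrable N (\<lambda>x. enn2real (q x))" "(\<integral>x. enn2real (q x) \<partial>N) = enn2real (\<integral>\<^sup>+x. q x \<partial>N)"
  proof -
    have e: "(\<integral>\<^sup>+x. ennreal (enn2real (q x)) \<partial>N) = (\<integral>\<^sup>+x. q x \<partial>N)"
      by (rule nn_integral_cong_AE) (use aeq in eventually_elim, auto simp: less_top)
    show "integrable N (\<lambda>x. enn2real (q x))"
      using e finq by (intro integrableI_nonneg) auto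
    show "(\<integral>x. enn2real (q x) \<partial>N) = enn2real (\<integral>\<^sup>+x. q x \<partial>N)"
      by (subst integral_eq_nn_integral) (auto simp: e)
  qed
  have Im [measurable]: "(\<lambda>x. \<integral>y. f y \<partial>K x) \<in> borel_measurable N"
    by (rule measurable_compose[OF K integral_measurable_subprob_algebra[OF m]])
  have ae: "AE x in N. enn2real (p x) - enn2real (q x) = (\<integral>y. f y \<partial>K x)"
    using aei by eventually_elim (simp add: real_lebesgue_integral_def p_def q_def)
  show "integrable N (\<lambda>x. \<integral>y. f y \<partial>K x)"
    by (rule integrable_cong_AE_imp[OF Bochner_Integration.integrable_diff[OF Ip(1) Iq(1)] Im ae])
  have "(\<integral>x. \<integral>y. f y \<partial>K x \<partial>N) = (\<integral>x. enn2real (p x) - enn2real (q x) \<partial>N)"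
    by (rule integral_cong_AE) (use ae in \<open>auto elim: eventually_mono\<close>)
  also have "\<dots> = enn2real (\<integral>\<^sup>+x. p x \<partial>N) - enn2real (\<integral>\<^sup>+x. q x \<partial>N)"
    using Ip Iq by simp
  also have "\<dots> = (\<integral>y. f y \<partial>(N \<bind> K))"
    using f by (simp add: real_lebesgue_integral_def intp intq)
  finally show "(\<integral>y. f y \<partial>(N \<bind> K)) = (\<integral>x. \<integral>y. f y \<partial>K x \<partial>N)" by simp
qed

lemma integrable_mult_squares:
  assumes [measurable]: "f \<in> borel_measurable N" "g \<in> borel_measurable N"
    and "integrable N (\<lambda>x. (f x)\<^sup>2)" "integrable N (\<lambda>x. (g x)\<^sup>2)"
  shows "integrable N (\<lambda>x. f x * g x :: real)"
proof (rule Bochner_Integration.integrable_bound)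
  show "integrable N (\<lambda>x. (f x)\<^sup>2 + (g x)\<^sup>2)" using assms by simp
  show "AE x in N. norm (f x * g x) \<le> norm ((f x)\<^sup>2 + (g x)\<^sup>2)"
  proof (rule AE_I2)
    fix x
    have "0 \<le> (\<bar>f x\<bar> - \<bar>g x\<bar>)\<^sup>2 + (f x)\<^sup>2 + (g x)\<^sup>2" by simp
    then show "norm (f x * g x) \<le> norm ((f x)\<^sup>2 + (g x)\<^sup>2)"
      by (simp add: power2_diff abs_mult)
  qed
qed simp

section \<open>The kernel operator and the law of two successive states\<close>

locale reversible_chain =
  fixes P :: "'a::polish_space \<Rightarrow> 'a measure" and \<pi> :: "'a measure" and \<delta> :: real
  assumes kernel: "markov_kernel P"
    and stationary: "stationary_distribution P \<pi>"
    and reversible: "reversible P \<pi>"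
    and \<delta>_pos: "\<delta> > 0"
    and holding: "measure (P x) {x} \<ge> \<delta>"
begin

sublocale \<pi>: prob_space \<pi>
  using stationary by (simp add: stationary_distribution_def)

lemma sets_\<pi> [simp, measurable_cong]: "sets \<pi> = sets borel"
  using stationary by (simp add: stationary_distribution_def)

lemma space_\<pi> [simp]: "space \<pi> = UNIV"
  using sets_eq_imp_space_eq[OF sets_\<pi>] by simp

lemma measure_\<pi>_UNIV [simp]: "emeasure \<pi> UNIV = 1" "measure \<pi> UNIV = 1"
  using \<pi>.emeasure_space_1 \<pi>.prob_space by simp_all

lemma bind_\<pi>: "\<pi> \<bind> P = \<pi>"
  using stationary by (simp add: stationary_distribution_def)

lemma P_prob_algebra: "P \<in> borel \<rightarrow>\<^sub>M prob_algebra borel"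
  using kernel by (simp add: markov_kernel_def)

lemma P_measurable [measurable]: "P \<in> borel \<rightarrow>\<^sub>M subprob_algebra borel"
  using P_prob_algebra by (rule measurable_prob_algebraD)

lemma P_measurable_\<pi>: "P \<in> \<pi> \<rightarrow>\<^sub>M subprob_algebra borel"
  by simp

lemma prob_space_P [simp]: "prob_space (P x)"
  using measurable_space[OF P_prob_algebra, of x] by (simp add: space_prob_algebra)

lemma sets_P [simp, measurable_cong]: "sets (P x) = sets borel"
  using measurable_space[OF P_prob_algebra, of x] by (simp add: space_prob_algebra)

lemma space_P [simp]: "space (P x) = UNIV"
  using sets_eq_imp_space_eq[OF sets_P] by simp

text \<open>Where \<open>f\<close> is not integrable under \<open>P x\<close> this takes the Bochner
  default 0. For \<open>f\<close> integrable under \<pi> that happens only on a null set, hence the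
  almost-everywhere arguments below.\<close>

definition T :: "('a \<Rightarrow> real) \<Rightarrow> 'a \<Rightarrow> real" where
  "T f x = (\<integral>y. f y \<partial>P x)"

text \<open>The joint law of two successive stationary states. Pairings <f, T g> and mean squared
  increments become integrals over it, so that swapping coordinates, positivity of squares and
  Cauchy-Schwarz yield the operator facts.\<close>

definition \<Gamma> :: "('a \<times> 'a) measure" where
  "\<Gamma> = \<pi> \<bind> (\<lambda>x. P x \<bind> (\<lambda>y. return (borel \<Otimes>\<^sub>M borel) (x, y)))"

lemma bind_P_pair:
  "P x \<bind> (\<lambda>y. return (borel \<Otimes>\<^sub>M borel) (x, y)) = distr (P x) (borel \<Otimes>\<^sub>M borel) (\<lambda>y. (x, y))"
  by (rule bind_return_distr') auto

lemma pair_kernel_measurable: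
  "(\<lambda>x. P x \<bind> (\<lambda>y. return (borel \<Otimes>\<^sub>M borel) (x, y))) \<in> \<pi> \<rightarrow>\<^sub>M subprob_algebra (borel \<Otimes>\<^sub>M borel)"
  by measurable

lemma sets_\<Gamma> [simp, measurable_cong]: "sets \<Gamma> = sets (borel \<Otimes>\<^sub>M borel)"
  unfolding \<Gamma>_def using sets_kernel[OF pair_kernel_measurable] by (rule sets_bind) auto

lemma T_measurable [measurable]: "f \<in> borel_measurable borel \<Longrightarrow> T f \<in> borel_measurable borel"
  unfolding T_def[abs_def]
  by (rule measurable_compose[OF P_measurable integral_measurable_subprob_algebra])

lemma distr_\<Gamma>_fst: "distr \<Gamma> borel fst = \<pi>"
proof -
  have "distr \<Gamma> borel fst = \<pi> \<bind> (\<lambda>x. distr (distr (P x) (borel \<Otimes>\<^sub>M borel) (\<lambda>y. (x, y))) borel fst)"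
    unfolding \<Gamma>_def by (subst distr_bind[OF pair_kernel_measurable]) (auto simp: bind_P_pair)
  also have "\<dots> = \<pi> \<bind> return borel"
    by (rule bind_cong[OF refl]) (auto simp: distr_distr comp_def prob_space.distr_const)
  also have "\<dots> = \<pi> \<bind> return \<pi>"
    by (rule bind_cong[OF refl]) (auto intro!: return_cong)
  finally show ?thesis by (simp add: bind_return')
qed

lemma distr_\<Gamma>_swap: "distr \<Gamma> (borel \<Otimes>\<^sub>M borel) (\<lambda>(x, y). (y, x)) = \<Gamma>"
proof -
  have "distr \<Gamma> (borel \<Otimes>\<^sub>M borel) (\<lambda>(x, y). (y, x))
     = \<pi> \<bind> (\<lambda>x. distr (distr (P x) (borel \<Otimes>\<^sub>M borel) (\<lambda>y. (x, y))) (borel \<Otimes>\<^sub>M borel) (\<lambda>(x, y). (y, x)))"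
    unfolding \<Gamma>_def by (subst distr_bind[OF pair_kernel_measurable]) (auto simp: bind_P_pair)
  also have "\<dots> = \<pi> \<bind> (\<lambda>x. P x \<bind> (\<lambda>y. return (borel \<Otimes>\<^sub>M borel) (y, x)))"
    by (rule bind_cong[OF refl]) (auto simp: distr_distr comp_def bind_return_distr')
  also have "\<dots> = \<Gamma>"
    using reversible by (simp add: reversible_def \<Gamma>_def)
  finally show ?thesis .
qed

lemma distr_\<Gamma>_snd: "distr \<Gamma> borel snd = \<pi>"
proof -
  \<comment> \<open>By reversibility the swap preserves \<Gamma>, so the second marginal reduces to
    the first.\<close>
  have "distr \<Gamma> borel snd = distr (distr \<Gamma> (borel \<Otimes>\<^sub>M borel) (\<lambda>(x, y). (y, x))) borel fst"
    by (subst distr_distr) (auto simp: comp_def case_prod_beta)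
  then show ?thesis by (simp add: distr_\<Gamma>_swap distr_\<Gamma>_fst)
qed

lemma prob_space_\<Gamma>: "prob_space \<Gamma>"
proof
  have "emeasure (distr \<Gamma> borel fst) UNIV = 1"
    using \<pi>.emeasure_space_1 by (simp add: distr_\<Gamma>_fst)
  then show "emeasure \<Gamma> (space \<Gamma>) = 1"
    by (subst (asm) emeasure_distr) auto
qed

lemma
  fixes F :: "'a \<times> 'a \<Rightarrow> real"
  assumes "integrable \<Gamma> F"
  shows \<Gamma>_AE_integrable: "AE x in \<pi>. integrable (P x) (\<lambda>y. F (x, y))"
    and \<Gamma>_integrable: "integrable \<pi> (\<lambda>x. \<integral>y. F (x, y) \<partial>P x)"
    and \<Gamma>_integral: "(\<integral>z. F z \<partial>\<Gamma>) = (\<integral>x. \<integral>y. F (x, y) \<partial>P x \<partial>\<pi>)"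
proof -
  have [measurable]: "F \<in> borel_measurable (borel \<Otimes>\<^sub>M borel)"
    using borel_measurable_integrable[OF assms] by simp
  note * = integrable_bind[OF pair_kernel_measurable _ assms[unfolded \<Gamma>_def]]
  show "AE x in \<pi>. integrable (P x) (\<lambda>y. F (x, y))"
    using *(1) by (simp add: bind_P_pair integrable_distr_eq)
  show "integrable \<pi> (\<lambda>x. \<integral>y. F (x, y) \<partial>P x)"
    using *(2) by (simp add: bind_P_pair integral_distr)
  show "(\<integral>z. F z \<partial>\<Gamma>) = (\<integral>x. \<integral>y. F (x, y) \<partial>P x \<partial>\<pi>)"
    using *(3) unfolding \<Gamma>_def[symmetric] by (simp add: bind_P_pair integral_distr)
qed

section \<open>Square-integrable functions and self-adjointness\<close>

text \<open>Borel functions rather than classes modulo null sets: the equation for the averaged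
  characteristic functions is later used at every single point.\<close>

definition L2 :: "('a \<Rightarrow> real) set" where
  "L2 = {f \<in> borel_measurable borel. integrable \<pi> (\<lambda>x. (f x)\<^sup>2)}"

lemma L2_measurable [measurable_dest]: "f \<in> L2 \<Longrightarrow> f \<in> borel_measurable borel"
  by (simp add: L2_def)

lemma L2_square: "f \<in> L2 \<Longrightarrow> integrable \<pi> (\<lambda>x. (f x)\<^sup>2)"
  by (simp add: L2_def)

lemma L2_mult: "f \<in> L2 \<Longrightarrow> g \<in> L2 \<Longrightarrow> integrable \<pi> (\<lambda>x. f x * g x)"
  by (intro integrable_mult_squares L2_square) auto

lemma bounded_L2:
  assumes "f \<in> borel_measurable borel" "\<And>x. \<bar>f x\<bar> \<le> K"
  shows "f \<in> L2"
proof -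
  have "(f x)\<^sup>2 \<le> K\<^sup>2" for x using assms(2)[of x] by (simp add: abs_le_square_iff[symmetric])
  then show ?thesis unfolding L2_def using assms
    by (auto intro!: \<pi>.integrable_const_bound[where B="K\<^sup>2"])
qed

lemma L2_const: "(\<lambda>_. c) \<in> L2"
  by (rule bounded_L2[where K="\<bar>c\<bar>"]) auto

lemma L2_integrable:
  assumes "f \<in> L2"
  shows "integrable \<pi> f"
  using L2_mult[OF assms L2_const[of 1]] by simp

lemma L2_add: "f \<in> L2 \<Longrightarrow> g \<in> L2 \<Longrightarrow> (\<lambda>x. f x + g x) \<in> L2"
  unfolding L2_def using L2_mult[of f g] by (auto simp: power2_sum L2_def mult.assoc)

lemma L2_cmult: "f \<in> L2 \<Longrightarrow> (\<lambda>x. c * f x) \<in> L2"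
  unfolding L2_def by (auto simp: power_mult_distrib)

lemma L2_sum: "(\<And>i. i \<in> I \<Longrightarrow> f i \<in> L2) \<Longrightarrow> (\<lambda>x. \<Sum>i\<in>I. f i x) \<in> L2"
proof (induction I rule: infinite_finite_induct)
  case (insert i I)
  then show ?case using L2_add[of "f i" "\<lambda>x. \<Sum>i\<in>I. f i x"] by simp
qed (use L2_const[of 0] in simp_all)

lemma \<Gamma>_fst:
  fixes f :: "'a \<Rightarrow> real"
  assumes [measurable]: "f \<in> borel_measurable borel"
  shows integrable_\<Gamma>_fst: "integrable \<Gamma> (\<lambda>z. f (fst z)) \<longleftrightarrow> integrable \<pi> f"
    and integral_\<Gamma>_fst: "(\<integral>z. f (fst z) \<partial>\<Gamma>) = (\<integral>x. f x \<partial>\<pi>)"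
proof -
  show "integrable \<Gamma> (\<lambda>z. f (fst z)) \<longleftrightarrow> integrable \<pi> f"
    by (subst (2) distr_\<Gamma>_fst[symmetric]) (simp add: integrable_distr_eq)
  show "(\<integral>z. f (fst z) \<partial>\<Gamma>) = (\<integral>x. f x \<partial>\<pi>)"
    by (subst (2) distr_\<Gamma>_fst[symmetric]) (simp add: integral_distr)
qed

lemma \<Gamma>_snd:
  fixes f :: "'a \<Rightarrow> real"
  assumes [measurable]: "f \<in> borel_measurable borel"
  shows integrable_\<Gamma>_snd: "integrable \<Gamma> (\<lambda>z. f (snd z)) \<longleftrightarrow> integrable \<pi> f"
    and integral_\<Gamma>_snd: "(\<integral>z. f (snd z) \<partial>\<Gamma>) = (\<integral>x. f x \<partial>\<pi>)"
proof -
  show "integrable \<Gamma> (\<lambda>z. f (snd z)) \<longleftrightarrow> integrable \<pi> f"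
    by (subst (2) distr_\<Gamma>_snd[symmetric]) (simp add: integrable_distr_eq)
  show "(\<integral>z. f (snd z) \<partial>\<Gamma>) = (\<integral>x. f x \<partial>\<pi>)"
    by (subst (2) distr_\<Gamma>_snd[symmetric]) (simp add: integral_distr)
qed

lemma T_integrable:
  assumes "f \<in> borel_measurable borel" "integrable \<pi> f"
  shows integrable_T: "integrable \<pi> (T f)"
    and integral_T: "(\<integral>x. T f x \<partial>\<pi>) = (\<integral>x. f x \<partial>\<pi>)"
    and AE_integrable_P: "AE x in \<pi>. integrable (P x) f"
proof -
  have i: "integrable \<Gamma> (\<lambda>z. f (snd z))" using assms by (simp add: integrable_\<Gamma>_snd)
  show "integrable \<pi> (T f)" "(\<integral>x. T f x \<partial>\<pi>) = (\<integral>x. f x \<partial>\<pi>)" "AE x in \<pi>. integrable (P x) f"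
    using \<Gamma>_integrable[OF i] \<Gamma>_integral[OF i] \<Gamma>_AE_integrable[OF i] assms
    by (simp_all add: T_def[abs_def] integral_\<Gamma>_snd)
qed

lemma \<Gamma>_product:
  assumes f: "f \<in> L2" and g: "g \<in> L2"
  shows integrable_\<Gamma>_product: "integrable \<Gamma> (\<lambda>z. f (fst z) * g (snd z))"
    and integral_\<Gamma>_product: "(\<integral>z. f (fst z) * g (snd z) \<partial>\<Gamma>) = (\<integral>x. f x * T g x \<partial>\<pi>)"
proof -
  have [measurable]: "f \<in> borel_measurable borel" "g \<in> borel_measurable borel"
    using f g by auto
  show *: "integrable \<Gamma> (\<lambda>z. f (fst z) * g (snd z))"
    using f g by (intro integrable_mult_squares) (simp_all add: integrable_\<Gamma>_fst[of "\<lambda>x. (f x)\<^sup>2"]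
      integrable_\<Gamma>_snd[of "\<lambda>x. (g x)\<^sup>2"] L2_square)
  show "(\<integral>z. f (fst z) * g (snd z) \<partial>\<Gamma>) = (\<integral>x. f x * T g x \<partial>\<pi>)"
    using \<Gamma>_integral[OF *] by (simp add: T_def)
qed

text \<open>Both sides are integrals over \<Gamma> that differ by exchanging the
  coordinates.\<close>

lemma T_symmetric:
  assumes f: "f \<in> L2" and g: "g \<in> L2"
  shows "(\<integral>x. f x * T g x \<partial>\<pi>) = (\<integral>x. T f x * g x \<partial>\<pi>)"
proof -
  have [measurable]: "f \<in> borel_measurable borel" "g \<in> borel_measurable borel"
    using f g by auto
  have "(\<integral>x. f x * T g x \<partial>\<pi>) = (\<integral>z. f (fst z) * g (snd z) \<partial>distr \<Gamma> (borel \<Otimes>\<^sub>M borel) (\<lambda>(x, y). (y, x)))"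
    using integral_\<Gamma>_product[OF f g] by (simp add: distr_\<Gamma>_swap)
  also have "\<dots> = (\<integral>z. g (fst z) * f (snd z) \<partial>\<Gamma>)"
    by (subst integral_distr) (auto simp: case_prod_beta mult.commute)
  also have "\<dots> = (\<integral>x. T f x * g x \<partial>\<pi>)"
    using integral_\<Gamma>_product[OF g f] by (simp add: mult.commute)
  finally show ?thesis .
qed

text \<open>Nonnegativity of the variance under \<open>P x\<close> gives (T f)^2 \<le> T (f^2)
  almost everywhere, and T preserves the integral.\<close>

lemma T_L2:
  assumes f: "f \<in> L2"
  shows "T f \<in> L2"
proof -
  have [measurable]: "f \<in> borel_measurable borel" using f by auto
  note sq = L2_square[OF f]
  have sm: "(\<lambda>x. (f x)\<^sup>2) \<in> borel_measurable borel" and fm: "f \<in> borel_measurable borel" by auto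
  have "integrable \<pi> (\<lambda>x. (T f x)\<^sup>2)"
  proof (rule Bochner_Integration.integrable_bound[OF integrable_T[OF sm sq]])
    show "AE x in \<pi>. norm ((T f x)\<^sup>2) \<le> norm (T (\<lambda>x. (f x)\<^sup>2) x)"
      using AE_integrable_P[OF sm sq] AE_integrable_P[OF fm L2_integrable[OF f]]
    proof eventually_elim
      case (elim x)
      interpret Px: prob_space "P x" by simp
      have "0 \<le> Px.variance f" by simp
      also have "\<dots> = T (\<lambda>x. (f x)\<^sup>2) x - (T f x)\<^sup>2"
        using elim by (simp add: Px.variance_eq T_def)
      finally show ?case by simp
    qed
  qed auto
  then show ?thesis by (simp add: L2_def)
qed

section \<open>The Dirichlet form and the effect of the holding probability\<close>

definition dirichlet :: "('a \<Rightarrow> real) \<Rightarrow> real" where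
  "dirichlet f = (\<integral>x. (f x)\<^sup>2 \<partial>\<pi>) - (\<integral>x. f x * T f x \<partial>\<pi>)"

lemma integral_\<Gamma>_square:
  assumes f: "f \<in> L2"
  shows "integrable \<Gamma> (\<lambda>z. (a * f (fst z) + b * f (snd z))\<^sup>2)"
    and "(\<integral>z. (a * f (fst z) + b * f (snd z))\<^sup>2 \<partial>\<Gamma>)
      = (a\<^sup>2 + b\<^sup>2) * (\<integral>x. (f x)\<^sup>2 \<partial>\<pi>) + 2 * a * b * (\<integral>x. f x * T f x \<partial>\<pi>)"
proof -
  have [measurable]: "f \<in> borel_measurable borel" using f by auto
  have e: "(\<lambda>z. (a * f (fst z) + b * f (snd z))\<^sup>2) =
     (\<lambda>z. a\<^sup>2 * (f (fst z))\<^sup>2 + b\<^sup>2 * (f (snd z))\<^sup>2 + (2 * a * b) * (f (fst z) * f (snd z)))"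
    by (auto simp: power2_sum power_mult_distrib algebra_simps)
  note i = integrable_\<Gamma>_fst[of "\<lambda>x. (f x)\<^sup>2"] integrable_\<Gamma>_snd[of "\<lambda>x. (f x)\<^sup>2"]
      L2_square[OF f] integrable_\<Gamma>_product[OF f f]
  show "integrable \<Gamma> (\<lambda>z. (a * f (fst z) + b * f (snd z))\<^sup>2)"
    unfolding e using i by (intro Bochner_Integration.integrable_add integrable_mult_right) auto
  have "(\<integral>z. (a * f (fst z) + b * f (snd z))\<^sup>2 \<partial>\<Gamma>)
      = a\<^sup>2 * (\<integral>x. (f x)\<^sup>2 \<partial>\<pi>) + b\<^sup>2 * (\<integral>x. (f x)\<^sup>2 \<partial>\<pi>) + (2 * a * b) * (\<integral>x. f x * T f x \<partial>\<pi>)"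
    unfolding e using i integral_\<Gamma>_fst[of "\<lambda>x. (f x)\<^sup>2"] integral_\<Gamma>_snd[of "\<lambda>x. (f x)\<^sup>2"]
       integral_\<Gamma>_product[OF f f] by simp
  then show "(\<integral>z. (a * f (fst z) + b * f (snd z))\<^sup>2 \<partial>\<Gamma>)
      = (a\<^sup>2 + b\<^sup>2) * (\<integral>x. (f x)\<^sup>2 \<partial>\<pi>) + 2 * a * b * (\<integral>x. f x * T f x \<partial>\<pi>)"
    by (simp add: algebra_simps)
qed

lemma dirichlet_eq:
  assumes f: "f \<in> L2"
  shows "(\<integral>z. (f (fst z) - f (snd z))\<^sup>2 \<partial>\<Gamma>) = 2 * dirichlet f"
  using integral_\<Gamma>_square(2)[OF f, of 1 "-1"] by (simp add: dirichlet_def)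

text \<open>In the mean of (f x + f y)^2 under \<open>P x\<close>, the atom y = x alone contributes
  4 (f x)^2 with weight at least \<delta>. In spectral terms, T is bounded below by -1 + 2
  \<delta>.\<close>

lemma T_add_nonneg:
  assumes f: "f \<in> L2"
  shows "2 * \<delta> * (\<integral>x. (f x)\<^sup>2 \<partial>\<pi>) \<le> (\<integral>x. (f x)\<^sup>2 \<partial>\<pi>) + (\<integral>x. f x * T f x \<partial>\<pi>)"
proof -
  have [measurable]: "f \<in> borel_measurable borel" using f by auto
  have i: "integrable \<Gamma> (\<lambda>z. (f (fst z) + f (snd z))\<^sup>2)"
    using integral_\<Gamma>_square(1)[OF f, of 1 1] by simp
  have "4 * \<delta> * (\<integral>x. (f x)\<^sup>2 \<partial>\<pi>) = (\<integral>x. 4 * \<delta> * (f x)\<^sup>2 \<partial>\<pi>)" by simp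
  also have "\<dots> \<le> (\<integral>x. \<integral>y. (f x + f y)\<^sup>2 \<partial>P x \<partial>\<pi>)"
  proof (rule integral_mono_AE)
    show "integrable \<pi> (\<lambda>x. 4 * \<delta> * (f x)\<^sup>2)" using L2_square[OF f] by simp
    show "integrable \<pi> (\<lambda>x. \<integral>y. (f x + f y)\<^sup>2 \<partial>P x)" using \<Gamma>_integrable[OF i] by simp
    show "AE x in \<pi>. 4 * \<delta> * (f x)\<^sup>2 \<le> (\<integral>y. (f x + f y)\<^sup>2 \<partial>P x)"
      using \<Gamma>_AE_integrable[OF i]
    proof eventually_elim
      case (elim x)
      interpret Px: prob_space "P x" by simp
      have ix: "integrable (P x) (indicator {x} :: 'a \<Rightarrow> real)"
        by (rule Px.integrable_const_bound[where B=1]) (auto simp: indicator_def)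
      have "4 * \<delta> * (f x)\<^sup>2 \<le> 4 * (f x)\<^sup>2 * measure (P x) {x}"
        using mult_right_mono[OF holding[of x], of "4 * (f x)\<^sup>2"] by (simp add: mult_ac)
      also have "\<dots> = (\<integral>y. 4 * (f x)\<^sup>2 * indicator {x} y \<partial>P x)" by simp
      also have "\<dots> \<le> (\<integral>y. (f x + f y)\<^sup>2 \<partial>P x)"
        using elim ix by (intro integral_mono integrable_mult_right) (auto simp: power2_eq_square split: split_indicator)
      finally show ?case .
    qed
  qed
  also have "\<dots> = 2 * ((\<integral>x. (f x)\<^sup>2 \<partial>\<pi>) + (\<integral>x. f x * T f x \<partial>\<pi>))"
    using \<Gamma>_integral[OF i] integral_\<Gamma>_square(2)[OF f, of 1 1] by simp
  finally show ?thesis by simp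
qed

text \<open>The holding probability bounds the conditional variance of \<open>f\<close> from below by
  \<open>\<delta> (f - T f)\<^sup>2\<close>.\<close>
lemma T_contraction_gap:
  assumes f: "f \<in> L2"
  shows "\<delta> * (\<integral>x. (f x - T f x)\<^sup>2 \<partial>\<pi>) \<le> (\<integral>x. (f x)\<^sup>2 \<partial>\<pi>) - (\<integral>x. (T f x)\<^sup>2 \<partial>\<pi>)"
proof -
  have [measurable]: "f \<in> borel_measurable borel" using f by auto
  note Tf = T_L2[OF f]
  note sq = L2_square[OF f]
  have sm: "(\<lambda>x. (f x)\<^sup>2) \<in> borel_measurable borel" and fm: "f \<in> borel_measurable borel" by auto
  have d: "integrable \<pi> (\<lambda>x. (f x - T f x)\<^sup>2)"
    using L2_square[OF L2_add[OF f L2_cmult[OF Tf, of "-1"]]] by simp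
  have "\<delta> * (\<integral>x. (f x - T f x)\<^sup>2 \<partial>\<pi>) = (\<integral>x. \<delta> * (f x - T f x)\<^sup>2 \<partial>\<pi>)" by simp
  also have "\<dots> \<le> (\<integral>x. T (\<lambda>x. (f x)\<^sup>2) x - (T f x)\<^sup>2 \<partial>\<pi>)"
  proof (rule integral_mono_AE)
    show "integrable \<pi> (\<lambda>x. \<delta> * (f x - T f x)\<^sup>2)" using d by simp
    show "integrable \<pi> (\<lambda>x. T (\<lambda>x. (f x)\<^sup>2) x - (T f x)\<^sup>2)"
      using integrable_T[OF sm sq] L2_square[OF Tf] by auto
    show "AE x in \<pi>. \<delta> * (f x - T f x)\<^sup>2 \<le> T (\<lambda>x. (f x)\<^sup>2) x - (T f x)\<^sup>2"
      using AE_integrable_P[OF sm sq] AE_integrable_P[OF fm L2_integrable[OF f]]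
    proof eventually_elim
      case (elim x)
      interpret Px: prob_space "P x" by simp
      have i: "integrable (P x) (\<lambda>y. (f y - T f x)\<^sup>2)"
        using elim by (simp add: power2_diff)
      have ix: "integrable (P x) (indicator {x} :: 'a \<Rightarrow> real)"
        by (rule Px.integrable_const_bound[where B=1]) (auto simp: indicator_def)
      have "\<delta> * (f x - T f x)\<^sup>2 \<le> (f x - T f x)\<^sup>2 * measure (P x) {x}"
        using mult_right_mono[OF holding[of x], of "(f x - T f x)\<^sup>2"] by (simp add: mult_ac)
      also have "\<dots> = (\<integral>y. (f x - T f x)\<^sup>2 * indicator {x} y \<partial>P x)" by simp
      also have "\<dots> \<le> (\<integral>y. (f y - T f x)\<^sup>2 \<partial>P x)"
        using i ix by (intro integral_mono integrable_mult_right) (auto split: split_indicator)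
      also have "\<dots> = T (\<lambda>x. (f x)\<^sup>2) x - (T f x)\<^sup>2"
        using elim Px.variance_eq[of f] by (simp add: T_def)
      finally show ?case .
    qed
  qed
  also have "\<dots> = (\<integral>x. (f x)\<^sup>2 \<partial>\<pi>) - (\<integral>x. (T f x)\<^sup>2 \<partial>\<pi>)"
    using integrable_T[OF sm sq] integral_T[OF sm sq] L2_square[OF Tf] by simp
  finally show ?thesis .
qed

lemma integral_T_square_le:
  assumes f: "f \<in> L2"
  shows "(\<integral>x. (T f x)\<^sup>2 \<partial>\<pi>) \<le> (\<integral>x. (f x)\<^sup>2 \<partial>\<pi>)"
proof -
  have "0 \<le> \<delta> * (\<integral>x. (f x - T f x)\<^sup>2 \<partial>\<pi>)" using \<delta>_pos by simp
  then show ?thesis using T_contraction_gap[OF f] by linarith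
qed

text \<open>Twice the Dirichlet form is the norm gap plus the squared norm of f - T f, and the
  holding probability bounds the latter by the gap over \<delta>. In spectral terms, 1 - \<lambda>^2
  controls 1 - \<lambda> because \<lambda> stays away from -1.\<close>

lemma dirichlet_le_gap:
  assumes f: "f \<in> L2"
  shows "2 * dirichlet f \<le> (1 + 1 / \<delta>) * ((\<integral>x. (f x)\<^sup>2 \<partial>\<pi>) - (\<integral>x. (T f x)\<^sup>2 \<partial>\<pi>))"
proof -
  have "(\<integral>x. (f x - T f x)\<^sup>2 \<partial>\<pi>) = (\<integral>x. (f x)\<^sup>2 - 2 * (f x * T f x) + (T f x)\<^sup>2 \<partial>\<pi>)"
    by (simp add: power2_diff algebra_simps)
  also have "\<dots> = (\<integral>x. (f x)\<^sup>2 \<partial>\<pi>) - 2 * (\<integral>x. f x * T f x \<partial>\<pi>) + (\<integral>x. (T f x)\<^sup>2 \<partial>\<pi>)"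
    using L2_square[OF f] L2_square[OF T_L2[OF f]] L2_mult[OF f T_L2[OF f]] by simp
  finally have "2 * dirichlet f = (\<integral>x. (f x - T f x)\<^sup>2 \<partial>\<pi>) + ((\<integral>x. (f x)\<^sup>2 \<partial>\<pi>) - (\<integral>x. (T f x)\<^sup>2 \<partial>\<pi>))"
    by (simp add: dirichlet_def)
  moreover have "(\<integral>x. (f x - T f x)\<^sup>2 \<partial>\<pi>) \<le> ((\<integral>x. (f x)\<^sup>2 \<partial>\<pi>) - (\<integral>x. (T f x)\<^sup>2 \<partial>\<pi>)) / \<delta>"
    using T_contraction_gap[OF f] \<delta>_pos by (simp add: field_simps)
  ultimately show ?thesis by (simp add: ring_distribs diff_divide_distrib)
qed

end

section \<open>Ergodicity\<close>

locale ergodic_reversible_chain = reversible_chain +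
  assumes irreducible: "phi_irreducible P"
begin

lemma kernel_power_measurable: "kernel_power P n \<in> borel \<rightarrow>\<^sub>M prob_algebra borel"
proof (induction n)
  case 0
  have "kernel_power P 0 = return borel" by (simp add: fun_eq_iff)
  then show ?case by simp
next
  case (Suc n)
  have "kernel_power P (Suc n) = (\<lambda>x. P x \<bind> kernel_power P n)" by (simp add: fun_eq_iff)
  moreover have "(\<lambda>x. P x \<bind> kernel_power P n) \<in> borel \<rightarrow>\<^sub>M prob_algebra borel"
    by (rule measurable_bind_prob_space[OF P_prob_algebra Suc])
  ultimately show ?case by simp
qed

lemma AE_AE_P:
  assumes "AE x in \<pi>. Q x" and [measurable]: "Measurable.pred borel Q"
  shows "AE x in \<pi>. AE y in P x. Q y"
proof -
  have "AE x in \<pi> \<bind> P. Q x" unfolding bind_\<pi> by (rule assms(1))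
  then show ?thesis by (simp add: AE_bind[OF P_measurable_\<pi>])
qed

text \<open>The set is invariant only up to a null set. Stationarity makes almost every starting
  point avoid the exceptional set after one step almost surely (\<open>AE_AE_P\<close>), which is
  what lets the induction on the number of steps go through.\<close>

lemma AE_kernel_power_invariant:
  assumes [measurable]: "A \<in> sets borel"
    and inv: "AE x in \<pi>. x \<in> A \<longrightarrow> (AE y in P x. y \<in> A)"
  shows "AE x in \<pi>. x \<in> A \<longrightarrow> (AE y in kernel_power P n x. y \<in> A)"
proof (induction n)
  case 0
  have "AE y in return borel x. y \<in> A" if "x \<in> A" for x
    using that by (subst AE_return) auto
  then show ?case unfolding kernel_power.simps by (rule AE_I2[OF impI])
next
  case (Suc n)
  note km [measurable] = measurable_prob_algebraD[OF kernel_power_measurable[of n]]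
  have [measurable]: "Measurable.pred borel (\<lambda>x. x \<in> A \<longrightarrow> (AE y in kernel_power P n x. y \<in> A))"
  proof -
    have "(AE y in kernel_power P n x. y \<in> A) \<longleftrightarrow> emeasure (kernel_power P n x) (- A) = 0" for x
    proof -
      have sp: "space (kernel_power P n x) = UNIV" "sets (kernel_power P n x) = sets borel"
        using measurable_space[OF km, of x] by (auto simp: space_subprob_algebra dest: sets_eq_imp_space_eq)
      show ?thesis by (subst AE_iff_measurable[where N="- A"]) (auto simp: sp)
    qed
    then show ?thesis by simp
  qed
  have "AE x in \<pi>. AE y in P x. y \<in> A \<longrightarrow> (AE z in kernel_power P n y. z \<in> A)"
    by (rule AE_AE_P[OF Suc]) measurable
  with inv show ?case
  proof eventually_elim
    case (elim x)
    have km': "kernel_power P n \<in> P x \<rightarrow>\<^sub>M subprob_algebra borel"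
      by (simp add: measurable_cong_sets[OF sets_P refl])
    show ?case
    proof
      assume "x \<in> A"
      with elim have "AE y in P x. y \<in> A" by simp
      with elim(2) have "AE y in P x. AE z in kernel_power P n y. z \<in> A"
        by eventually_elim simp
      then show "AE y in kernel_power P (Suc n) x. y \<in> A"
        by (subst kernel_power.simps, subst AE_bind[OF km']) auto
    qed
  qed
qed

text \<open>As \<open>A\<close> is not null, some single point never leaves \<open>A\<close> under
  any power of the kernel, outside probability zero. Irreducibility started from that one point
  forbids positive \<phi>-mass outside \<open>A\<close>.\<close>

lemma invariant_complement_null:
  assumes [measurable]: "A \<in> sets borel"
    and inv: "AE x in \<pi>. x \<in> A \<longrightarrow> (AE y in P x. y \<in> A)"
    and pos: "\<not> (AE x in \<pi>. x \<notin> A)"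
    and \<phi>: "\<And>B x. B \<in> sets borel \<Longrightarrow> emeasure \<phi> B > 0 \<Longrightarrow> \<exists>n\<ge>1. emeasure (kernel_power P n x) B > 0"
  shows "emeasure \<phi> (- A) = 0"
proof -
  have "AE x in \<pi>. \<forall>n. x \<in> A \<longrightarrow> (AE y in kernel_power P n x. y \<in> A)"
    unfolding AE_all_countable using AE_kernel_power_invariant[OF assms(1) inv] by blast
  then have "\<exists>x. \<forall>n. AE y in kernel_power P n x. y \<in> A"
  proof (rule contrapos_pp)
    assume "\<not> (\<exists>x. \<forall>n. AE y in kernel_power P n x. y \<in> A)"
    then show "\<not> (AE x in \<pi>. \<forall>n. x \<in> A \<longrightarrow> (AE y in kernel_power P n x. y \<in> A))"
      using pos by (metis (mono_tags, lifting) eventually_mono)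
  qed
  then obtain x where x: "\<And>n. AE y in kernel_power P n x. y \<in> A" by blast
  have "emeasure (kernel_power P n x) (- A) = 0" for n
  proof -
    have sp: "space (kernel_power P n x) = UNIV" "sets (kernel_power P n x) = sets borel"
      using measurable_space[OF kernel_power_measurable, of x n]
      by (auto simp: space_prob_algebra dest: sets_eq_imp_space_eq)
    show ?thesis using x[of n] by (subst (asm) AE_iff_measurable[where N="- A"]) (auto simp: sp)
  qed
  then show ?thesis using \<phi>[of "- A" x] by (force simp: not_gr_zero)
qed

text \<open>If neither \<open>A\<close> nor its complement were \<pi>-null, both would have
  \<phi>-measure zero, although \<phi> is not the zero measure.\<close>

lemma invariant_trivial:
  assumes [measurable]: "A \<in> sets borel"
    and 1: "AE x in \<pi>. x \<in> A \<longrightarrow> (AE y in P x. y \<in> A)"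
    and 2: "AE x in \<pi>. x \<notin> A \<longrightarrow> (AE y in P x. y \<notin> A)"
  shows "(AE x in \<pi>. x \<in> A) \<or> (AE x in \<pi>. x \<notin> A)"
proof (rule ccontr)
  assume neg: "\<not> ?thesis"
  obtain \<phi> where s: "sets \<phi> = sets borel" and p: "emeasure \<phi> (space \<phi>) > 0"
    and \<phi>: "\<And>B x. B \<in> sets borel \<Longrightarrow> emeasure \<phi> B > 0 \<Longrightarrow> \<exists>n\<ge>1. emeasure (kernel_power P n x) B > 0"
    using irreducible unfolding phi_irreducible_def by blast
  have a: "emeasure \<phi> (- A) = 0"
    using neg by (intro invariant_complement_null[OF assms(1) 1 _ \<phi>]) auto
  have b: "emeasure \<phi> (- (- A)) = 0"
    using neg 2 by (intro invariant_complement_null[OF _ _ _ \<phi>]) auto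
  have "emeasure \<phi> (space \<phi>) \<le> emeasure \<phi> (- A) + emeasure \<phi> A"
    using sets_eq_imp_space_eq[OF s]
    by (subst plus_emeasure) (auto simp: s)
  then show False using a b p by simp
qed

text \<open>Along almost every step \<open>f\<close> does not change, so the set where
  \<open>f\<close> exceeds its mean and the complement are both invariant, and one of them has full
  measure. Exceeding the mean almost everywhere is impossible; staying below it almost everywhere
  forces equality.\<close>

lemma zero_energy_const:
  assumes f: "f \<in> L2" and z: "(\<integral>z. (f (fst z) - f (snd z))\<^sup>2 \<partial>\<Gamma>) = 0"
  shows "AE x in \<pi>. f x = (\<integral>x. f x \<partial>\<pi>)"
proof -
  have [measurable]: "f \<in> borel_measurable borel" using f by auto
  define c where "c = (\<integral>x. f x \<partial>\<pi>)"
  have i: "integrable \<Gamma> (\<lambda>z. (f (fst z) - f (snd z))\<^sup>2)"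
    using integral_\<Gamma>_square(1)[OF f, of 1 "-1"] by simp
  have "AE z in \<Gamma>. f (fst z) = f (snd z)"
    using integral_nonneg_eq_0_iff_AE[OF i] z by simp
  then have "AE x in \<pi>. AE z in P x \<bind> (\<lambda>y. return (borel \<Otimes>\<^sub>M borel) (x, y)). f (fst z) = f (snd z)"
    unfolding \<Gamma>_def by (subst (asm) AE_bind[OF pair_kernel_measurable]) auto
  then have ae: "AE x in \<pi>. AE y in P x. f y = f x"
  proof eventually_elim
    case (elim x)
    then have "AE y in P x. f x = f y"
      unfolding bind_P_pair by (subst (asm) AE_distr_iff) auto
    then show ?case by eventually_elim simp
  qed
  define A where "A = {x. f x > c}"
  have [measurable]: "A \<in> sets borel" unfolding A_def by measurable
  have "(AE x in \<pi>. x \<in> A) \<or> (AE x in \<pi>. x \<notin> A)"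
  proof (rule invariant_trivial)
    show "AE x in \<pi>. x \<in> A \<longrightarrow> (AE y in P x. y \<in> A)"
      using ae by eventually_elim (auto simp: A_def elim: eventually_mono)
    show "AE x in \<pi>. x \<notin> A \<longrightarrow> (AE y in P x. y \<notin> A)"
      using ae by eventually_elim (auto simp: A_def elim: eventually_mono)
  qed simp
  then show ?thesis
  proof
    assume "AE x in \<pi>. x \<in> A"
    then have "(\<integral>x. c \<partial>\<pi>) < (\<integral>x. f x \<partial>\<pi>)"
      using L2_integrable[OF f] \<pi>.emeasure_space_1
      by (intro \<pi>.integral_less_AE_space) (simp_all add: A_def del: space_\<pi>)
    then show ?thesis by (simp add: c_def)
  next
    assume le: "AE x in \<pi>. x \<notin> A"
    have "AE x in \<pi>. c - f x = 0"
    proof (subst integral_nonneg_eq_0_iff_AE[symmetric])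
      show "integrable \<pi> (\<lambda>x. c - f x)" using L2_integrable[OF f] by simp
      show "AE x in \<pi>. 0 \<le> c - f x" using le by eventually_elim (simp add: A_def)
      show "(\<integral>x. c - f x \<partial>\<pi>) = 0"
        using L2_integrable[OF f] by (simp add: c_def)
    qed
    then show ?thesis by eventually_elim (simp add: c_def)
  qed
qed

end

section \<open>Cauchy-Schwarz and a criterion for null sequences\<close>

lemma integral_cauchy_schwarz:
  fixes f g :: "'b \<Rightarrow> real"
  assumes [measurable]: "f \<in> borel_measurable N" "g \<in> borel_measurable N"
    and f: "integrable N (\<lambda>x. (f x)\<^sup>2)" and g: "integrable N (\<lambda>x. (g x)\<^sup>2)"
  shows "(\<integral>x. f x * g x \<partial>N)\<^sup>2 \<le> (\<integral>x. (f x)\<^sup>2 \<partial>N) * (\<integral>x. (g x)\<^sup>2 \<partial>N)"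
proof -
  define A B C where "A = (\<integral>x. (f x)\<^sup>2 \<partial>N)" and "B = (\<integral>x. f x * g x \<partial>N)" and "C = (\<integral>x. (g x)\<^sup>2 \<partial>N)"
  have fg: "integrable N (\<lambda>x. f x * g x)"
    using assms by (rule integrable_mult_squares)
  have "0 \<le> C" by (simp add: C_def)
  show ?thesis
  proof (cases "C = 0")
    case True
    then have "AE x in N. (g x)\<^sup>2 = 0"
      using integral_nonneg_eq_0_iff_AE[OF g] by (simp add: C_def)
    then have "B = (\<integral>x. 0 \<partial>N)"
      unfolding B_def by (intro integral_cong_AE) (auto elim: eventually_mono)
    then show ?thesis by (simp add: B_def[symmetric] C_def[symmetric] \<open>C = 0\<close>)
  next
    case False
    \<comment> \<open>The projection of \<open>f\<close> away from \<open>g\<close>, scaled by C to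
      avoid a division.\<close>
    have "0 \<le> (\<integral>x. (C * f x - B * g x)\<^sup>2 \<partial>N)" by simp
    also have "\<dots> = (\<integral>x. C\<^sup>2 * (f x)\<^sup>2 - 2 * C * B * (f x * g x) + B\<^sup>2 * (g x)\<^sup>2 \<partial>N)"
      by (intro Bochner_Integration.integral_cong) (auto simp: power2_diff power_mult_distrib)
    also have "\<dots> = C\<^sup>2 * A - 2 * C * B * B + B\<^sup>2 * C"
      using f g fg by (simp add: A_def B_def C_def)
    also have "\<dots> = C * (A * C - B\<^sup>2)" by (simp add: power2_eq_square algebra_simps)
    finally have "0 \<le> A * C - B\<^sup>2" using False \<open>0 \<le> C\<close> by (simp add: zero_le_mult_iff)
    then show ?thesis by (simp add: A_def B_def C_def)
  qed
qed

text \<open>Serves truncation arguments, where the dominating null sequence itself depends on the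
  tolerance.\<close>

lemma LIMSEQ_zero_approx:
  fixes a :: "nat \<Rightarrow> real"
  assumes "\<And>\<epsilon>. \<epsilon> > 0 \<Longrightarrow> \<exists>b. b \<longlonglongrightarrow> 0 \<and> (\<forall>n. \<bar>a n\<bar> \<le> \<bar>b n\<bar> + \<epsilon>)"
  shows "a \<longlonglongrightarrow> 0"
proof (rule LIMSEQ_I)
  fix r :: real assume "r > 0"
  then obtain b where b: "b \<longlonglongrightarrow> 0" "\<And>n. \<bar>a n\<bar> \<le> \<bar>b n\<bar> + r / 2" using assms[of "r/2"] by auto
  obtain N where "\<And>n. n \<ge> N \<Longrightarrow> \<bar>b n\<bar> < r / 2"
    using LIMSEQ_D[OF b(1), of "r/2"] \<open>r > 0\<close> by auto
  then have "\<And>n. n \<ge> N \<Longrightarrow> norm (a n - 0) < r" using b(2) by (smt (verit) field_sum_of_halves real_norm_def)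
  then show "\<exists>N. \<forall>n\<ge>N. norm (a n - 0) < r" by blast
qed

section \<open>Autocovariances, powers of the operator and the mean ergodic property\<close>

context reversible_chain
begin

text \<open>For \<open>f\<close> of mean zero this is the covariance of f(X_i) and f(X_(i+k)) in the
  stationary chain, by \<open>integral_X_product\<close>.\<close>

definition autocov :: "('a \<Rightarrow> real) \<Rightarrow> nat \<Rightarrow> real" where
  "autocov f k = (\<integral>x. f x * (T ^^ k) f x \<partial>\<pi>)"

lemma T_power_L2: "f \<in> L2 \<Longrightarrow> (T ^^ k) f \<in> L2"
  by (induction k) (auto intro: T_L2)

lemma T_power_measurable [measurable]:
  "f \<in> borel_measurable borel \<Longrightarrow> (T ^^ k) f \<in> borel_measurable borel"
  by (induction k) auto

lemma integral_T_power_mult: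
  assumes f: "f \<in> L2"
  shows "(\<integral>x. (T ^^ j) f x * (T ^^ k) f x \<partial>\<pi>) = autocov f (j + k)"
proof (induction j arbitrary: k)
  case (Suc j)
  have "(\<integral>x. (T ^^ Suc j) f x * (T ^^ k) f x \<partial>\<pi>) = (\<integral>x. (T ^^ j) f x * (T ^^ Suc k) f x \<partial>\<pi>)"
    using T_symmetric[OF T_power_L2[OF f, of j] T_power_L2[OF f, of k]] by simp
  then show ?case using Suc[of "Suc k"] by simp
qed (simp add: autocov_def)

lemma integral_T_power_square: "f \<in> L2 \<Longrightarrow> (\<integral>x. ((T ^^ k) f x)\<^sup>2 \<partial>\<pi>) = autocov f (2 * k)"
  using integral_T_power_mult[of f k k] by (simp add: power2_eq_square mult_2)

lemma autocov_even_nonneg: "f \<in> L2 \<Longrightarrow> 0 \<le> autocov f (2 * k)"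
  by (simp flip: integral_T_power_square)

lemma autocov_even_decseq:
  assumes f: "f \<in> L2"
  shows "decseq (\<lambda>k. autocov f (2 * k))"
proof (rule decseq_SucI)
  fix k
  show "autocov f (2 * Suc k) \<le> autocov f (2 * k)"
    using integral_T_square_le[OF T_power_L2[OF f, of k]]
      integral_T_power_square[OF f, of k] integral_T_power_square[OF f, of "Suc k"] by simp
qed

lemma T_bounded:
  assumes "f \<in> borel_measurable borel" "\<And>x. \<bar>f x\<bar> \<le> K"
  shows "\<bar>T f x\<bar> \<le> K"
proof -
  interpret Px: prob_space "P x" by simp
  have "0 \<le> K" using assms(2)[of undefined] by linarith
  have "norm (T f x) \<le> (\<integral>y. norm (f y) \<partial>P x)" unfolding T_def by simp
  also have "\<dots> \<le> (\<integral>y. K \<partial>P x)"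
    using assms \<open>0 \<le> K\<close> by (intro integral_mono Px.integrable_const_bound[where B=K]) auto
  finally show ?thesis using Px.prob_space by simp
qed

lemma T_power_bounded:
  assumes [measurable]: "f \<in> borel_measurable borel" and "\<And>x. \<bar>f x\<bar> \<le> K"
  shows "\<bar>(T ^^ k) f x\<bar> \<le> K"
proof (induction k arbitrary: x)
  case (Suc k)
  then show ?case using T_bounded[of "(T ^^ k) f" K] by simp
qed (use assms in simp)

lemma integral_T_power:
  assumes f: "f \<in> L2"
  shows "(\<integral>x. (T ^^ k) f x \<partial>\<pi>) = (\<integral>x. f x \<partial>\<pi>)"
proof (induction k)
  case (Suc k)
  then show ?case using integral_T[OF _ L2_integrable[OF T_power_L2[OF f, of k]]] T_power_L2[OF f, of k] by auto
qed simp

lemma integral_mult_square_le: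
  assumes f: "f \<in> L2" and g: "g \<in> L2"
  shows "(\<integral>x. f x * g x \<partial>\<pi>)\<^sup>2 \<le> (\<integral>x. (f x)\<^sup>2 \<partial>\<pi>) * (\<integral>x. (g x)\<^sup>2 \<partial>\<pi>)"
  using f g by (intro integral_cauchy_schwarz L2_square) auto

lemma integral_abs_le_L2:
  assumes f: "f \<in> L2"
  shows "(\<integral>x. \<bar>f x\<bar> \<partial>\<pi>) \<le> sqrt (\<integral>x. (f x)\<^sup>2 \<partial>\<pi>)"
proof -
  have "(\<lambda>x. \<bar>f x\<bar>) \<in> L2" using f by (auto simp: L2_def)
  from integral_mult_square_le[OF this L2_const[of 1]]
  show ?thesis by (intro real_le_rsqrt) simp
qed

lemma AE_\<Gamma>:
  assumes "AE x in \<pi>. Q x"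
  shows AE_\<Gamma>_fst: "AE z in \<Gamma>. Q (fst z)" and AE_\<Gamma>_snd: "AE z in \<Gamma>. Q (snd z)"
proof -
  have "AE x in distr \<Gamma> borel fst. Q x" "AE x in distr \<Gamma> borel snd. Q x"
    using assms by (simp_all only: distr_\<Gamma>_fst distr_\<Gamma>_snd)
  then show "AE z in \<Gamma>. Q (fst z)" "AE z in \<Gamma>. Q (snd z)"
    by (auto intro: AE_distrD[rotated])
qed

end

context ergodic_reversible_chain
begin

text \<open>The squared norms of T^k f decrease, and symmetry expresses every distance between even
  iterates through them, so these iterates are Cauchy. A limit \<open>g\<close> has zero energy,
  because the energy of an iterate is bounded by the drop of the norm in the next step. Ergodicity
  makes \<open>g\<close> constant, and the mean is preserved, so \<open>g\<close> vanishes and with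
  it the limit of the norms.\<close>

lemma autocov_even_tendsto_0:
  assumes [measurable]: "f \<in> borel_measurable borel" and bnd: "\<And>x. \<bar>f x\<bar> \<le> K"
    and mean: "(\<integral>x. f x \<partial>\<pi>) = 0"
  shows "(\<lambda>k. autocov f (2 * k)) \<longlonglongrightarrow> 0"
proof -
  have f: "f \<in> L2" by (rule bounded_L2[OF _ bnd]) simp
  define a where "a = (\<lambda>k. autocov f (2 * k))"
  \<comment> \<open>Even powers keep the lag of every pairing even, so that <s_i, s_j> is again a
    value of \<open>a\<close>, namely at i + j.\<close>
  define s where "s = (\<lambda>k. (T ^^ (2 * k)) f)"
  have s_meas [measurable]: "s k \<in> borel_measurable borel" for k unfolding s_def by simp
  have s_L2: "s k \<in> L2" for k unfolding s_def using f by (rule T_power_L2)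
  have s_bnd: "\<bar>s k x\<bar> \<le> K" for k x unfolding s_def by (rule T_power_bounded) (auto intro: bnd)
  obtain L where L: "a \<longlonglongrightarrow> L"
    using decseq_convergent[OF autocov_even_decseq[OF f], of 0] autocov_even_nonneg[OF f]
    unfolding a_def by blast
  have s_diff: "(\<integral>x. (s i x - s j x)\<^sup>2 \<partial>\<pi>) = a (2 * i) + a (2 * j) - 2 * a (i + j)" for i j
  proof -
    have "(\<integral>x. (s i x - s j x)\<^sup>2 \<partial>\<pi>) = (\<integral>x. (s i x)\<^sup>2 + (s j x)\<^sup>2 - 2 * (s i x * s j x) \<partial>\<pi>)"
      by (simp add: power2_diff mult.assoc)
    also have "\<dots> = (\<integral>x. (s i x)\<^sup>2 \<partial>\<pi>) + (\<integral>x. (s j x)\<^sup>2 \<partial>\<pi>) - 2 * (\<integral>x. s i x * s j x \<partial>\<pi>)"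
      using L2_square[OF s_L2] L2_mult[OF s_L2 s_L2] by simp
    also have "\<dots> = a (2 * i) + a (2 * j) - 2 * a (i + j)"
      unfolding s_def a_def integral_T_power_square[OF f] integral_T_power_mult[OF f]
      by (simp add: distrib_left)
    finally show ?thesis .
  qed
  have cauchy: "\<exists>N. \<forall>i\<ge>N. \<forall>j\<ge>N. (\<integral>x. norm (s i x - s j x) \<partial>\<pi>) < e" if "e > 0" for e
  proof -
    have "e\<^sup>2 / 4 > 0" using that by simp
    from LIMSEQ_D[OF L this] obtain N where N: "\<And>n. n \<ge> N \<Longrightarrow> \<bar>a n - L\<bar> < e\<^sup>2 / 4" by auto
    show ?thesis
    proof (intro exI allI impI)
      fix i j assume ij: "N \<le> i" "N \<le> j"
      have "(\<integral>x. (s i x - s j x)\<^sup>2 \<partial>\<pi>) < e\<^sup>2"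
        using N[of "2 * i"] N[of "2 * j"] N[of "i + j"] ij unfolding s_diff by (simp add: abs_if split: if_splits)
      then have "sqrt (\<integral>x. (s i x - s j x)\<^sup>2 \<partial>\<pi>) < e"
        using that by (simp add: real_less_lsqrt)
      moreover have "(\<lambda>x. s i x - s j x) \<in> L2"
        using L2_add[OF s_L2[of i] L2_cmult[OF s_L2[of j], of "-1"]] by simp
      ultimately show "(\<integral>x. norm (s i x - s j x) \<partial>\<pi>) < e"
        using integral_abs_le_L2 by fastforce
    qed
  qed
  \<comment> \<open>Passing to an almost-everywhere convergent subsequence replaces completeness of
    L2; the uniform bound \<open>K\<close> then allows dominated convergence.\<close>
  obtain r where r: "strict_mono r" "AE x in \<pi>. Cauchy (\<lambda>i. s (r i) x)"
    using cauchy_L1_AE_cauchy_subseq[of \<pi> s] L2_integrable[OF s_L2] cauchy by blast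
  define g where "g = (\<lambda>x. lim (\<lambda>i. s (r i) x))"
  have [measurable]: "g \<in> borel_measurable borel" unfolding g_def by measurable
  have conv: "AE x in \<pi>. (\<lambda>i. s (r i) x) \<longlonglongrightarrow> g x"
    using r(2) by eventually_elim (simp add: g_def Cauchy_convergent_iff convergent_LIMSEQ_iff)
  have sq_le: "(s k x)\<^sup>2 \<le> K\<^sup>2" for k x
    using s_bnd[of k x] abs_le_square_iff[of "s k x" K] by simp
  have g2: "integrable \<pi> (\<lambda>x. (g x)\<^sup>2)" "(\<lambda>i. \<integral>x. (s (r i) x)\<^sup>2 \<partial>\<pi>) \<longlonglongrightarrow> (\<integral>x. (g x)\<^sup>2 \<partial>\<pi>)"
    by (rule integrable_dominated_convergence[where w="\<lambda>_. K\<^sup>2" and s="\<lambda>i x. (s (r i) x)\<^sup>2"]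
        integral_dominated_convergence[where w="\<lambda>_. K\<^sup>2"];
        use conv sq_le in \<open>auto elim!: eventually_mono intro!: tendsto_power\<close>)+
  have gL2: "g \<in> L2" using g2(1) by (simp add: L2_def)
  have "(\<lambda>i. \<integral>x. s (r i) x \<partial>\<pi>) \<longlonglongrightarrow> (\<integral>x. g x \<partial>\<pi>)"
    by (rule integral_dominated_convergence[where w="\<lambda>_. K"]) (use conv s_bnd in auto)
  then have g_mean: "(\<integral>x. g x \<partial>\<pi>) = 0"
    using integral_T_power[OF f] mean by (simp add: s_def LIMSEQ_const_iff)
  have g_norm: "(\<integral>x. (g x)\<^sup>2 \<partial>\<pi>) = L"
  proof (rule LIMSEQ_unique[OF g2(2)])
    have "(\<lambda>i. a (2 * r i)) \<longlonglongrightarrow> L"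
      using r(1) by (intro filterlim_compose[OF L]) (auto intro!: filterlim_subseq strict_monoI simp: strict_mono_def)
    then show "(\<lambda>i. \<integral>x. (s (r i) x)\<^sup>2 \<partial>\<pi>) \<longlonglongrightarrow> L"
      by (simp add: s_def a_def integral_T_power_square[OF f])
  qed
  have "(\<lambda>i. \<integral>z. (s (r i) (fst z) - s (r i) (snd z))\<^sup>2 \<partial>\<Gamma>) \<longlonglongrightarrow> (\<integral>z. (g (fst z) - g (snd z))\<^sup>2 \<partial>\<Gamma>)"
  proof (rule integral_dominated_convergence[where w="\<lambda>_. (2 * K)\<^sup>2"])
    interpret \<Gamma>: prob_space \<Gamma> by (rule prob_space_\<Gamma>)
    show "integrable \<Gamma> (\<lambda>_. (2 * K)\<^sup>2)" by simp
    show "AE z in \<Gamma>. (\<lambda>i. (s (r i) (fst z) - s (r i) (snd z))\<^sup>2) \<longlonglongrightarrow> (g (fst z) - g (snd z))\<^sup>2"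
      using AE_\<Gamma>_fst[OF conv] AE_\<Gamma>_snd[OF conv] by eventually_elim (intro tendsto_intros)
    show "AE z in \<Gamma>. norm ((s (r i) (fst z) - s (r i) (snd z))\<^sup>2) \<le> (2 * K)\<^sup>2" for i
    proof (rule AE_I2)
      fix z
      have "\<bar>s (r i) (fst z) - s (r i) (snd z)\<bar> \<le> \<bar>2 * K\<bar>"
        using s_bnd[of "r i" "fst z"] s_bnd[of "r i" "snd z"] by linarith
      then show "norm ((s (r i) (fst z) - s (r i) (snd z))\<^sup>2) \<le> (2 * K)\<^sup>2"
        unfolding abs_le_square_iff by simp
    qed
  qed auto
  moreover have "(\<lambda>i. \<integral>z. (s (r i) (fst z) - s (r i) (snd z))\<^sup>2 \<partial>\<Gamma>) \<longlonglongrightarrow> 0"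
  proof (rule tendsto_sandwich[OF _ _ tendsto_const])
    have mono: "strict_mono (\<lambda>i. 2 * r i)" using r(1) by (auto simp: strict_mono_def)
    have "(\<lambda>i. a (2 * r i)) \<longlonglongrightarrow> L" "(\<lambda>i. a (Suc (2 * r i))) \<longlonglongrightarrow> L"
      using LIMSEQ_subseq_LIMSEQ[OF L mono] LIMSEQ_subseq_LIMSEQ[OF LIMSEQ_Suc[OF L] mono]
      by (simp_all add: comp_def)
    then have "(\<lambda>i. (1 + 1 / \<delta>) * (a (2 * r i) - a (Suc (2 * r i)))) \<longlonglongrightarrow> (1 + 1 / \<delta>) * (L - L)"
      by (intro tendsto_intros)
    then show "(\<lambda>i. (1 + 1 / \<delta>) * (a (2 * r i) - a (Suc (2 * r i)))) \<longlonglongrightarrow> 0" by simp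
    have "(\<integral>z. (s k (fst z) - s k (snd z))\<^sup>2 \<partial>\<Gamma>) \<le> (1 + 1 / \<delta>) * (a (2 * k) - a (Suc (2 * k)))" for k
    proof -
      have "T (s k) = (T ^^ Suc (2 * k)) f" by (simp add: s_def)
      then have "(\<integral>x. (T (s k) x)\<^sup>2 \<partial>\<pi>) = a (Suc (2 * k))"
        using integral_T_power_square[OF f, of "Suc (2 * k)"] by (simp add: a_def)
      moreover have "(\<integral>x. (s k x)\<^sup>2 \<partial>\<pi>) = a (2 * k)"
        using integral_T_power_square[OF f, of "2 * k"] by (simp add: a_def s_def)
      ultimately show ?thesis
        using dirichlet_eq[OF s_L2[of k]] dirichlet_le_gap[OF s_L2[of k]] by simp
    qed
    then show "\<forall>\<^sub>F i in sequentially. (\<integral>z. (s (r i) (fst z) - s (r i) (snd z))\<^sup>2 \<partial>\<Gamma>)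
        \<le> (1 + 1 / \<delta>) * (a (2 * r i) - a (Suc (2 * r i)))" by simp
  qed simp
  ultimately have "(\<integral>z. (g (fst z) - g (snd z))\<^sup>2 \<partial>\<Gamma>) = 0"
    by (rule LIMSEQ_unique)
  from zero_energy_const[OF gL2 this] have "AE x in \<pi>. (g x)\<^sup>2 = 0"
    by eventually_elim (simp add: g_mean)
  then have "L = 0"
    using integral_nonneg_eq_0_iff_AE[OF g2(1)] g_norm by simp
  then show ?thesis using L by (simp add: a_def)
qed

end

section \<open>Weak asymptotic constancy of almost invariant functions\<close>

context ergodic_reversible_chain
begin

text \<open>Each power is moved across the pairing by symmetry, at the cost of the norm of U - T U
  times a fixed norm.\<close>

lemma integral_T_power_diff_tendsto_0:
  assumes U: "\<And>n. U n \<in> L2" and gap: "(\<lambda>n. \<integral>x. (U n x - T (U n) x)\<^sup>2 \<partial>\<pi>) \<longlonglongrightarrow> 0"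
    and f: "f \<in> L2"
  shows "(\<lambda>n. (\<integral>x. f x * U n x \<partial>\<pi>) - (\<integral>x. (T ^^ k) f x * U n x \<partial>\<pi>)) \<longlonglongrightarrow> 0"
proof (induction k)
  case (Suc k)
  define g where "g = (T ^^ k) f"
  have g: "g \<in> L2" unfolding g_def using f by (rule T_power_L2)
  have dL2: "(\<lambda>x. U n x - T (U n) x) \<in> L2" for n
    using L2_add[OF U L2_cmult[OF T_L2[OF U], of "-1"]] by simp
  have "(\<lambda>n. sqrt ((\<integral>x. (g x)\<^sup>2 \<partial>\<pi>) * (\<integral>x. (U n x - T (U n) x)\<^sup>2 \<partial>\<pi>))) \<longlonglongrightarrow> sqrt ((\<integral>x. (g x)\<^sup>2 \<partial>\<pi>) * 0)"
    by (intro tendsto_intros gap)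
  then have "(\<lambda>n. sqrt ((\<integral>x. (g x)\<^sup>2 \<partial>\<pi>) * (\<integral>x. (U n x - T (U n) x)\<^sup>2 \<partial>\<pi>))) \<longlonglongrightarrow> 0" by simp
  then have "(\<lambda>n. \<integral>x. g x * (U n x - T (U n) x) \<partial>\<pi>) \<longlonglongrightarrow> 0"
    by (rule Lim_null_comparison[rotated])
       (use integral_mult_square_le[OF g dL2] in \<open>auto simp: real_le_rsqrt abs_le_square_iff intro!: always_eventually real_le_rsqrt\<close>)
  moreover have "(\<integral>x. g x * (U n x - T (U n) x) \<partial>\<pi>)
      = (\<integral>x. g x * U n x \<partial>\<pi>) - (\<integral>x. T g x * U n x \<partial>\<pi>)" for n
    using L2_mult[OF g U] L2_mult[OF g T_L2[OF U]] T_symmetric[OF g U]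
    by (simp add: right_diff_distrib)
  ultimately have "(\<lambda>n. (\<integral>x. g x * U n x \<partial>\<pi>) - (\<integral>x. T g x * U n x \<partial>\<pi>)) \<longlonglongrightarrow> 0" by simp
  from tendsto_add[OF Suc this] show ?case by (simp add: g_def)
qed simp

text \<open>A bounded test function of mean zero may be replaced by an iterate T^k f, whose norm is
  small by \<open>autocov_even_tendsto_0\<close>. An integrable one is truncated and centred first;
  the bound on \<open>U\<close> makes the truncation error uniform in n. The approximating constant
  is the mean of \<open>U n\<close> and may vary with n.\<close>

lemma asymptotically_constant:
  assumes [measurable]: "\<And>n. U n \<in> borel_measurable borel" and bnd: "\<And>n x. \<bar>U n x\<bar> \<le> 1"
    and gap: "(\<lambda>n. \<integral>x. (U n x - T (U n) x)\<^sup>2 \<partial>\<pi>) \<longlonglongrightarrow> 0"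
    and [measurable]: "\<phi> \<in> borel_measurable borel" and \<phi>: "integrable \<pi> \<phi>"
  shows "(\<lambda>n. (\<integral>x. \<phi> x * U n x \<partial>\<pi>) - (\<integral>x. \<phi> x \<partial>\<pi>) * (\<integral>x. U n x \<partial>\<pi>)) \<longlonglongrightarrow> 0"
proof -
  have U: "U n \<in> L2" for n by (rule bounded_L2[OF _ bnd]) simp
  have UI: "integrable \<pi> (U n)" for n using U by (rule L2_integrable)
  have U_mult: "integrable \<pi> (\<lambda>x. f x * U n x)" "\<bar>\<integral>x. f x * U n x \<partial>\<pi>\<bar> \<le> (\<integral>x. \<bar>f x\<bar> \<partial>\<pi>)"
    if f: "integrable \<pi> f" for f n
  proof -
    have le: "\<bar>f x * U n x\<bar> \<le> \<bar>f x\<bar>" for x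
      using mult_left_mono[OF bnd[of n x], of "\<bar>f x\<bar>"] by (simp add: abs_mult)
    have [measurable]: "f \<in> borel_measurable borel"
      using borel_measurable_integrable[OF f] by simp
    show i: "integrable \<pi> (\<lambda>x. f x * U n x)"
      by (rule Bochner_Integration.integrable_bound[OF f]) (use le in auto)
    have "\<bar>\<integral>x. f x * U n x \<partial>\<pi>\<bar> \<le> (\<integral>x. \<bar>f x * U n x\<bar> \<partial>\<pi>)" by simp
    also have "\<dots> \<le> (\<integral>x. \<bar>f x\<bar> \<partial>\<pi>)" using i f le by (intro integral_mono) auto
    finally show "\<bar>\<integral>x. f x * U n x \<partial>\<pi>\<bar> \<le> (\<integral>x. \<bar>f x\<bar> \<partial>\<pi>)" .
  qed
  have bounded: "(\<lambda>n. \<integral>x. f x * U n x \<partial>\<pi>) \<longlonglongrightarrow> 0"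
    if fm [measurable]: "f \<in> borel_measurable borel" and fb: "\<And>x. \<bar>f x\<bar> \<le> K" and f0: "(\<integral>x. f x \<partial>\<pi>) = 0" for f K
  proof (rule LIMSEQ_zero_approx)
    fix \<epsilon> :: real assume "\<epsilon> > 0"
    have f: "f \<in> L2" by (rule bounded_L2[OF fm fb])
    have "\<epsilon>\<^sup>2 > 0" using \<open>\<epsilon> > 0\<close> by simp
    from LIMSEQ_D[OF autocov_even_tendsto_0[OF fm fb f0] this]
    obtain k where "norm (autocov f (2 * k) - 0) < \<epsilon>\<^sup>2" by blast
    then have "sqrt (\<integral>x. ((T ^^ k) f x)\<^sup>2 \<partial>\<pi>) \<le> \<epsilon>"
      using integral_T_power_square[OF f, of k] \<open>\<epsilon> > 0\<close> by (intro real_le_lsqrt) auto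
    then have k: "\<bar>\<integral>x. (T ^^ k) f x * U n x \<partial>\<pi>\<bar> \<le> \<epsilon>" for n
      using U_mult(2)[OF L2_integrable[OF T_power_L2[OF f, of k]], of n]
        integral_abs_le_L2[OF T_power_L2[OF f, of k]] by linarith
    show "\<exists>b. b \<longlonglongrightarrow> 0 \<and> (\<forall>n. \<bar>\<integral>x. f x * U n x \<partial>\<pi>\<bar> \<le> \<bar>b n\<bar> + \<epsilon>)"
    proof (intro exI conjI allI)
      show "(\<lambda>n. (\<integral>x. f x * U n x \<partial>\<pi>) - (\<integral>x. (T ^^ k) f x * U n x \<partial>\<pi>)) \<longlonglongrightarrow> 0"
        by (rule integral_T_power_diff_tendsto_0[OF U gap f])
      show "\<bar>\<integral>x. f x * U n x \<partial>\<pi>\<bar> \<le> \<bar>(\<integral>x. f x * U n x \<partial>\<pi>) - (\<integral>x. (T ^^ k) f x * U n x \<partial>\<pi>)\<bar> + \<epsilon>" for n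
        using k[of n] by linarith
    qed
  qed
  show ?thesis
  proof (rule LIMSEQ_zero_approx)
    fix \<epsilon> :: real assume "\<epsilon> > 0"
    define \<phi>' where "\<phi>' = (\<lambda>K x. max (- real K) (min (real K) (\<phi> x)))"
    have [measurable]: "\<phi>' K \<in> borel_measurable borel" for K unfolding \<phi>'_def by measurable
    have b: "\<bar>\<phi>' K x\<bar> \<le> real K" for K x unfolding \<phi>'_def by auto
    have iK: "integrable \<pi> (\<phi>' K)" for K by (rule L2_integrable, rule bounded_L2[OF _ b[of K]]) simp
    have "(\<lambda>K. \<integral>x. \<bar>\<phi> x - \<phi>' K x\<bar> \<partial>\<pi>) \<longlonglongrightarrow> (\<integral>x. 0 \<partial>\<pi>)"
    proof (rule integral_dominated_convergence[where w="\<lambda>x. \<bar>\<phi> x\<bar>"])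
      show "AE x in \<pi>. (\<lambda>K. \<bar>\<phi> x - \<phi>' K x\<bar>) \<longlonglongrightarrow> 0"
      proof (rule AE_I2, rule tendsto_eventually)
        fix x
        obtain N :: nat where N: "\<bar>\<phi> x\<bar> \<le> real N" using real_arch_simple by blast
        show "\<forall>\<^sub>F K in sequentially. \<bar>\<phi> x - \<phi>' K x\<bar> = 0"
          using eventually_ge_at_top[of N] by eventually_elim (use N in \<open>auto simp: \<phi>'_def\<close>)
      qed
      show "AE x in \<pi>. norm \<bar>\<phi> x - \<phi>' K x\<bar> \<le> \<bar>\<phi> x\<bar>" for K
        by (rule AE_I2) (auto simp: \<phi>'_def)
    qed (use \<phi> in auto)
    then obtain K where K: "(\<integral>x. \<bar>\<phi> x - \<phi>' K x\<bar> \<partial>\<pi>) < \<epsilon> / 2"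
      using \<open>\<epsilon> > 0\<close> by (auto dest!: LIMSEQ_D[of _ _ "\<epsilon> / 2"])
    define c where "c = (\<integral>x. \<phi>' K x \<partial>\<pi>)"
    have 1: "(\<lambda>n. \<integral>x. (\<phi>' K x - c) * U n x \<partial>\<pi>) \<longlonglongrightarrow> 0"
    proof (rule bounded)
      show "\<bar>\<phi>' K x - c\<bar> \<le> real K + \<bar>c\<bar>" for x using b[of K x] by linarith
      show "(\<integral>x. \<phi>' K x - c \<partial>\<pi>) = 0" using iK by (simp add: c_def)
    qed simp
    have d: "integrable \<pi> (\<lambda>x. \<phi> x - \<phi>' K x)" using \<phi> iK by simp
    have 2: "\<bar>\<integral>x. (\<phi> x - \<phi>' K x) * U n x \<partial>\<pi>\<bar> \<le> \<epsilon> / 2" for n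
      using U_mult(2)[OF d, of n] K by simp
    have 3: "\<bar>(c - (\<integral>x. \<phi> x \<partial>\<pi>)) * (\<integral>x. U n x \<partial>\<pi>)\<bar> \<le> \<epsilon> / 2" for n
    proof -
      have "\<bar>\<integral>x. U n x \<partial>\<pi>\<bar> \<le> 1" using U_mult(2)[of "\<lambda>_. 1" n] by simp
      moreover have "\<bar>c - (\<integral>x. \<phi> x \<partial>\<pi>)\<bar> \<le> \<epsilon> / 2"
        using integral_abs_bound[of \<pi> "\<lambda>x. \<phi> x - \<phi>' K x"] K \<phi> iK by (simp add: c_def abs_minus_commute)
      ultimately show ?thesis
        using mult_mono[of "\<bar>c - (\<integral>x. \<phi> x \<partial>\<pi>)\<bar>" "\<epsilon> / 2" "\<bar>\<integral>x. U n x \<partial>\<pi>\<bar>" 1] \<open>\<epsilon> > 0\<close>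
        by (simp add: abs_mult)
    qed
    have 4: "(\<integral>x. \<phi> x * U n x \<partial>\<pi>) - (\<integral>x. \<phi> x \<partial>\<pi>) * (\<integral>x. U n x \<partial>\<pi>) =
        (\<integral>x. (\<phi>' K x - c) * U n x \<partial>\<pi>) + (\<integral>x. (\<phi> x - \<phi>' K x) * U n x \<partial>\<pi>)
        + (c - (\<integral>x. \<phi> x \<partial>\<pi>)) * (\<integral>x. U n x \<partial>\<pi>)" for n
      using U_mult(1)[OF \<phi>, of n] U_mult(1)[OF iK[of K], of n] UI[of n]
      by (simp add: left_diff_distrib)
    have "\<bar>(\<integral>x. \<phi> x * U n x \<partial>\<pi>) - (\<integral>x. \<phi> x \<partial>\<pi>) * (\<integral>x. U n x \<partial>\<pi>)\<bar>
        \<le> \<bar>\<integral>x. (\<phi>' K x - c) * U n x \<partial>\<pi>\<bar> + \<epsilon>" for n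
      using 2[of n] 3[of n] 4[of n] by linarith
    with 1 show "\<exists>b. b \<longlonglongrightarrow> 0 \<and> (\<forall>n. \<bar>(\<integral>x. \<phi> x * U n x \<partial>\<pi>) - (\<integral>x. \<phi> x \<partial>\<pi>) * (\<integral>x. U n x \<partial>\<pi>)\<bar> \<le> \<bar>b n\<bar> + \<epsilon>)"
      by blast
  qed
qed

end

section \<open>Averaged characteristic functions\<close>

context reversible_chain
begin

text \<open>The pairing is half the integral over \<Gamma> of the product of the increments of
  \<open>g\<close> and \<open>f\<close>, to which Cauchy-Schwarz applies. Having the energy of
  \<open>g\<close> on the right, not its norm, is what closes the estimate in
  \<open>sum_autocov_bounded\<close>.\<close>

lemma integral_mult_generator_le:
  assumes g: "g \<in> L2" and f: "f \<in> L2"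
  shows "(\<integral>x. g x * (f x - T f x) \<partial>\<pi>)\<^sup>2 \<le> dirichlet g * dirichlet f"
proof -
  have [measurable]: "f \<in> borel_measurable borel" "g \<in> borel_measurable borel"
    using f g by auto
  have sq: "integrable \<Gamma> (\<lambda>z. (k (fst z) - k (snd z))\<^sup>2)" if "k \<in> L2" for k
    using integral_\<Gamma>_square(1)[OF that, of 1 "-1"] by simp
  have i: "integrable \<Gamma> (\<lambda>z. g (fst z) * f (fst z))" "integrable \<Gamma> (\<lambda>z. g (snd z) * f (snd z))"
    using L2_mult[OF g f] integrable_\<Gamma>_fst[of "\<lambda>x. g x * f x"] integrable_\<Gamma>_snd[of "\<lambda>x. g x * f x"] by auto
  have "(\<integral>z. (g (fst z) - g (snd z)) * (f (fst z) - f (snd z)) \<partial>\<Gamma>)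
      = (\<integral>z. g (fst z) * f (fst z) + g (snd z) * f (snd z)
          - g (fst z) * f (snd z) - f (fst z) * g (snd z) \<partial>\<Gamma>)"
    by (simp add: algebra_simps)
  also have "\<dots> = (\<integral>x. g x * f x \<partial>\<pi>) + (\<integral>x. g x * f x \<partial>\<pi>)
      - (\<integral>x. g x * T f x \<partial>\<pi>) - (\<integral>x. f x * T g x \<partial>\<pi>)"
    using i integrable_\<Gamma>_product[OF g f] integrable_\<Gamma>_product[OF f g]
      integral_\<Gamma>_product[OF g f] integral_\<Gamma>_product[OF f g]
      integral_\<Gamma>_fst[of "\<lambda>x. g x * f x"] integral_\<Gamma>_snd[of "\<lambda>x. g x * f x"] by simp
  also have "\<dots> = 2 * (\<integral>x. g x * (f x - T f x) \<partial>\<pi>)"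
    using T_symmetric[OF f g] L2_mult[OF g f] L2_mult[OF g T_L2[OF f]]
    by (simp add: right_diff_distrib mult.commute)
  finally have "(2 * (\<integral>x. g x * (f x - T f x) \<partial>\<pi>))\<^sup>2
      \<le> (\<integral>z. (g (fst z) - g (snd z))\<^sup>2 \<partial>\<Gamma>) * (\<integral>z. (f (fst z) - f (snd z))\<^sup>2 \<partial>\<Gamma>)"
    using integral_cauchy_schwarz[OF _ _ sq[OF g] sq[OF f]] by simp
  then show ?thesis by (simp add: dirichlet_eq f g power_mult_distrib)
qed

lemma T_bounded_square:
  assumes [measurable]: "f \<in> borel_measurable borel" and b: "\<And>x. \<bar>f x\<bar> \<le> K"
  shows "(T f x)\<^sup>2 \<le> T (\<lambda>x. (f x)\<^sup>2) x"
proof -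
  interpret Px: prob_space "P x" by simp
  have "(f y)\<^sup>2 \<le> K\<^sup>2" for y using b[of y] abs_le_square_iff[of "f y" K] by simp
  then have "integrable (P x) (\<lambda>y. (f y)\<^sup>2)"
    by (intro Px.integrable_const_bound[where B="K\<^sup>2"]) auto
  moreover have "integrable (P x) f"
    using b by (intro Px.integrable_const_bound[where B=K]) auto
  ultimately have "Px.variance f = T (\<lambda>x. (f x)\<^sup>2) x - (T f x)\<^sup>2"
    by (simp add: Px.variance_eq T_def)
  moreover have "0 \<le> Px.variance f" by simp
  ultimately show ?thesis by simp
qed

text \<open>Real and imaginary part of \<open>E\<^sub>x exp (i (\<theta> (X\<^sub>0) + \<dots> + \<theta> (X\<^sub>k\<^sub>-\<^sub>1)))\<close>.\<close>
primrec char_fun :: "('a \<Rightarrow> real) \<Rightarrow> nat \<Rightarrow> ('a \<Rightarrow> real) \<times> ('a \<Rightarrow> real)" where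
  "char_fun \<theta> 0 = (\<lambda>_. 1, \<lambda>_. 0)"
| "char_fun \<theta> (Suc k) =
     (\<lambda>x. cos (\<theta> x) * T (fst (char_fun \<theta> k)) x - sin (\<theta> x) * T (snd (char_fun \<theta> k)) x,
      \<lambda>x. sin (\<theta> x) * T (fst (char_fun \<theta> k)) x + cos (\<theta> x) * T (snd (char_fun \<theta> k)) x)"

abbreviation char_re where "char_re \<theta> k \<equiv> fst (char_fun \<theta> k)"
abbreviation char_im where "char_im \<theta> k \<equiv> snd (char_fun \<theta> k)"

lemma char_fun_measurable [measurable]:
  assumes [measurable]: "\<theta> \<in> borel_measurable borel"
  shows "char_re \<theta> k \<in> borel_measurable borel" "char_im \<theta> k \<in> borel_measurable borel"
  by (induction k) auto

lemma sin_cos_rotation: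
  "(cos a * p - sin a * q)\<^sup>2 + (sin a * p + cos a * q)\<^sup>2 = p\<^sup>2 + (q::real)\<^sup>2"
proof -
  have "(c * p - s * q)\<^sup>2 + (s * p + c * q)\<^sup>2 = (s\<^sup>2 + c\<^sup>2) * (p\<^sup>2 + q\<^sup>2)" for c s :: real
    by (simp add: power2_eq_square algebra_simps)
  then show ?thesis by simp
qed

lemma abs_le_1_of_squares: "p\<^sup>2 + q\<^sup>2 \<le> 1 \<Longrightarrow> \<bar>p\<bar> \<le> 1 \<and> \<bar>q::real\<bar> \<le> 1"
  using zero_le_power2[of p] zero_le_power2[of q]
  unfolding abs_square_le_1[symmetric] by linarith

text \<open>The induction must treat both parts together: the rotation by \<theta> preserves the sum
  of squares but not the size of either part, and T decreases it by Jensen.\<close>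

lemma char_fun_bounded:
  assumes [measurable]: "\<theta> \<in> borel_measurable borel"
  shows "(char_re \<theta> k x)\<^sup>2 + (char_im \<theta> k x)\<^sup>2 \<le> 1"
proof (induction k arbitrary: x)
  case (Suc k)
  interpret Px: prob_space "P x" by simp
  have b: "\<bar>char_re \<theta> k y\<bar> \<le> 1" "\<bar>char_im \<theta> k y\<bar> \<le> 1" for y
    using abs_le_1_of_squares[OF Suc[of y]] by auto
  have sq: "\<bar>(char_re \<theta> k y)\<^sup>2\<bar> \<le> 1" "\<bar>(char_im \<theta> k y)\<^sup>2\<bar> \<le> 1" for y
    using b[of y] by (simp_all add: abs_square_le_1)
  have "(char_re \<theta> (Suc k) x)\<^sup>2 + (char_im \<theta> (Suc k) x)\<^sup>2
      = (T (char_re \<theta> k) x)\<^sup>2 + (T (char_im \<theta> k) x)\<^sup>2"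
    by (simp add: sin_cos_rotation)
  also have "\<dots> \<le> T (\<lambda>x. (char_re \<theta> k x)\<^sup>2) x + T (\<lambda>x. (char_im \<theta> k x)\<^sup>2) x"
    by (intro add_mono T_bounded_square[where K=1] b) auto
  also have "\<dots> = T (\<lambda>x. (char_re \<theta> k x)\<^sup>2 + (char_im \<theta> k x)\<^sup>2) x"
    unfolding T_def using sq
    by (subst Bochner_Integration.integral_add) (auto intro!: Px.integrable_const_bound[where B=1])
  also have "\<dots> \<le> 1"
    using T_bounded[of "\<lambda>x. (char_re \<theta> k x)\<^sup>2 + (char_im \<theta> k x)\<^sup>2" 1 x] Suc by simp
  finally show ?case .
qed simp

definition avg_re :: "('a \<Rightarrow> real) \<Rightarrow> nat \<Rightarrow> 'a \<Rightarrow> real" where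
  "avg_re \<theta> n x = (\<Sum>k<n. char_re \<theta> k x) / real n"

definition avg_im :: "('a \<Rightarrow> real) \<Rightarrow> nat \<Rightarrow> 'a \<Rightarrow> real" where
  "avg_im \<theta> n x = (\<Sum>k<n. char_im \<theta> k x) / real n"

lemma avg_measurable [measurable]:
  assumes [measurable]: "\<theta> \<in> borel_measurable borel"
  shows "avg_re \<theta> n \<in> borel_measurable borel" "avg_im \<theta> n \<in> borel_measurable borel"
  unfolding avg_re_def[abs_def] avg_im_def[abs_def] by measurable

lemma T_avg:
  assumes "\<And>k. f k \<in> borel_measurable borel" "\<And>k x. \<bar>f k x\<bar> \<le> K"
  shows "T (\<lambda>x. (\<Sum>k<n. f k x) / c) x = (\<Sum>k<n. T (f k) x) / c"
proof -
  interpret Px: prob_space "P x" by simp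
  have "integrable (P x) (f k)" for k
    using assms by (intro Px.integrable_const_bound[where B=K]) auto
  then show ?thesis by (simp add: T_def)
qed

lemma abs_avg_le_1:
  assumes "\<And>k. \<bar>a k :: real\<bar> \<le> 1"
  shows "\<bar>(\<Sum>k<n. a k) / real n\<bar> \<le> 1"
proof (cases "n = 0")
  case False
  have "\<bar>\<Sum>k<n. a k\<bar> \<le> (\<Sum>k<n. \<bar>a k\<bar>)" by (rule sum_abs)
  also have "\<dots> \<le> (\<Sum>k<n. 1)" by (intro sum_mono assms)
  finally show ?thesis using False by simp
qed simp

context
  fixes \<theta> :: "'a \<Rightarrow> real" and n :: nat
  assumes \<theta> [measurable]: "\<theta> \<in> borel_measurable borel" and n: "n > 0"
begin

lemma char_abs_le_1: "\<bar>char_re \<theta> k x\<bar> \<le> 1" "\<bar>char_im \<theta> k x\<bar> \<le> 1"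
  using abs_le_1_of_squares[OF char_fun_bounded[OF \<theta>]] by auto

lemma avg_abs_le_1: "\<bar>avg_re \<theta> n x\<bar> \<le> 1" "\<bar>avg_im \<theta> n x\<bar> \<le> 1"
  unfolding avg_re_def avg_im_def by (rule abs_avg_le_1, rule char_abs_le_1)+

lemma avg_L2: "avg_re \<theta> n \<in> L2" "avg_im \<theta> n \<in> L2"
  by (rule bounded_L2[where K=1], simp, rule avg_abs_le_1)+

text \<open>The sums over k and over k + 1 differ by the end terms at 0 and n only. The bounds
  differ because the complex function starts from 1, so only its real part has a nonzero initial
  term.\<close>

lemma avg_equation:
  obtains e1 e2 :: real where "\<bar>e1\<bar> \<le> 2 / n" "\<bar>e2\<bar> \<le> 1 / n"
    "avg_re \<theta> n x - e1 = cos (\<theta> x) * T (avg_re \<theta> n) x - sin (\<theta> x) * T (avg_im \<theta> n) x"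
    "avg_im \<theta> n x - e2 = sin (\<theta> x) * T (avg_re \<theta> n) x + cos (\<theta> x) * T (avg_im \<theta> n) x"
proof
  let ?e1 = "(1 - char_re \<theta> n x) / n" and ?e2 = "- char_im \<theta> n x / n"
  have "\<bar>1 - char_re \<theta> n x\<bar> \<le> 2" using char_abs_le_1(1)[of n x] by linarith
  then show "\<bar>?e1\<bar> \<le> 2 / n" by (simp add: divide_right_mono)
  show "\<bar>?e2\<bar> \<le> 1 / n" using char_abs_le_1(2)[of n x] by (simp add: divide_right_mono)
  have Tre: "T (avg_re \<theta> n) x = (\<Sum>k<n. T (char_re \<theta> k) x) / n"
    unfolding avg_re_def[abs_def] by (rule T_avg[where K=1]) (auto intro: char_abs_le_1)
  have Tim: "T (avg_im \<theta> n) x = (\<Sum>k<n. T (char_im \<theta> k) x) / n"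
    unfolding avg_im_def[abs_def] by (rule T_avg[where K=1]) (auto intro: char_abs_le_1)
  have shift: "(\<Sum>k<n. a (Suc k)) = (\<Sum>k<n. a k) - a 0 + (a n :: real)" for a
    using sum.lessThan_Suc_shift[of a n] by simp
  have "avg_re \<theta> n x - ?e1 = (\<Sum>k<n. char_re \<theta> (Suc k) x) / n"
    using shift[of "\<lambda>k. char_re \<theta> k x"] by (simp add: avg_re_def diff_divide_distrib add_divide_distrib del: char_fun.simps(2))
  then show "avg_re \<theta> n x - ?e1 = cos (\<theta> x) * T (avg_re \<theta> n) x - sin (\<theta> x) * T (avg_im \<theta> n) x"
    by (simp add: Tre Tim sum_subtractf sum_distrib_left diff_divide_distrib)
  have "avg_im \<theta> n x - ?e2 = (\<Sum>k<n. char_im \<theta> (Suc k) x) / n"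
    using shift[of "\<lambda>k. char_im \<theta> k x"] by (simp add: avg_im_def diff_divide_distrib add_divide_distrib del: char_fun.simps(2))
  then show "avg_im \<theta> n x - ?e2 = sin (\<theta> x) * T (avg_re \<theta> n) x + cos (\<theta> x) * T (avg_im \<theta> n) x"
    by (simp add: Tre Tim sum.distrib sum_distrib_left add_divide_distrib)
qed

text \<open>The rotation preserves the modulus, so the two gaps together are at most 2 |U e1| + 2 |V
  e2| \<le> (4 + 2) / n. Each gap is nonnegative, hence each obeys this bound by itself.\<close>

lemma avg_energy:
  shows "(\<integral>x. (avg_re \<theta> n x)\<^sup>2 \<partial>\<pi>) - (\<integral>x. (T (avg_re \<theta> n) x)\<^sup>2 \<partial>\<pi>) \<le> 6 / n"
    and "(\<integral>x. (avg_im \<theta> n x)\<^sup>2 \<partial>\<pi>) - (\<integral>x. (T (avg_im \<theta> n) x)\<^sup>2 \<partial>\<pi>) \<le> 6 / n"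
proof -
  let ?U = "avg_re \<theta> n" and ?V = "avg_im \<theta> n"
  note L = L2_square[OF avg_L2(1)] L2_square[OF avg_L2(2)]
    L2_square[OF T_L2[OF avg_L2(1)]] L2_square[OF T_L2[OF avg_L2(2)]]
  have pw: "(?U x)\<^sup>2 + (?V x)\<^sup>2 - 6 / n \<le> (T ?U x)\<^sup>2 + (T ?V x)\<^sup>2" for x
  proof (rule avg_equation[of x])
    fix e1 e2 :: real
    assume e: "\<bar>e1\<bar> \<le> 2 / n" "\<bar>e2\<bar> \<le> 1 / n"
      and eq: "?U x - e1 = cos (\<theta> x) * T ?U x - sin (\<theta> x) * T ?V x"
        "?V x - e2 = sin (\<theta> x) * T ?U x + cos (\<theta> x) * T ?V x"
    have "\<bar>?U x * e1\<bar> \<le> 1 * (2 / n)" "\<bar>?V x * e2\<bar> \<le> 1 * (1 / n)"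
      unfolding abs_mult by (intro mult_mono avg_abs_le_1 e; simp)+
    then have "2 * (?U x * e1) + 2 * (?V x * e2) \<le> 6 / n" by simp
    moreover have "(T ?U x)\<^sup>2 + (T ?V x)\<^sup>2 = (?U x - e1)\<^sup>2 + (?V x - e2)\<^sup>2"
      unfolding eq by (simp add: sin_cos_rotation)
    ultimately show ?thesis
      using zero_le_power2[of e1] zero_le_power2[of e2]
      unfolding power2_diff mult.assoc by linarith
  qed
  have "(\<integral>x. (?U x)\<^sup>2 + (?V x)\<^sup>2 - 6 / n \<partial>\<pi>) \<le> (\<integral>x. (T ?U x)\<^sup>2 + (T ?V x)\<^sup>2 \<partial>\<pi>)"
    using L pw by (intro integral_mono) auto
  then have "(\<integral>x. (?U x)\<^sup>2 \<partial>\<pi>) + (\<integral>x. (?V x)\<^sup>2 \<partial>\<pi>) - 6 / n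
      \<le> (\<integral>x. (T ?U x)\<^sup>2 \<partial>\<pi>) + (\<integral>x. (T ?V x)\<^sup>2 \<partial>\<pi>)"
    using L by simp
  then show "(\<integral>x. (?U x)\<^sup>2 \<partial>\<pi>) - (\<integral>x. (T ?U x)\<^sup>2 \<partial>\<pi>) \<le> 6 / n"
    "(\<integral>x. (?V x)\<^sup>2 \<partial>\<pi>) - (\<integral>x. (T ?V x)\<^sup>2 \<partial>\<pi>) \<le> 6 / n"
    using integral_T_square_le[OF avg_L2(1)] integral_T_square_le[OF avg_L2(2)] by linarith+
qed

lemma avg_generator_small:
  shows "(\<integral>x. (avg_re \<theta> n x - T (avg_re \<theta> n) x)\<^sup>2 \<partial>\<pi>) \<le> 6 / (\<delta> * n)"
    and "(\<integral>x. (avg_im \<theta> n x - T (avg_im \<theta> n) x)\<^sup>2 \<partial>\<pi>) \<le> 6 / (\<delta> * n)"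
  using order_trans[OF T_contraction_gap[OF avg_L2(1)] avg_energy(1)]
    order_trans[OF T_contraction_gap[OF avg_L2(2)] avg_energy(2)] \<delta>_pos n
  by (simp_all add: field_simps)

text \<open>With G = U + i V, the equation reads (1 - exp(-i \<theta>)) G = G - T G - exp(-i
  \<theta>) e, and |1 - exp(-i \<theta>)|^2 = 2 (1 - cos \<theta>). The constant collects 2 * (6 +
  6) / \<delta> from the two generator terms and 2 * 5 from the error.\<close>

lemma avg_rotation_small:
  "(\<integral>x. 2 * (1 - cos (\<theta> x)) * (avg_re \<theta> n x)\<^sup>2 \<partial>\<pi>) \<le> (24 / \<delta> + 10) / n"
proof -
  let ?U = "avg_re \<theta> n" and ?V = "avg_im \<theta> n"
  have dL2: "(\<lambda>x. ?U x - T ?U x) \<in> L2" "(\<lambda>x. ?V x - T ?V x) \<in> L2"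
    using L2_add[OF avg_L2(1) L2_cmult[OF T_L2[OF avg_L2(1)], of "-1"]]
      L2_add[OF avg_L2(2) L2_cmult[OF T_L2[OF avg_L2(2)], of "-1"]] by simp_all
  have pw: "2 * (1 - cos (\<theta> x)) * (?U x)\<^sup>2
      \<le> 2 * (?U x - T ?U x)\<^sup>2 + 2 * (?V x - T ?V x)\<^sup>2 + 10 / n" for x
  proof (rule avg_equation[of x])
    fix e1 e2 :: real
    assume e: "\<bar>e1\<bar> \<le> 2 / n" "\<bar>e2\<bar> \<le> 1 / n"
      and eq: "?U x - e1 = cos (\<theta> x) * T ?U x - sin (\<theta> x) * T ?V x"
        "?V x - e2 = sin (\<theta> x) * T ?U x + cos (\<theta> x) * T ?V x"
    define c s where "c = cos (\<theta> x)" and "s = sin (\<theta> x)"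
    have cs: "s\<^sup>2 + c\<^sup>2 = 1" "c \<le> 1" by (simp_all add: c_def s_def)
    \<comment> \<open>The inverse rotation solves the two equations for T U and T V.\<close>
    have "c * (?U x - e1) + s * (?V x - e2) = (s\<^sup>2 + c\<^sup>2) * T ?U x"
      "c * (?V x - e2) - s * (?U x - e1) = (s\<^sup>2 + c\<^sup>2) * T ?V x"
      unfolding eq c_def[symmetric] s_def[symmetric] by (simp_all add: power2_eq_square algebra_simps)
    then have TU: "T ?U x = c * (?U x - e1) + s * (?V x - e2)" and TV: "T ?V x = c * (?V x - e2) - s * (?U x - e1)"
      by (simp_all add: cs)
    \<comment> \<open>Real and imaginary part of exp(-i \<theta>) (e1 + i e2).\<close>
    define a b where "a = c * e1 + s * e2" and "b = c * e2 - s * e1"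
    have "(?U x - T ?U x - a)\<^sup>2 + (?V x - T ?V x - b)\<^sup>2
        = (1 - 2 * c + (s\<^sup>2 + c\<^sup>2)) * ((?U x)\<^sup>2 + (?V x)\<^sup>2)"
      unfolding TU TV a_def b_def by (simp add: power2_eq_square algebra_simps)
    then have 1: "(?U x - T ?U x - a)\<^sup>2 + (?V x - T ?V x - b)\<^sup>2 = 2 * (1 - c) * ((?U x)\<^sup>2 + (?V x)\<^sup>2)"
      by (simp add: cs)
    have "a\<^sup>2 + b\<^sup>2 = (s\<^sup>2 + c\<^sup>2) * (e1\<^sup>2 + e2\<^sup>2)"
      unfolding a_def b_def by (simp add: power2_eq_square algebra_simps)
    also have "\<dots> \<le> (2 / n)\<^sup>2 + (1 / n)\<^sup>2"
      using power_mono[OF e(1), of 2] power_mono[OF e(2), of 2] cs by simp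
    also have "\<dots> = 5 / (real n)\<^sup>2" by (simp add: power_divide)
    also have "\<dots> \<le> 5 / n"
      using n by (intro divide_left_mono) (auto simp: power2_eq_square)
    finally have 2: "a\<^sup>2 + b\<^sup>2 \<le> 5 / n" .
    have sq: "(p - q)\<^sup>2 \<le> 2 * p\<^sup>2 + 2 * q\<^sup>2" for p q :: real
      using zero_le_power2[of "p + q"] by (simp add: power2_sum power2_diff)
    have "2 * (1 - c) * (?U x)\<^sup>2 \<le> 2 * (1 - c) * ((?U x)\<^sup>2 + (?V x)\<^sup>2)"
      using cs by (intro mult_left_mono) auto
    then show ?thesis
      using 1 2 sq[of "?U x - T ?U x" a] sq[of "?V x - T ?V x" b] by (simp add: c_def)
  qed
  have "\<bar>2 * (1 - cos (\<theta> x)) * (?U x)\<^sup>2\<bar> \<le> 4 * 1" for x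
  proof -
    have "\<bar>2 * (1 - cos (\<theta> x))\<bar> \<le> 4"
      using cos_le_one[of "\<theta> x"] cos_ge_minus_one[of "\<theta> x"]
      unfolding right_diff_distrib by linarith
    then show ?thesis
      unfolding abs_mult[of _ "(?U x)\<^sup>2"] using avg_abs_le_1(1)[of x]
      by (intro mult_mono) (auto simp: abs_square_le_1)
  qed
  then have "integrable \<pi> (\<lambda>x. 2 * (1 - cos (\<theta> x)) * (?U x)\<^sup>2)"
    by (intro \<pi>.integrable_const_bound[where B=4]) auto
  then have "(\<integral>x. 2 * (1 - cos (\<theta> x)) * (?U x)\<^sup>2 \<partial>\<pi>)
      \<le> (\<integral>x. 2 * (?U x - T ?U x)\<^sup>2 + 2 * (?V x - T ?V x)\<^sup>2 + 10 / n \<partial>\<pi>)"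
    using pw L2_square[OF dL2(1)] L2_square[OF dL2(2)] by (intro integral_mono) auto
  also have "\<dots> = 2 * (\<integral>x. (?U x - T ?U x)\<^sup>2 \<partial>\<pi>) + 2 * (\<integral>x. (?V x - T ?V x)\<^sup>2 \<partial>\<pi>) + 10 / n"
    using L2_square[OF dL2(1)] L2_square[OF dL2(2)] by simp
  also have "\<dots> \<le> 2 * (6 / (\<delta> * n)) + 2 * (6 / (\<delta> * n)) + 10 / n"
    using avg_generator_small by (intro add_mono mult_left_mono) auto
  also have "\<dots> = (24 / \<delta> + 10) / n" by (simp add: add_divide_distrib)
  finally show ?thesis .
qed

end

end

section \<open>Elementary bounds for sine and cosine\<close>

lemma one_minus_cos_eq: "1 - cos y = 2 * (sin (y / 2))\<^sup>2" for y :: real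
  using cos_double_sin[of "y / 2"] by simp

lemma one_minus_cos_le_square: "1 - cos y \<le> y\<^sup>2 / 2" for y :: real
proof -
  have "(sin (y / 2))\<^sup>2 \<le> (y / 2)\<^sup>2"
    unfolding abs_le_square_iff[symmetric] by (rule abs_sin_x_le_abs_x)
  then show ?thesis by (simp add: one_minus_cos_eq power_divide)
qed

text \<open>The quadratic bound gives pointwise convergence; this linear one provides a dominating
  function that involves only the first power of \<open>h\<close>.\<close>

lemma one_minus_cos_le_abs: "1 - cos y \<le> \<bar>y\<bar>" for y :: real
proof (cases "\<bar>y\<bar> \<le> 2")
  case True
  have "y\<^sup>2 = \<bar>y\<bar> * \<bar>y\<bar>" by (simp add: power2_eq_square)
  also have "\<dots> \<le> 2 * \<bar>y\<bar>" using True by (intro mult_right_mono) auto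
  finally show ?thesis using one_minus_cos_le_square[of y] by simp
next
  case False
  then show ?thesis using cos_ge_minus_one[of y] by linarith
qed

lemma abs_sin_minus_le: "\<bar>sin y - y\<bar> \<le> \<bar>y\<bar> ^ 3 / 6" for y :: real
proof -
  have "(\<Sum>m<3. sin_coeff m * y ^ m) = y"
    by (simp add: numeral_3_eq_3 sin_coeff_def)
  then show ?thesis
    using Maclaurin_sin_bound[of y 3] by (simp add: fact_numeral field_simps)
qed

text \<open>With z = y / 2, the cubic Taylor error leaves |sin z| \<ge> 5/6 |z|, and 2 * 25/36
  exceeds 1.\<close>

lemma one_minus_cos_ge:
  fixes y :: real
  assumes "\<bar>y\<bar> \<le> 1"
  shows "y\<^sup>2 / 4 \<le> 1 - cos y"
proof -
  define z where "z = y / 2"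
  have z: "\<bar>z\<bar> \<le> 1 / 2" using assms by (simp add: z_def)
  have "\<bar>z\<bar> ^ 3 = \<bar>z\<bar> * z\<^sup>2" by (simp add: power3_eq_cube power2_eq_square abs_mult)
  also have "\<dots> \<le> \<bar>z\<bar> * 1"
    using z power_mono[of "\<bar>z\<bar>" 1 2] by (intro mult_left_mono) auto
  finally have "\<bar>z\<bar> ^ 3 / 6 \<le> \<bar>z\<bar> / 6" by simp
  with abs_sin_minus_le[of z] have "5 / 6 * \<bar>z\<bar> \<le> \<bar>sin z\<bar>" by linarith
  then have "(5 / 6 * \<bar>z\<bar>)\<^sup>2 \<le> \<bar>sin z\<bar>\<^sup>2" by (rule power_mono) simp
  then have "25 / 36 * z\<^sup>2 \<le> (sin z)\<^sup>2" by (simp add: power_mult_distrib power_divide)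
  moreover have "y\<^sup>2 = 4 * z\<^sup>2" by (simp add: z_def power_divide)
  ultimately show ?thesis
    using zero_le_power2[of z] unfolding one_minus_cos_eq z_def[symmetric] by linarith
qed

section \<open>Square integrability of \<open>h\<close> and its pairing with the Dirichlet
  form\<close>

text \<open>Isolates what boundedness in probability provides, in terms of the kernel and \<pi>
  alone. All k \<le> n are needed at the common scale 1 / sqrt n so that the average over k inherits
  the bound.\<close>

locale char_fun_bounded_below = ergodic_reversible_chain +
  fixes h :: "'a \<Rightarrow> real" and t :: real
  assumes h [measurable]: "h \<in> borel_measurable borel"
    and t: "t > 0"
    and char_re_ge: "\<And>n k. k \<le> n \<Longrightarrow> n > 0 \<Longrightarrow>
      1 / 2 \<le> (\<integral>x. char_re (\<lambda>x. t / sqrt (real n) * h x) k x \<partial>\<pi>)"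
begin

text \<open>The successor stands for the number n of steps and keeps it positive.\<close>

definition \<theta> :: "nat \<Rightarrow> 'a \<Rightarrow> real" where
  "\<theta> m = (\<lambda>x. t / sqrt (real (Suc m)) * h x)"

definition U :: "nat \<Rightarrow> 'a \<Rightarrow> real" where
  "U m = avg_re (\<theta> m) (Suc m)"

definition V :: "nat \<Rightarrow> 'a \<Rightarrow> real" where
  "V m = avg_im (\<theta> m) (Suc m)"

lemma \<theta>_measurable [measurable]: "\<theta> m \<in> borel_measurable borel"
  unfolding \<theta>_def by measurable

lemma U_abs_le_1: "\<bar>U m x\<bar> \<le> 1" and V_abs_le_1: "\<bar>V m x\<bar> \<le> 1"
  unfolding U_def V_def by (rule avg_abs_le_1[OF \<theta>_measurable]; simp)+

lemma U_L2: "U m \<in> L2" and V_L2: "V m \<in> L2"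
  unfolding U_def V_def by (rule avg_L2[OF \<theta>_measurable]; simp)+

lemma U_measurable [measurable]: "U m \<in> borel_measurable borel"
  and V_measurable [measurable]: "V m \<in> borel_measurable borel"
  using U_L2 V_L2 by auto

lemma integral_U_ge: "1 / 2 \<le> (\<integral>x. U m x \<partial>\<pi>)"
proof -
  have i: "integrable \<pi> (char_re (\<theta> m) k)" for k
    by (intro L2_integrable bounded_L2[where K=1]) (auto intro: char_abs_le_1)
  have "(\<integral>x. U m x \<partial>\<pi>) = (\<Sum>k<Suc m. \<integral>x. char_re (\<theta> m) k x \<partial>\<pi>) / real (Suc m)"
    unfolding U_def avg_re_def using i by (simp del: of_nat_Suc sum.lessThan_Suc)
  moreover have "(\<Sum>k<Suc m. 1 / 2) \<le> (\<Sum>k<Suc m. \<integral>x. char_re (\<theta> m) k x \<partial>\<pi>)"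
    unfolding \<theta>_def by (intro sum_mono char_re_ge) auto
  ultimately show ?thesis by (simp add: le_divide_eq del: of_nat_Suc sum.lessThan_Suc)
qed

lemma inverse_Suc_tendsto_0: "(\<lambda>m. c / real (Suc m)) \<longlonglongrightarrow> 0"
  using tendsto_mult_right[OF LIMSEQ_inverse_real_of_nat, of c] by (simp add: divide_inverse mult.commute)

lemma U_asymptotically_constant:
  assumes "\<phi> \<in> borel_measurable borel" "integrable \<pi> \<phi>"
  shows "(\<lambda>m. (\<integral>x. \<phi> x * U m x \<partial>\<pi>) - (\<integral>x. \<phi> x \<partial>\<pi>) * (\<integral>x. U m x \<partial>\<pi>)) \<longlonglongrightarrow> 0"
proof (rule asymptotically_constant[OF _ U_abs_le_1 _ assms])
  show "(\<lambda>m. \<integral>x. (U m x - T (U m) x)\<^sup>2 \<partial>\<pi>) \<longlonglongrightarrow> 0"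
  proof (rule tendsto_sandwich[OF _ _ tendsto_const inverse_Suc_tendsto_0[of "6 / \<delta>"]])
    show "\<forall>\<^sub>F m in sequentially. (\<integral>x. (U m x - T (U m) x)\<^sup>2 \<partial>\<pi>) \<le> 6 / \<delta> / real (Suc m)"
      unfolding U_def using avg_generator_small(1)[OF \<theta>_measurable, of "Suc _"]
      by (intro always_eventually allI) (simp del: of_nat_Suc)
  qed simp
qed measurable

text \<open>With \<phi> the truncated square of \<open>h\<close> and I its integral, the integral of
  \<phi> U is at least I / 2 asymptotically. By weighted Cauchy-Schwarz its square is at most I
  times the integral of \<phi> U^2, which is bounded by \<open>avg_rotation_small\<close>. Thus I^2
  / 4 \<le> I * 2 C / t^2, with a bound free of the truncation level.\<close>

lemma truncated_square_le:
  "(\<integral>x. (h x)\<^sup>2 * indicator {x. \<bar>h x\<bar> \<le> real K} x \<partial>\<pi>) \<le> 8 * (24 / \<delta> + 10) / t\<^sup>2"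
proof -
  define \<phi> where "\<phi> = (\<lambda>x. (h x)\<^sup>2 * indicator {x. \<bar>h x\<bar> \<le> real K} x)"
  define C where "C = 24 / \<delta> + 10"
  define I where "I = (\<integral>x. \<phi> x \<partial>\<pi>)"
  have [measurable]: "\<phi> \<in> borel_measurable borel" unfolding \<phi>_def by measurable
  have \<phi>0: "0 \<le> \<phi> x" for x by (simp add: \<phi>_def)
  have \<phi>b: "\<bar>\<phi> x\<bar> \<le> (real K)\<^sup>2" for x
    using abs_le_square_iff[of "h x" "real K"] by (auto simp: \<phi>_def split: split_indicator)
  have \<phi>i: "integrable \<pi> \<phi>"
    by (rule L2_integrable, rule bounded_L2[OF _ \<phi>b]) simp
  have I0: "0 \<le> I" unfolding I_def using \<phi>0 by simp
  have C0: "0 \<le> C" unfolding C_def using \<delta>_pos by simp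
  \<comment> \<open>For such m the angle is at most 1 wherever |h| \<le> K, so the quadratic lower
    bound for 1 - cos applies; elsewhere \<phi> vanishes.\<close>
  have bound: "\<phi> x * (U m x)\<^sup>2 \<le> 2 * real (Suc m) / t\<^sup>2 * (2 * (1 - cos (\<theta> m x)) * (U m x)\<^sup>2)"
    if m: "(t * K)\<^sup>2 \<le> real (Suc m)" for m x
  proof (cases "\<bar>h x\<bar> \<le> real K")
    case True
    have "t * K \<le> sqrt (real (Suc m))" using m by (rule real_le_rsqrt)
    then have "t * \<bar>h x\<bar> \<le> sqrt (real (Suc m))"
      using mult_left_mono[OF True, of t] t by linarith
    then have "\<bar>\<theta> m x\<bar> \<le> 1"
      using t by (simp add: \<theta>_def abs_mult divide_le_eq del: of_nat_Suc)
    then have "(\<theta> m x)\<^sup>2 \<le> 4 * (1 - cos (\<theta> m x))" using one_minus_cos_ge[of "\<theta> m x"] by simp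
    moreover have "(\<theta> m x)\<^sup>2 = t\<^sup>2 / real (Suc m) * (h x)\<^sup>2"
      by (simp add: \<theta>_def power_mult_distrib power_divide del: of_nat_Suc)
    ultimately have "t\<^sup>2 / real (Suc m) * (h x)\<^sup>2 \<le> 4 * (1 - cos (\<theta> m x))" by (simp only:)
    then have "(h x)\<^sup>2 \<le> 2 * real (Suc m) / t\<^sup>2 * (2 * (1 - cos (\<theta> m x)))"
      using t by (simp add: field_simps del: of_nat_Suc)
    then have "(h x)\<^sup>2 * (U m x)\<^sup>2 \<le> 2 * real (Suc m) / t\<^sup>2 * (2 * (1 - cos (\<theta> m x))) * (U m x)\<^sup>2"
      by (rule mult_right_mono) simp
    then show ?thesis using True by (simp add: \<phi>_def mult.assoc)
  next
    case False
    then show ?thesis by (simp add: \<phi>_def)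
  qed
  have U_sq: "\<bar>(U m x)\<^sup>2\<bar> \<le> 1" for m x using U_abs_le_1[of m x] by (simp add: abs_square_le_1)
  have main: "(\<integral>x. \<phi> x * U m x \<partial>\<pi>)\<^sup>2 \<le> I * (2 * C / t\<^sup>2)" if m: "(t * K)\<^sup>2 \<le> real (Suc m)" for m
  proof -
    have i1: "integrable \<pi> (\<lambda>x. \<phi> x * (U m x)\<^sup>2)"
      by (rule Bochner_Integration.integrable_bound[OF \<phi>i])
         (use U_sq in \<open>auto simp: abs_mult intro!: mult_left_le\<close>)
    have "\<bar>2 * (1 - cos (\<theta> m x)) * (U m x)\<^sup>2\<bar> \<le> 4 * 1" for x
    proof -
      have "\<bar>2 * (1 - cos (\<theta> m x))\<bar> \<le> 4"
        using cos_le_one[of "\<theta> m x"] cos_ge_minus_one[of "\<theta> m x"]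
        unfolding right_diff_distrib by linarith
      then show ?thesis
        unfolding abs_mult[of _ "(U m x)\<^sup>2"] by (intro mult_mono U_sq) auto
    qed
    then have i2: "integrable \<pi> (\<lambda>x. 2 * (1 - cos (\<theta> m x)) * (U m x)\<^sup>2)"
      by (intro \<pi>.integrable_const_bound[where B=4]) auto
    have "(\<integral>x. \<phi> x * (U m x)\<^sup>2 \<partial>\<pi>)
        \<le> (\<integral>x. 2 * real (Suc m) / t\<^sup>2 * (2 * (1 - cos (\<theta> m x)) * (U m x)\<^sup>2) \<partial>\<pi>)"
      using bound[OF m] i1 i2 by (intro integral_mono integrable_mult_right) auto
    also have "\<dots> = 2 * real (Suc m) / t\<^sup>2 * (\<integral>x. 2 * (1 - cos (\<theta> m x)) * (U m x)\<^sup>2 \<partial>\<pi>)"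
      by (rule integral_mult_right_zero)
    also have "\<dots> \<le> 2 * real (Suc m) / t\<^sup>2 * (C / real (Suc m))"
      unfolding C_def U_def by (intro mult_left_mono avg_rotation_small) auto
    also have "\<dots> = 2 * C / t\<^sup>2" by (simp del: of_nat_Suc)
    finally have 1: "(\<integral>x. \<phi> x * (U m x)\<^sup>2 \<partial>\<pi>) \<le> 2 * C / t\<^sup>2" .
    \<comment> \<open>Splitting off a root of the weight leaves U^2, the quantity controlled above,
      against the same weight.\<close>
    have "(\<integral>x. sqrt (\<phi> x) * (sqrt (\<phi> x) * U m x) \<partial>\<pi>)\<^sup>2
        \<le> (\<integral>x. (sqrt (\<phi> x))\<^sup>2 \<partial>\<pi>) * (\<integral>x. (sqrt (\<phi> x) * U m x)\<^sup>2 \<partial>\<pi>)"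
      using \<phi>i i1 \<phi>0 by (intro integral_cauchy_schwarz) (auto simp: power_mult_distrib)
    then have "(\<integral>x. \<phi> x * U m x \<partial>\<pi>)\<^sup>2 \<le> I * (\<integral>x. \<phi> x * (U m x)\<^sup>2 \<partial>\<pi>)"
      using \<phi>0 by (simp add: I_def power_mult_distrib mult.assoc[symmetric])
    also have "\<dots> \<le> I * (2 * C / t\<^sup>2)" using 1 I0 by (rule mult_left_mono)
    finally show ?thesis .
  qed
  define d where "d = (\<lambda>m. (\<integral>x. \<phi> x * U m x \<partial>\<pi>) - I * (\<integral>x. U m x \<partial>\<pi>))"
  have d: "d \<longlonglongrightarrow> 0"
    unfolding d_def I_def by (rule U_asymptotically_constant) (use \<phi>i in auto)
  obtain N :: nat where N: "(t * K)\<^sup>2 \<le> real N" using real_arch_simple by blast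
  have "I * (1 / 2) + d m \<le> sqrt (I * (2 * C / t\<^sup>2))" if "m \<ge> N" for m
  proof -
    have "I * (1 / 2) \<le> I * (\<integral>x. U m x \<partial>\<pi>)" using integral_U_ge I0 by (rule mult_left_mono)
    moreover have "(\<integral>x. \<phi> x * U m x \<partial>\<pi>) \<le> sqrt (I * (2 * C / t\<^sup>2))"
      using N that by (intro real_le_rsqrt main) auto
    ultimately show ?thesis by (simp add: d_def)
  qed
  then have "I * (1 / 2) + 0 \<le> sqrt (I * (2 * C / t\<^sup>2))"
    by (intro LIMSEQ_le_const2[OF tendsto_add[OF tendsto_const d]]) auto
  then have "(I / 2)\<^sup>2 \<le> (sqrt (I * (2 * C / t\<^sup>2)))\<^sup>2"
    using I0 by (intro power_mono) auto
  then have "I * I \<le> I * (8 * C / t\<^sup>2)"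
    using I0 C0 by (simp add: power2_eq_square mult_ac)
  then have "I \<le> 8 * C / t\<^sup>2"
    using I0 C0 mult_left_le_imp_le[of I I "8 * C / t\<^sup>2"] by (cases "I = 0") auto
  then show ?thesis by (simp add: I_def \<phi>_def C_def)
qed

text \<open>Fatou's lemma applies because the bound on truncated squares is uniform in the
  truncation level.\<close>

lemma h_L2: "h \<in> L2"
proof -
  define C where "C = 8 * (24 / \<delta> + 10) / t\<^sup>2"
  define \<phi> where "\<phi> = (\<lambda>K x. (h x)\<^sup>2 * indicator {x. \<bar>h x\<bar> \<le> real K} x)"
  have [measurable]: "\<phi> K \<in> borel_measurable borel" for K unfolding \<phi>_def by measurable
  have b: "\<bar>\<phi> K x\<bar> \<le> (real K)\<^sup>2" for x K
    using abs_le_square_iff[of "h x" "real K"] by (auto simp: \<phi>_def split: split_indicator)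
  have i: "integrable \<pi> (\<phi> K)" for K
    by (rule L2_integrable, rule bounded_L2[OF _ b]) simp
  have "integrable \<pi> (\<lambda>x. (h x)\<^sup>2)"
  proof (rule integrableI_nonneg)
    have "(\<integral>\<^sup>+x. ennreal ((h x)\<^sup>2) \<partial>\<pi>) = (\<integral>\<^sup>+x. liminf (\<lambda>K. ennreal (\<phi> K x)) \<partial>\<pi>)"
    proof (rule nn_integral_cong)
      fix x
      obtain N :: nat where N: "\<bar>h x\<bar> \<le> real N" using real_arch_simple by blast
      have "(\<lambda>K. ennreal (\<phi> K x)) \<longlonglongrightarrow> ennreal ((h x)\<^sup>2)"
        by (rule tendsto_eventually, rule eventually_mono[OF eventually_ge_at_top[of N]])
           (use N in \<open>auto simp: \<phi>_def\<close>)
      then show "ennreal ((h x)\<^sup>2) = liminf (\<lambda>K. ennreal (\<phi> K x))"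
        by (intro lim_imp_Liminf[symmetric]) auto
    qed
    also have "\<dots> \<le> liminf (\<lambda>K. \<integral>\<^sup>+x. ennreal (\<phi> K x) \<partial>\<pi>)"
      by (rule nn_integral_liminf) auto
    also have "\<dots> \<le> ennreal C"
    proof (rule Liminf_le)
      have "(\<integral>\<^sup>+x. ennreal (\<phi> K x) \<partial>\<pi>) = ennreal (\<integral>x. \<phi> K x \<partial>\<pi>)" for K
        using i by (intro nn_integral_eq_integral) (auto simp: \<phi>_def)
      then show "\<forall>\<^sub>F K in sequentially. (\<integral>\<^sup>+x. ennreal (\<phi> K x) \<partial>\<pi>) \<le> ennreal C"
        using truncated_square_le by (intro always_eventually allI) (simp add: \<phi>_def C_def ennreal_leI)
    qed simp
    also have "\<dots> < \<infinity>" by simp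
    finally show "(\<integral>\<^sup>+x. ennreal ((h x)\<^sup>2) \<partial>\<pi>) < \<infinity>" .
  qed auto
  then show ?thesis by (simp add: L2_def)
qed

text \<open>The imaginary part of the equation says that V - T V is sin \<theta> * U up to (1 - cos
  \<theta>) V and the error. Multiplied by sqrt n and paired with \<open>g\<close>, the sine term
  tends to t <g, h> times the mean of U, which is at least 1/2; the other corrections vanish, and
  the left side is bounded by energies.\<close>

lemma integral_mult_h_le_dirichlet:
  assumes g: "g \<in> L2"
  shows "t\<^sup>2 / 4 * (\<integral>x. g x * h x \<partial>\<pi>)\<^sup>2 \<le> 3 * (1 + 1 / \<delta>) * dirichlet g"
proof -
  have [measurable]: "g \<in> borel_measurable borel" using g by auto
  define r where "r = (\<lambda>m. sqrt (real (Suc m)))"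
  have r0: "r m > 0" and r2: "r m * r m = real (Suc m)" for m by (simp_all add: r_def)
  have r_inv: "(\<lambda>m. c / r m) \<longlonglongrightarrow> 0" for c
  proof -
    have "(\<lambda>m. sqrt (1 / real (Suc m))) \<longlonglongrightarrow> sqrt 0" by (intro tendsto_real_sqrt inverse_Suc_tendsto_0)
    then have "(\<lambda>m. c * sqrt (1 / real (Suc m))) \<longlonglongrightarrow> c * 0" by (intro tendsto_mult_left) simp
    then show ?thesis by (simp add: r_def real_sqrt_divide)
  qed
  have gh: "integrable \<pi> (\<lambda>x. \<bar>g x\<bar> * \<bar>h x\<bar>)"
    using integrable_abs[OF L2_mult[OF g h_L2]] by (simp add: abs_mult)
  have r\<theta>: "r m * \<theta> m x = t * h x" "\<bar>\<theta> m x\<bar> = t * \<bar>h x\<bar> / r m" for m x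
    using t by (simp_all add: \<theta>_def r_def abs_mult del: of_nat_Suc)
  define D where "D = sqrt (dirichlet g * (3 * (1 + 1 / \<delta>)))"
  have "0 \<le> (\<integral>z. (g (fst z) - g (snd z))\<^sup>2 \<partial>\<Gamma>)" by simp
  then have dir_nonneg: "0 \<le> dirichlet g" by (simp add: dirichlet_eq[OF g])
  have dL2: "(\<lambda>x. V m x - T (V m) x) \<in> L2" for m
    using L2_add[OF V_L2 L2_cmult[OF T_L2[OF V_L2], of "-1"]] by simp
  \<comment> \<open>The energy of \<open>V m\<close> is of order 1/n, which exactly compensates the
    factor sqrt n; the 3 is half of the 6 in \<open>avg_energy\<close>.\<close>
  have A: "\<bar>r m * (\<integral>x. g x * (V m x - T (V m) x) \<partial>\<pi>)\<bar> \<le> D" for m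
  proof -
    have "2 * dirichlet (V m) \<le> (1 + 1 / \<delta>) * (6 / real (Suc m))"
      using \<delta>_pos unfolding V_def
      by (intro order_trans[OF dirichlet_le_gap[OF V_L2[of m, unfolded V_def]]] mult_left_mono avg_energy) auto
    then have "dirichlet (V m) \<le> 3 * (1 + 1 / \<delta>) / real (Suc m)"
      by (simp add: field_simps del: of_nat_Suc)
    then have "dirichlet g * dirichlet (V m) \<le> dirichlet g * (3 * (1 + 1 / \<delta>) / real (Suc m))"
      using dir_nonneg by (rule mult_left_mono)
    with integral_mult_generator_le[OF g V_L2[of m]]
    have "(\<integral>x. g x * (V m x - T (V m) x) \<partial>\<pi>)\<^sup>2 \<le> dirichlet g * (3 * (1 + 1 / \<delta>)) / real (Suc m)"
      by simp
    then have "(r m * (\<integral>x. g x * (V m x - T (V m) x) \<partial>\<pi>))\<^sup>2 \<le> dirichlet g * (3 * (1 + 1 / \<delta>))"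
      using r2[of m] by (simp add: power_mult_distrib power2_eq_square[of "r m"] field_simps del: of_nat_Suc)
    then show ?thesis unfolding D_def by (intro real_le_rsqrt) simp
  qed
  \<comment> \<open>Pointwise the quadratic bound gives decay like 1 / r, while the linear bound
    gives the majorant t |g h|, integrable now that \<open>h\<close> is in L2.\<close>
  have B: "(\<lambda>m. \<integral>x. g x * (r m * (1 - cos (\<theta> m x)) * V m x) \<partial>\<pi>) \<longlonglongrightarrow> (\<integral>x. 0 \<partial>\<pi>)"
  proof (rule integral_dominated_convergence[where w="\<lambda>x. t * (\<bar>g x\<bar> * \<bar>h x\<bar>)"])
    show "integrable \<pi> (\<lambda>x. t * (\<bar>g x\<bar> * \<bar>h x\<bar>))" using gh by simp
    show "AE x in \<pi>. (\<lambda>m. g x * (r m * (1 - cos (\<theta> m x)) * V m x)) \<longlonglongrightarrow> 0"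
    proof (rule AE_I2, rule Lim_null_comparison)
      fix x
      show "\<forall>\<^sub>F m in sequentially. norm (g x * (r m * (1 - cos (\<theta> m x)) * V m x)) \<le> (\<bar>g x\<bar> * (t\<^sup>2 * (h x)\<^sup>2 / 2)) / r m"
      proof (intro always_eventually allI)
        fix m
        have "r m * (1 - cos (\<theta> m x)) \<le> r m * (\<bar>\<theta> m x\<bar>\<^sup>2 / 2)"
          using one_minus_cos_le_square[of "\<theta> m x"] r0[of m] by (intro mult_left_mono) auto
        also have "\<dots> = (t\<^sup>2 * (h x)\<^sup>2 / 2) / r m"
          unfolding r\<theta>(2) using r0[of m] by (simp add: power_mult_distrib power_divide power2_eq_square[of "r m"])
        finally have "\<bar>r m * (1 - cos (\<theta> m x)) * V m x\<bar> \<le> (t\<^sup>2 * (h x)\<^sup>2 / 2) / r m * 1"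
          unfolding abs_mult[of _ "V m x"] using r0[of m] cos_le_one[of "\<theta> m x"]
          by (intro mult_mono V_abs_le_1) auto
        then have "\<bar>g x\<bar> * \<bar>r m * (1 - cos (\<theta> m x)) * V m x\<bar> \<le> \<bar>g x\<bar> * ((t\<^sup>2 * (h x)\<^sup>2 / 2) / r m * 1)"
          by (rule mult_left_mono) simp
        then show "norm (g x * (r m * (1 - cos (\<theta> m x)) * V m x)) \<le> (\<bar>g x\<bar> * (t\<^sup>2 * (h x)\<^sup>2 / 2)) / r m"
          by (simp add: abs_mult)
      qed
      show "(\<lambda>m. (\<bar>g x\<bar> * (t\<^sup>2 * (h x)\<^sup>2 / 2)) / r m) \<longlonglongrightarrow> 0" by (rule r_inv)
    qed
    show "AE x in \<pi>. norm (g x * (r m * (1 - cos (\<theta> m x)) * V m x)) \<le> t * (\<bar>g x\<bar> * \<bar>h x\<bar>)" for m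
    proof (rule AE_I2)
      fix x
      have "r m * (1 - cos (\<theta> m x)) \<le> r m * \<bar>\<theta> m x\<bar>"
        using one_minus_cos_le_abs[of "\<theta> m x"] r0[of m] by (intro mult_left_mono) auto
      also have "\<dots> = t * \<bar>h x\<bar>"
        unfolding r\<theta>(2) using r0[of m] by simp
      finally have "\<bar>r m * (1 - cos (\<theta> m x)) * V m x\<bar> \<le> t * \<bar>h x\<bar> * 1"
        unfolding abs_mult[of _ "V m x"] using r0[of m] cos_le_one[of "\<theta> m x"] t
        by (intro mult_mono V_abs_le_1) auto
      then have "\<bar>g x\<bar> * \<bar>r m * (1 - cos (\<theta> m x)) * V m x\<bar> \<le> \<bar>g x\<bar> * (t * \<bar>h x\<bar> * 1)"
        by (rule mult_left_mono) simp
      then show "norm (g x * (r m * (1 - cos (\<theta> m x)) * V m x)) \<le> t * (\<bar>g x\<bar> * \<bar>h x\<bar>)"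
        by (simp add: abs_mult mult_ac)
    qed
  qed auto
  \<comment> \<open>Replaces the sine by its argument: the Taylor error is cubic and of order 1/n
    after scaling, again with a majorant linear in \<open>h\<close>.\<close>
  have S: "(\<lambda>m. \<integral>x. g x * ((r m * sin (\<theta> m x) - t * h x) * U m x) \<partial>\<pi>) \<longlonglongrightarrow> (\<integral>x. 0 \<partial>\<pi>)"
  proof (rule integral_dominated_convergence[where w="\<lambda>x. 2 * t * (\<bar>g x\<bar> * \<bar>h x\<bar>)"])
    show "integrable \<pi> (\<lambda>x. 2 * t * (\<bar>g x\<bar> * \<bar>h x\<bar>))" using gh by simp
    show "AE x in \<pi>. (\<lambda>m. g x * ((r m * sin (\<theta> m x) - t * h x) * U m x)) \<longlonglongrightarrow> 0"
    proof (rule AE_I2, rule Lim_null_comparison)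
      fix x
      show "\<forall>\<^sub>F m in sequentially. norm (g x * ((r m * sin (\<theta> m x) - t * h x) * U m x)) \<le> (\<bar>g x\<bar> * ((t * \<bar>h x\<bar>) ^ 3 / 6)) / real (Suc m)"
      proof (intro always_eventually allI)
        fix m
        have "\<bar>r m * sin (\<theta> m x) - t * h x\<bar> = r m * \<bar>sin (\<theta> m x) - \<theta> m x\<bar>"
          unfolding r\<theta>(1)[of m x, symmetric] right_diff_distrib[symmetric] abs_mult using r0[of m] by simp
        also have "\<dots> \<le> r m * (\<bar>\<theta> m x\<bar> ^ 3 / 6)"
          using r0[of m] by (intro mult_left_mono abs_sin_minus_le) auto
        also have "\<dots> = ((t * \<bar>h x\<bar>) ^ 3 / 6) / real (Suc m)"
          unfolding r\<theta>(2) r2[symmetric] using r0[of m] by (simp add: power_divide power3_eq_cube)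
        finally have "\<bar>(r m * sin (\<theta> m x) - t * h x) * U m x\<bar> \<le> ((t * \<bar>h x\<bar>) ^ 3 / 6) / real (Suc m) * 1"
          unfolding abs_mult[of _ "U m x"] using t by (intro mult_mono U_abs_le_1) auto
        then have "\<bar>g x\<bar> * \<bar>(r m * sin (\<theta> m x) - t * h x) * U m x\<bar> \<le> \<bar>g x\<bar> * (((t * \<bar>h x\<bar>) ^ 3 / 6) / real (Suc m) * 1)"
          by (rule mult_left_mono) simp
        then show "norm (g x * ((r m * sin (\<theta> m x) - t * h x) * U m x)) \<le> (\<bar>g x\<bar> * ((t * \<bar>h x\<bar>) ^ 3 / 6)) / real (Suc m)"
          by (simp add: abs_mult del: of_nat_Suc)
      qed
      show "(\<lambda>m. (\<bar>g x\<bar> * ((t * \<bar>h x\<bar>) ^ 3 / 6)) / real (Suc m)) \<longlonglongrightarrow> 0" by (rule inverse_Suc_tendsto_0)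
    qed
    show "AE x in \<pi>. norm (g x * ((r m * sin (\<theta> m x) - t * h x) * U m x)) \<le> 2 * t * (\<bar>g x\<bar> * \<bar>h x\<bar>)" for m
    proof (rule AE_I2)
      fix x
      have "\<bar>r m * sin (\<theta> m x)\<bar> \<le> r m * \<bar>\<theta> m x\<bar>"
        unfolding abs_mult[of "r m"] using abs_sin_x_le_abs_x[of "\<theta> m x"] r0[of m] by simp
      also have "\<dots> = t * \<bar>h x\<bar>" unfolding r\<theta>(2) using r0[of m] by simp
      finally have "\<bar>r m * sin (\<theta> m x) - t * h x\<bar> \<le> 2 * (t * \<bar>h x\<bar>)"
        using t abs_triangle_ineq4[of "r m * sin (\<theta> m x)" "t * h x"] by (simp add: abs_mult)
      then have "\<bar>(r m * sin (\<theta> m x) - t * h x) * U m x\<bar> \<le> 2 * (t * \<bar>h x\<bar>) * 1"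
        unfolding abs_mult[of _ "U m x"] using t by (intro mult_mono U_abs_le_1) auto
      then have "\<bar>g x\<bar> * \<bar>(r m * sin (\<theta> m x) - t * h x) * U m x\<bar> \<le> \<bar>g x\<bar> * (2 * (t * \<bar>h x\<bar>) * 1)"
        by (rule mult_left_mono) simp
      then show "norm (g x * ((r m * sin (\<theta> m x) - t * h x) * U m x)) \<le> 2 * t * (\<bar>g x\<bar> * \<bar>h x\<bar>)"
        by (simp add: abs_mult mult_ac)
    qed
  qed auto
  \<comment> \<open>Substituting the equation for T V reduces this to r (s e1 - c e2), whose size is
    at most r * 3/n = 3/r.\<close>
  define R where "R = (\<lambda>m x. r m * sin (\<theta> m x) * U m x - r m * (V m x - T (V m) x)
      + r m * (1 - cos (\<theta> m x)) * V m x)"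
  have [measurable]: "R m \<in> borel_measurable borel" for m unfolding R_def by measurable
  have R_le: "\<bar>R m x\<bar> \<le> 3 / r m" for m x
  proof (rule avg_equation[OF \<theta>_measurable, of "Suc m" m x, folded U_def V_def])
    fix e1 e2 :: real
    assume e: "\<bar>e1\<bar> \<le> 2 / real (Suc m)" "\<bar>e2\<bar> \<le> 1 / real (Suc m)"
      and eq: "U m x - e1 = cos (\<theta> m x) * T (U m) x - sin (\<theta> m x) * T (V m) x"
        "V m x - e2 = sin (\<theta> m x) * T (U m) x + cos (\<theta> m x) * T (V m) x"
    define c s where "c = cos (\<theta> m x)" and "s = sin (\<theta> m x)"
    have cs: "s\<^sup>2 + c\<^sup>2 = 1" "\<bar>c\<bar> \<le> 1" "\<bar>s\<bar> \<le> 1" by (simp_all add: c_def s_def)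
    have "c * (V m x - e2) - s * (U m x - e1) = (s\<^sup>2 + c\<^sup>2) * T (V m) x"
      unfolding eq c_def[symmetric] s_def[symmetric] by (simp add: power2_eq_square algebra_simps)
    then have TV: "T (V m) x = c * (V m x - e2) - s * (U m x - e1)" by (simp add: cs)
    have "R m x = r m * (s * e1 - c * e2)"
      unfolding R_def TV c_def[symmetric] s_def[symmetric] by (simp add: algebra_simps)
    moreover have "\<bar>s * e1 - c * e2\<bar> \<le> 3 / real (Suc m)"
    proof -
      have "\<bar>s * e1\<bar> \<le> 1 * (2 / real (Suc m))" "\<bar>c * e2\<bar> \<le> 1 * (1 / real (Suc m))"
        unfolding abs_mult by (intro mult_mono e cs; simp)+
      then show ?thesis by (simp add: add_divide_distrib[symmetric])
    qed
    ultimately have "\<bar>R m x\<bar> \<le> r m * (3 / real (Suc m))"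
      using mult_left_mono[of "\<bar>s * e1 - c * e2\<bar>" "3 / real (Suc m)" "r m"] r0[of m]
      by (simp add: abs_mult del: of_nat_Suc)
    also have "\<dots> = 3 / r m" unfolding r2[of m, symmetric] using r0[of m] by simp
    finally show ?thesis .
  qed simp
  have E: "(\<lambda>m. \<integral>x. g x * R m x \<partial>\<pi>) \<longlonglongrightarrow> 0"
  proof (rule Lim_null_comparison[OF _ r_inv])
    show "\<forall>\<^sub>F m in sequentially. norm (\<integral>x. g x * R m x \<partial>\<pi>) \<le> (3 * (\<integral>x. \<bar>g x\<bar> \<partial>\<pi>)) / r m"
    proof (intro always_eventually allI)
      fix m
      have "R m \<in> L2" by (rule bounded_L2[OF _ R_le]) simp
      then have "norm (\<integral>x. g x * R m x \<partial>\<pi>) \<le> (\<integral>x. norm (g x * R m x) \<partial>\<pi>)" by simp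
      also have "\<dots> \<le> (\<integral>x. \<bar>g x\<bar> * (3 / r m) \<partial>\<pi>)"
      proof (rule integral_mono)
        show "integrable \<pi> (\<lambda>x. norm (g x * R m x))"
          using L2_mult[OF g \<open>R m \<in> L2\<close>] by (rule integrable_norm)
        show "integrable \<pi> (\<lambda>x. \<bar>g x\<bar> * (3 / r m))"
          using L2_integrable[OF g] by (intro integrable_mult_left integrable_abs)
        show "norm (g x * R m x) \<le> \<bar>g x\<bar> * (3 / r m)" for x
          unfolding real_norm_def abs_mult by (intro mult_left_mono R_le) simp
      qed
      also have "\<dots> = (3 * (\<integral>x. \<bar>g x\<bar> \<partial>\<pi>)) / r m" by simp
      finally show "norm (\<integral>x. g x * R m x \<partial>\<pi>) \<le> (3 * (\<integral>x. \<bar>g x\<bar> \<partial>\<pi>)) / r m" .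
    qed
  qed
  define J where "J = (\<integral>x. g x * h x \<partial>\<pi>)"
  \<comment> \<open>All vanishing corrections at once, so that the limit is taken in a single
    inequality.\<close>
  define d where "d = (\<lambda>m. t * ((\<integral>x. g x * h x * U m x \<partial>\<pi>) - J * (\<integral>x. U m x \<partial>\<pi>))
     + (\<integral>x. g x * ((r m * sin (\<theta> m x) - t * h x) * U m x) \<partial>\<pi>)
     + (\<integral>x. g x * (r m * (1 - cos (\<theta> m x)) * V m x) \<partial>\<pi>)
     - (\<integral>x. g x * R m x \<partial>\<pi>))"
  have d: "d \<longlonglongrightarrow> 0"
  proof -
    have "(\<lambda>m. (\<integral>x. g x * h x * U m x \<partial>\<pi>) - J * (\<integral>x. U m x \<partial>\<pi>)) \<longlonglongrightarrow> 0"
      unfolding J_def using L2_mult[OF g h_L2] by (intro U_asymptotically_constant) auto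
    then have "d \<longlonglongrightarrow> t * 0 + 0 + 0 - 0"
      unfolding d_def using S B E by (intro tendsto_intros) auto
    then show ?thesis by simp
  qed
  have decomp: "t * (J * (\<integral>x. U m x \<partial>\<pi>)) + d m = r m * (\<integral>x. g x * (V m x - T (V m) x) \<partial>\<pi>)" for m
  proof -
    have RL: "R m \<in> L2" by (rule bounded_L2[OF _ R_le]) simp
    have cL: "(\<lambda>x. r m * (1 - cos (\<theta> m x)) * V m x) \<in> L2"
    proof (rule bounded_L2)
      show "\<bar>r m * (1 - cos (\<theta> m x)) * V m x\<bar> \<le> r m * 2 * 1" for x
        unfolding abs_mult using r0[of m] cos_ge_minus_one[of "\<theta> m x"] cos_le_one[of "\<theta> m x"]
        by (intro mult_mono V_abs_le_1) (auto simp del: cos_ge_minus_one cos_le_one)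
    qed simp
    have sL: "(\<lambda>x. r m * sin (\<theta> m x) * U m x) \<in> L2"
    proof (rule bounded_L2)
      show "\<bar>r m * sin (\<theta> m x) * U m x\<bar> \<le> r m * 1 * 1" for x
        unfolding abs_mult using r0[of m] by (intro mult_mono U_abs_le_1) auto
    qed simp
    have hU: "integrable \<pi> (\<lambda>x. g x * h x * U m x)"
      by (rule Bochner_Integration.integrable_bound[OF L2_mult[OF g h_L2]])
         (use U_abs_le_1[of m] in \<open>auto simp: abs_mult intro!: mult_left_le\<close>)
    have s_eq: "(\<integral>x. g x * ((r m * sin (\<theta> m x) - t * h x) * U m x) \<partial>\<pi>)
        = (\<integral>x. g x * (r m * sin (\<theta> m x) * U m x) \<partial>\<pi>) - t * (\<integral>x. g x * h x * U m x \<partial>\<pi>)"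
    proof -
      have "(\<integral>x. g x * ((r m * sin (\<theta> m x) - t * h x) * U m x) \<partial>\<pi>)
        = (\<integral>x. g x * (r m * sin (\<theta> m x) * U m x) - t * (g x * h x * U m x) \<partial>\<pi>)"
        by (intro Bochner_Integration.integral_cong) (auto simp: algebra_simps)
      then show ?thesis using L2_mult[OF g sL] hU by simp
    qed
    have "(\<integral>x. g x * (r m * sin (\<theta> m x) * U m x) \<partial>\<pi>) =
        (\<integral>x. r m * (g x * (V m x - T (V m) x)) - g x * (r m * (1 - cos (\<theta> m x)) * V m x) + g x * R m x \<partial>\<pi>)"
      by (intro Bochner_Integration.integral_cong) (auto simp: R_def algebra_simps)
    also have "\<dots> = r m * (\<integral>x. g x * (V m x - T (V m) x) \<partial>\<pi>)
        - (\<integral>x. g x * (r m * (1 - cos (\<theta> m x)) * V m x) \<partial>\<pi>) + (\<integral>x. g x * R m x \<partial>\<pi>)"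
      using L2_mult[OF g dL2[of m]] L2_mult[OF g cL] L2_mult[OF g RL] by simp
    finally show ?thesis unfolding d_def s_eq by (simp add: right_diff_distrib)
  qed
  have "t * \<bar>J\<bar> * (1 / 2) - \<bar>d m\<bar> \<le> D" for m
  proof -
    have "t * \<bar>J\<bar> * (1 / 2) \<le> t * \<bar>J\<bar> * (\<integral>x. U m x \<partial>\<pi>)"
      using t integral_U_ge[of m] by (intro mult_left_mono) auto
    also have "\<dots> = \<bar>t * (J * (\<integral>x. U m x \<partial>\<pi>))\<bar>"
      using t integral_U_ge[of m] by (simp add: abs_mult)
    finally show ?thesis using decomp[of m] A[of m] by linarith
  qed
  then have "t * \<bar>J\<bar> * (1 / 2) - \<bar>0\<bar> \<le> D"
    by (intro LIMSEQ_le_const2[OF tendsto_diff[OF tendsto_const tendsto_rabs[OF d]]]) auto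
  then have "(t * \<bar>J\<bar> / 2)\<^sup>2 \<le> D\<^sup>2" using t by (intro power_mono) auto
  then show ?thesis
    using dir_nonneg \<delta>_pos by (simp add: D_def J_def power_mult_distrib power_divide mult_ac)
qed

end

section \<open>Summability of the autocovariances\<close>

context char_fun_bounded_below
begin

text \<open>\<open>T_add_nonneg\<close> for T^k h. Odd lags may have negative autocovariance; paired
  with the preceding even lag they become nonnegative in sum.\<close>

lemma autocov_pair_ge: "2 * \<delta> * autocov h (2 * k) \<le> autocov h (2 * k) + autocov h (Suc (2 * k))"
proof -
  have "(\<integral>x. (T ^^ k) h x * T ((T ^^ k) h) x \<partial>\<pi>) = autocov h (Suc (2 * k))"
    using integral_T_power_mult[OF h_L2, of k "Suc k"] by (simp add: mult_2)
  then show ?thesis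
    using T_add_nonneg[OF T_power_L2[OF h_L2, of k]] by (simp add: integral_T_power_square[OF h_L2])
qed

text \<open>Writing B n for the sum, g = h + ... + T^(2n-1) h has <g, h> = B n, and telescoping
  gives its energy as B n - (B (2n) - B n) \<le> B n. The preceding inequality becomes t^2 / 4 * (B
  n)^2 \<le> 3 (1 + 1 / \<delta>) B n, which bounds B n itself.\<close>

lemma sum_autocov_bounded:
  "(\<Sum>k<n. autocov h (2 * k) + autocov h (Suc (2 * k))) \<le> 12 * (1 + 1 / \<delta>) / t\<^sup>2"
proof -
  define \<gamma> where "\<gamma> = autocov h"
  define B where "B = (\<lambda>n. \<Sum>k<n. \<gamma> (2 * k) + \<gamma> (Suc (2 * k)))"
  have B_eq: "B n = (\<Sum>j<2 * n. \<gamma> j)" for n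
    by (induction n) (simp_all add: B_def)
  have pair_nonneg: "0 \<le> \<gamma> (2 * k) + \<gamma> (Suc (2 * k))" for k
  proof -
    have "0 \<le> 2 * \<delta> * autocov h (2 * k)" using autocov_even_nonneg[OF h_L2, of k] \<delta>_pos by simp
    then show ?thesis using autocov_pair_ge[of k] unfolding \<gamma>_def by linarith
  qed
  have B_mono: "B n \<le> B (2 * n)" for n
    unfolding B_def using pair_nonneg by (intro sum_mono2) auto
  have B_nonneg: "0 \<le> B n" unfolding B_def using pair_nonneg by (intro sum_nonneg) auto
  define f where "f = (\<lambda>k. (T ^^ k) h)"
  have fL2: "f k \<in> L2" for k unfolding f_def by (rule T_power_L2[OF h_L2])
  \<comment> \<open>An even number of terms, so that every sum of autocovariances splits into the
    nonnegative pairs.\<close>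
  define g where "g = (\<lambda>x. \<Sum>k<2 * n. f k x)"
  have gL2: "g \<in> L2" unfolding g_def using fL2 by (intro L2_sum)
  have "(\<integral>x. g x * h x \<partial>\<pi>) = (\<Sum>k<2 * n. \<integral>x. f k x * h x \<partial>\<pi>)"
    unfolding g_def sum_distrib_right using L2_mult[OF fL2 h_L2]
    by (intro Bochner_Integration.integral_sum) auto
  also have "\<dots> = B n"
    unfolding B_eq \<gamma>_def autocov_def f_def by (simp add: mult.commute)
  finally have gh: "(\<integral>x. g x * h x \<partial>\<pi>) = B n" .
  have "(\<integral>x. (g x)\<^sup>2 \<partial>\<pi>) = (\<Sum>j<2 * n. \<Sum>k<2 * n. \<integral>x. f j x * f k x \<partial>\<pi>)"
    unfolding power2_eq_square g_def sum_product using L2_mult[OF fL2 fL2]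
    by (simp add: Bochner_Integration.integral_sum)
  also have "\<dots> = (\<Sum>j<2 * n. \<Sum>k<2 * n. \<gamma> (j + k))"
    unfolding f_def \<gamma>_def integral_T_power_mult[OF h_L2] ..
  finally have gg: "(\<integral>x. (g x)\<^sup>2 \<partial>\<pi>) = (\<Sum>j<2 * n. \<Sum>k<2 * n. \<gamma> (j + k))" .
  have "(\<integral>x. g x * T g x \<partial>\<pi>) = (\<integral>z. (\<Sum>j<2 * n. \<Sum>k<2 * n. f j (fst z) * f k (snd z)) \<partial>\<Gamma>)"
    using integral_\<Gamma>_product[OF gL2 gL2] by (simp add: g_def sum_product)
  also have "\<dots> = (\<Sum>j<2 * n. \<Sum>k<2 * n. \<integral>x. f j x * T (f k) x \<partial>\<pi>)"
    using integrable_\<Gamma>_product[OF fL2 fL2]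
    by (simp add: Bochner_Integration.integral_sum integral_\<Gamma>_product[OF fL2 fL2])
  also have "\<dots> = (\<Sum>j<2 * n. \<Sum>k<2 * n. \<gamma> (j + Suc k))"
    using integral_T_power_mult[OF h_L2, of _ "Suc _"] by (simp add: f_def \<gamma>_def)
  finally have gTg: "(\<integral>x. g x * T g x \<partial>\<pi>) = (\<Sum>j<2 * n. \<Sum>k<2 * n. \<gamma> (j + Suc k))" .
  have "dirichlet g = (\<Sum>j<2 * n. \<Sum>k<2 * n. \<gamma> (j + k) - \<gamma> (j + Suc k))"
    unfolding dirichlet_def gg gTg by (simp add: sum_subtractf)
  also have "\<dots> = (\<Sum>j<2 * n. \<gamma> j - \<gamma> (j + 2 * n))"
  proof (rule sum.cong[OF refl])
    show "(\<Sum>k<2 * n. \<gamma> (j + k) - \<gamma> (j + Suc k)) = \<gamma> j - \<gamma> (j + 2 * n)" for j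
      using sum_lessThan_telescope'[of "\<lambda>k. \<gamma> (j + k)" "2 * n"] by simp
  qed
  also have "\<dots> = B n - (\<Sum>j<2 * n. \<gamma> (j + 2 * n))"
    by (simp add: sum_subtractf B_eq)
  \<comment> \<open>Since \<open>B n\<close> covers the lags below 2n, the lags from 2n up to 4n
    form the next block.\<close>
  also have "(\<Sum>j<2 * n. \<gamma> (j + 2 * n)) = B (2 * n) - B n"
  proof -
    have "(\<Sum>j<2 * n. \<gamma> (j + 2 * n)) = sum \<gamma> {2 * n..<2 * (2 * n)}"
      using sum.shift_bounds_nat_ivl[where g=\<gamma> and m=0 and k="2 * n" and n="2 * n"]
      by (simp add: atLeast0LessThan)
    moreover have "sum \<gamma> {0..<2 * n} + sum \<gamma> {2 * n..<2 * (2 * n)} = sum \<gamma> {0..<2 * (2 * n)}"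
      by (rule sum.atLeastLessThan_concat) auto
    ultimately show ?thesis unfolding B_eq by (simp add: atLeast0LessThan)
  qed
  finally have "dirichlet g \<le> B n" using B_mono by simp
  then have "3 * (1 + 1 / \<delta>) * dirichlet g \<le> 3 * (1 + 1 / \<delta>) * B n"
    using \<delta>_pos by (intro mult_left_mono) auto
  with integral_mult_h_le_dirichlet[OF gL2]
  have "t\<^sup>2 / 4 * (B n)\<^sup>2 \<le> 3 * (1 + 1 / \<delta>) * B n" by (simp add: gh)
  then have "B n * (B n * t\<^sup>2) \<le> B n * (12 * (1 + 1 / \<delta>))"
    by (simp add: power2_eq_square algebra_simps)
  then have "B n * t\<^sup>2 \<le> 12 * (1 + 1 / \<delta>)"
    using B_nonneg \<delta>_pos by (cases "B n = 0") (auto simp: mult_le_cancel_left)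
  then show ?thesis using t by (simp add: B_def \<gamma>_def pos_le_divide_eq)
qed

text \<open>With b the sum of a pair and a its nonnegative even term, the absolute values in the
  pair add up to at most b + 2 a, and a \<le> b / (2 \<delta>). Bounded sums of pairs thus bound the
  absolute sums.\<close>

lemma summable_autocov: "summable (\<lambda>k. \<bar>autocov h k\<bar>)"
proof (rule summableI_nonneg_bounded)
  fix n
  define b where "b = (\<lambda>k. autocov h (2 * k) + autocov h (Suc (2 * k)))"
  have even: "2 * \<delta> * autocov h (2 * k) \<le> b k" for k
    unfolding b_def by (rule autocov_pair_ge)
  have b0: "0 \<le> b k" for k
  proof -
    have "0 \<le> 2 * \<delta> * autocov h (2 * k)" using autocov_even_nonneg[OF h_L2, of k] \<delta>_pos by simp
    then show ?thesis using even[of k] by linarith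
  qed
  have pair: "\<bar>autocov h (2 * k)\<bar> + \<bar>autocov h (Suc (2 * k))\<bar> \<le> (1 + 1 / \<delta>) * b k" for k
  proof -
    have "2 * autocov h (2 * k) \<le> b k / \<delta>"
      using even[of k] \<delta>_pos by (simp add: pos_le_divide_eq mult_ac)
    moreover have "\<bar>autocov h (2 * k)\<bar> + \<bar>autocov h (Suc (2 * k))\<bar> \<le> b k + 2 * autocov h (2 * k)"
      using autocov_even_nonneg[OF h_L2, of k] b0[of k] unfolding b_def by linarith
    ultimately show ?thesis by (simp add: distrib_right)
  qed
  have "(\<Sum>k<n. \<bar>autocov h k\<bar>) \<le> (\<Sum>k<2 * n. \<bar>autocov h k\<bar>)"
    by (intro sum_mono2) auto
  also have "\<dots> = (\<Sum>k<n. \<bar>autocov h (2 * k)\<bar> + \<bar>autocov h (Suc (2 * k))\<bar>)"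
    by (induction n) simp_all
  also have "\<dots> \<le> (1 + 1 / \<delta>) * (\<Sum>k<n. b k)"
    unfolding sum_distrib_left by (intro sum_mono pair)
  also have "\<dots> \<le> (1 + 1 / \<delta>) * (12 * (1 + 1 / \<delta>) / t\<^sup>2)"
    unfolding b_def using \<delta>_pos by (intro mult_left_mono sum_autocov_bounded) auto
  finally show "(\<Sum>k<n. \<bar>autocov h k\<bar>) \<le> (1 + 1 / \<delta>) * (12 * (1 + 1 / \<delta>) / t\<^sup>2)" .
qed simp

end

section \<open>Cesaro means\<close>

lemma cesaro_mean_tendsto_0:
  fixes a :: "nat \<Rightarrow> real"
  assumes "a \<longlonglongrightarrow> 0"
  shows "(\<lambda>n. (\<Sum>j<n. a j) / real n) \<longlonglongrightarrow> 0"
proof (rule LIMSEQ_zero_approx)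
  fix \<epsilon> :: real assume "\<epsilon> > 0"
  with assms obtain N where N: "\<And>j. j \<ge> N \<Longrightarrow> \<bar>a j\<bar> < \<epsilon>"
    unfolding LIMSEQ_iff by (metis diff_zero real_norm_def)
  define K where "K = (\<Sum>j<N. \<bar>a j\<bar>)"
  show "\<exists>b. b \<longlonglongrightarrow> 0 \<and> (\<forall>n. \<bar>(\<Sum>j<n. a j) / real n\<bar> \<le> \<bar>b n\<bar> + \<epsilon>)"
  proof (intro exI conjI allI)
    show "(\<lambda>n. K / real n) \<longlonglongrightarrow> 0" by (rule lim_const_over_n)
    fix n
    have "\<bar>a j\<bar> \<le> (if j < N then \<bar>a j\<bar> else 0) + \<epsilon>" for j
      using N[of j] \<open>\<epsilon> > 0\<close> by (cases "j < N") auto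
    then have "(\<Sum>j<n. \<bar>a j\<bar>) \<le> (\<Sum>j<n. (if j < N then \<bar>a j\<bar> else 0) + \<epsilon>)"
      by (intro sum_mono)
    also have "\<dots> = (\<Sum>j<n. if j < N then \<bar>a j\<bar> else 0) + \<epsilon> * real n"
      by (simp add: sum.distrib)
    also have "(\<Sum>j<n. if j < N then \<bar>a j\<bar> else 0) \<le> K"
      unfolding K_def sum.inter_restrict[symmetric, OF finite_lessThan] sum.If_cases[OF finite_lessThan]
      by simp (intro sum_mono2, auto)
    finally have "\<bar>\<Sum>j<n. a j\<bar> \<le> K + \<epsilon> * real n"
      using sum_abs[of a "{..<n}"] by linarith
    then have "\<bar>\<Sum>j<n. a j\<bar> / real n \<le> (K + \<epsilon> * real n) / real n" by (rule divide_right_mono) simp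
    also have "\<dots> \<le> K / real n + \<epsilon>" using \<open>\<epsilon> > 0\<close> by (simp add: add_divide_distrib)
    finally have "\<bar>(\<Sum>j<n. a j) / real n\<bar> \<le> K / real n + \<epsilon>" by simp
    then show "\<bar>(\<Sum>j<n. a j) / real n\<bar> \<le> \<bar>K / real n\<bar> + \<epsilon>"
      using abs_ge_self[of "K / real n"] by linarith
  qed
qed

lemma cesaro_mean:
  fixes c :: "nat \<Rightarrow> real"
  assumes "c \<longlonglongrightarrow> l"
  shows "(\<lambda>n. (\<Sum>j<n. c j) / real n) \<longlonglongrightarrow> l"
proof -
  have "(\<lambda>j. c j - l) \<longlonglongrightarrow> 0" using assms by (simp add: LIM_zero)
  from cesaro_mean_tendsto_0[OF this]
  have "(\<lambda>n. (\<Sum>j<n. c j - l) / real n + l) \<longlonglongrightarrow> 0 + l" by (intro tendsto_add tendsto_const)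
  moreover have "\<forall>\<^sub>F n in sequentially. (\<Sum>j<n. c j - l) / real n + l = (\<Sum>j<n. c j) / real n"
    using eventually_gt_at_top[of 0] by eventually_elim (simp add: sum_subtractf field_simps)
  ultimately show ?thesis by (simp add: tendsto_cong)
qed

section \<open>The stationary chain\<close>

locale stationary_reversible_chain = reversible_chain +
  fixes M :: "'b measure" and X :: "nat \<Rightarrow> 'b \<Rightarrow> 'a"
  assumes chain: "stationary_markov_chain M X P \<pi>"
begin

sublocale M: prob_space M
  using chain by (simp add: stationary_markov_chain_def markov_chain_def)

lemma X_measurable [measurable]: "X n \<in> M \<rightarrow>\<^sub>M borel"
  using chain by (simp add: stationary_markov_chain_def markov_chain_def)

lemma distr_X0: "distr M borel (X 0) = \<pi>"
  using chain by (simp add: stationary_markov_chain_def)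

abbreviation "past \<equiv> past_algebra M X"

lemma space_past [simp]: "space (past n) = space M"
  by (simp add: past_algebra_def space_measure_of_conv)

lemma sets_past:
  "sets (past n) = sigma_sets (space M) (\<Union>k\<le>n. sets (vimage_algebra (space M) (X k) borel))"
  unfolding past_algebra_def by (rule sets_measure_of) (use sets.space_closed in fastforce)

lemma subalgebra_past: "subalgebra M (past n)"
proof -
  have "sets (past n) \<subseteq> sets M"
    unfolding sets_past
  proof (rule sets.sigma_sets_subset)
    show "(\<Union>k\<le>n. sets (vimage_algebra (space M) (X k) borel)) \<subseteq> sets M"
      by (auto simp: sets_vimage_algebra2 intro!: measurable_sets[OF X_measurable])
  qed
  then show ?thesis by (simp add: subalgebra_def)
qed

lemma X_measurable_past [measurable]:
  assumes "k \<le> n"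
  shows "X k \<in> past n \<rightarrow>\<^sub>M borel"
proof (rule measurableI)
  fix A :: "'a set" assume "A \<in> sets borel"
  then have "X k -` A \<inter> space M \<in> sets (vimage_algebra (space M) (X k) borel)"
    by (auto simp: sets_vimage_algebra2)
  then show "X k -` A \<inter> space (past n) \<in> sets (past n)"
    using assms unfolding sets_past by auto
qed simp

lemma cond_prob_past:
  assumes "B \<in> sets borel"
  shows "AE \<omega> in M. real_cond_exp M (past n) (\<lambda>\<omega>. indicator B (X (Suc n) \<omega>)) \<omega> = measure (P (X n \<omega>)) B"
  using chain assms by (simp add: stationary_markov_chain_def markov_chain_def)

lemma sigma_finite_subalgebra_past: "sigma_finite_subalgebra M (past n)"
  by (rule finite_measure_subalgebra_is_sigma_finite)
     (simp add: finite_measure_subalgebra_def finite_measure_subalgebra_axioms_def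
       subalgebra_past M.finite_measure_axioms)

text \<open>The Markov property on a past event, put as an identity of measures. In this form the
  passage from indicators to integrable functions is \<open>integral_bind\<close>, with no
  approximation by simple functions.\<close>

lemma distr_density_step:
  assumes A: "A \<in> sets (past n)"
  shows "distr (density M (indicator A)) borel (X (Suc n)) = distr (density M (indicator A)) borel (X n) \<bind> P"
proof (rule measure_eqI)
  have AM [measurable]: "A \<in> sets M" using A subalgebra_past by (auto simp: subalgebra_def)
  let ?D = "density M (indicator A)"
  have Pm: "P \<in> distr ?D borel (X n) \<rightarrow>\<^sub>M subprob_algebra borel" by simp
  show "sets (distr ?D borel (X (Suc n))) = sets (distr ?D borel (X n) \<bind> P)"
    by (subst sets_bind[OF sets_kernel[OF Pm]]) auto
  fix B assume "B \<in> sets (distr ?D borel (X (Suc n)))"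
  then have B [measurable]: "B \<in> sets borel" by simp
  interpret F: sigma_finite_subalgebra M "past n" by (rule sigma_finite_subalgebra_past)
  let ?I = "\<lambda>\<omega>. indicator A \<omega> * indicator B (X (Suc n) \<omega>) :: real"
  let ?J = "\<lambda>\<omega>. indicator A \<omega> * measure (P (X n \<omega>)) B"
  have mB [measurable]: "(\<lambda>\<omega>. measure (P (X n \<omega>)) B) \<in> borel_measurable M"
    by (rule measurable_compose[OF X_measurable])
       (rule measurable_compose[OF P_measurable measurable_measure_subprob_algebra[OF B]])
  have I: "integrable M ?I"
    by (rule M.integrable_const_bound[where B=1]) (auto split: split_indicator)
  have J: "integrable M ?J"
    by (rule M.integrable_const_bound[where B=1]) (auto split: split_indicator simp: prob_space.prob_le_1)
  have IJ: "(\<integral>\<omega>. ?I \<omega> \<partial>M) = (\<integral>\<omega>. ?J \<omega> \<partial>M)"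
  proof -
    have "(\<integral>\<omega>. ?I \<omega> \<partial>M)
        = (\<integral>\<omega>. indicator A \<omega> * real_cond_exp M (past n) (\<lambda>\<omega>. indicator B (X (Suc n) \<omega>)) \<omega> \<partial>M)"
      using A I by (intro F.real_cond_exp_intg(2)[symmetric]) auto
    also have "\<dots> = (\<integral>\<omega>. ?J \<omega> \<partial>M)"
      using cond_prob_past[OF B, of n] by (intro integral_cong_AE) (auto elim: eventually_mono)
    finally show ?thesis .
  qed
  have "emeasure (distr ?D borel (X (Suc n))) B = (\<integral>\<^sup>+\<omega>. ennreal (?I \<omega>) \<partial>M)"
    by (subst emeasure_distr)
       (auto simp: emeasure_density intro!: nn_integral_cong split: split_indicator)
  also have "\<dots> = (\<integral>\<^sup>+\<omega>. ennreal (?J \<omega>) \<partial>M)"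
    using I J IJ by (simp add: nn_integral_eq_integral)
  also have "\<dots> = (\<integral>\<^sup>+\<omega>. indicator A \<omega> * emeasure (P (X n \<omega>)) B \<partial>M)"
    by (intro nn_integral_cong)
       (simp add: finite_measure.emeasure_eq_measure[OF prob_space.finite_measure[OF prob_space_P]]
         split: split_indicator)
  also have "\<dots> = emeasure (distr ?D borel (X n) \<bind> P) B"
    by (subst emeasure_bind[OF _ Pm B]) (simp_all add: nn_integral_distr nn_integral_density)
  finally show "emeasure (distr ?D borel (X (Suc n))) B = emeasure (distr ?D borel (X n) \<bind> P) B" .
qed

lemma distr_X: "distr M borel (X n) = \<pi>"
proof (induction n)
  case (Suc n)
  have "density M (indicator (space M)) = M"
    by (subst density_1[symmetric]) (intro density_cong, auto)
  then show ?case
    using distr_density_step[of "space M" n] Suc sets.top[of "past n"] by (simp add: bind_\<pi>)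
qed (rule distr_X0)

lemma X_integral:
  fixes f :: "'a \<Rightarrow> real"
  assumes [measurable]: "f \<in> borel_measurable borel"
  shows integrable_X: "integrable M (\<lambda>\<omega>. f (X n \<omega>)) \<longleftrightarrow> integrable \<pi> f"
    and integral_X: "(\<integral>\<omega>. f (X n \<omega>) \<partial>M) = (\<integral>x. f x \<partial>\<pi>)"
proof -
  show "integrable M (\<lambda>\<omega>. f (X n \<omega>)) \<longleftrightarrow> integrable \<pi> f"
    by (subst distr_X[of n, symmetric]) (simp add: integrable_distr_eq)
  show "(\<integral>\<omega>. f (X n \<omega>) \<partial>M) = (\<integral>x. f x \<partial>\<pi>)"
    by (subst distr_X[of n, symmetric]) (simp add: integral_distr)
qed

lemma cond_exp_past:
  assumes [measurable]: "f \<in> borel_measurable borel" and f: "integrable \<pi> f"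
  shows "AE \<omega> in M. real_cond_exp M (past n) (\<lambda>\<omega>. f (X (Suc n) \<omega>)) \<omega> = T f (X n \<omega>)"
proof -
  interpret F: sigma_finite_subalgebra M "past n" by (rule sigma_finite_subalgebra_past)
  have [measurable]: "X n \<in> past n \<rightarrow>\<^sub>M borel" by (rule X_measurable_past) simp
  have i: "integrable M (\<lambda>\<omega>. f (X (Suc n) \<omega>))" using f by (simp add: integrable_X)
  show ?thesis
  proof (rule F.real_cond_exp_charact)
    fix A assume A: "A \<in> sets (past n)"
    then have AM [measurable]: "A \<in> sets M" using subalgebra_past by (auto simp: subalgebra_def)
    let ?D = "density M (\<lambda>x. ennreal (indicator A x))"
    have D: "distr ?D borel (X (Suc n)) = distr ?D borel (X n) \<bind> P"
      using distr_density_step[OF A] by (simp add: ennreal_indicator)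
    have Pm: "P \<in> distr ?D borel (X n) \<rightarrow>\<^sub>M subprob_algebra borel" by simp
    have "integrable (distr ?D borel (X (Suc n))) f"
      using integrable_mult_indicator[OF AM i]
      by (simp add: integrable_distr_eq integrable_density)
    then have "(\<integral>x. f x \<partial>distr ?D borel (X (Suc n))) = (\<integral>x. T f x \<partial>distr ?D borel (X n))"
      unfolding D T_def by (intro integral_bind[OF Pm]) (auto simp: M.not_empty)
    then show "(\<integral>\<omega>\<in>A. f (X (Suc n) \<omega>) \<partial>M) = (\<integral>\<omega>\<in>A. T f (X n \<omega>) \<partial>M)"
      by (simp add: integral_distr integral_density set_lebesgue_integral_def)
  qed (use i integrable_T[OF assms] in \<open>auto simp: integrable_X\<close>)
qed

lemma markov_step:
  assumes [measurable]: "f \<in> borel_measurable borel" and f: "integrable \<pi> f"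
    and Z [measurable]: "Z \<in> borel_measurable (past n)"
    and Zf: "integrable M (\<lambda>\<omega>. Z \<omega> * f (X (Suc n) \<omega>))"
  shows "(\<integral>\<omega>. Z \<omega> * f (X (Suc n) \<omega>) \<partial>M) = (\<integral>\<omega>. Z \<omega> * T f (X n \<omega>) \<partial>M)"
proof -
  interpret F: sigma_finite_subalgebra M "past n" by (rule sigma_finite_subalgebra_past)
  have [measurable]: "Z \<in> borel_measurable M"
    using Z by (rule measurable_from_subalg[OF subalgebra_past])
  have "(\<integral>\<omega>. Z \<omega> * f (X (Suc n) \<omega>) \<partial>M)
      = (\<integral>\<omega>. Z \<omega> * real_cond_exp M (past n) (\<lambda>\<omega>. f (X (Suc n) \<omega>)) \<omega> \<partial>M)"
    by (rule F.real_cond_exp_intg(2)[symmetric, OF Zf]) measurable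
  also have "\<dots> = (\<integral>\<omega>. Z \<omega> * T f (X n \<omega>) \<partial>M)"
    using cond_exp_past[OF assms(1) f, of n] by (intro integral_cong_AE) (auto elim: eventually_mono)
  finally show ?thesis .
qed

lemma integrable_X_product:
  assumes f: "f \<in> L2" and g: "g \<in> L2"
  shows "integrable M (\<lambda>\<omega>. f (X i \<omega>) * g (X j \<omega>))"
proof -
  have [measurable]: "f \<in> borel_measurable borel" "g \<in> borel_measurable borel" using f g by auto
  show ?thesis
    using L2_square[OF f] L2_square[OF g] integrable_X[of "\<lambda>x. (f x)\<^sup>2"] integrable_X[of "\<lambda>x. (g x)\<^sup>2"]
    by (intro integrable_mult_squares) auto
qed

text \<open>The steps are peeled off at the later time; each replaces the second function by its
  image under T, so the induction has to be general in \<open>g\<close>.\<close>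

lemma integral_X_product:
  assumes f: "f \<in> L2" and g: "g \<in> L2"
  shows "(\<integral>\<omega>. f (X i \<omega>) * g (X (i + k) \<omega>) \<partial>M) = (\<integral>x. f x * (T ^^ k) g x \<partial>\<pi>)"
  using g
proof (induction k arbitrary: g)
  case 0
  then have [measurable]: "g \<in> borel_measurable borel" by auto
  have [measurable]: "f \<in> borel_measurable borel" using f by auto
  show ?case using integral_X[of "\<lambda>x. f x * g x" i] by simp
next
  case (Suc k)
  then have [measurable]: "g \<in> borel_measurable borel" by auto
  have [measurable]: "f \<in> borel_measurable borel" using f by auto
  have [measurable]: "X i \<in> past (i + k) \<rightarrow>\<^sub>M borel" by (rule X_measurable_past) simp
  have "(\<integral>\<omega>. f (X i \<omega>) * g (X (Suc (i + k)) \<omega>) \<partial>M) = (\<integral>\<omega>. f (X i \<omega>) * T g (X (i + k) \<omega>) \<partial>M)"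
    by (rule markov_step[OF _ L2_integrable[OF Suc.prems] _ integrable_X_product[OF f Suc.prems]]) measurable
  also have "\<dots> = (\<integral>x. f x * (T ^^ k) (T g) x \<partial>\<pi>)" by (rule Suc.IH[OF T_L2[OF Suc.prems]])
  finally show ?case by (simp add: funpow_swap1)
qed

text \<open>\<open>G j m\<close> interpolates: the first j summands are read along the chain, the
  other m through the kernel. One Markov step together with the addition formulas trades one
  summand, so the value depends on j + m only.\<close>

lemma integral_char_re:
  assumes \<theta> [measurable]: "\<theta> \<in> borel_measurable borel"
  shows "(\<integral>x. char_re \<theta> k x \<partial>\<pi>) = (\<integral>\<omega>. cos (partial_sum \<theta> X k \<omega>) \<partial>M)"
proof -
  define G where "G j m = (\<integral>\<omega>. cos (partial_sum \<theta> X j \<omega>) * char_re \<theta> m (X j \<omega>)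
      - sin (partial_sum \<theta> X j \<omega>) * char_im \<theta> m (X j \<omega>) \<partial>M)" for j m
  have ps [measurable]: "partial_sum \<theta> X j \<in> borel_measurable (past n)" if "j \<le> Suc n" for j n
    unfolding partial_sum_def[abs_def]
    by (rule borel_measurable_sum, rule measurable_compose[OF X_measurable_past \<theta>]) (use that in auto)
  have psM [measurable]: "partial_sum \<theta> X j \<in> borel_measurable M" for j
    unfolding partial_sum_def[abs_def] by measurable
  have bnd: "\<bar>char_re \<theta> k x\<bar> \<le> 1" "\<bar>char_im \<theta> k x\<bar> \<le> 1" for k x
    using abs_le_1_of_squares[OF char_fun_bounded[OF \<theta>]] by auto
  have L: "char_re \<theta> m \<in> L2" "char_im \<theta> m \<in> L2" for m
    by (rule bounded_L2[where K=1]; use bnd in auto)+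
  have ib: "integrable M (\<lambda>\<omega>. c \<omega> * f (X j \<omega>))"
    if [measurable]: "c \<in> borel_measurable M" "f \<in> borel_measurable borel"
      and "\<And>\<omega>. \<bar>c \<omega>\<bar> \<le> 1" "\<And>x. \<bar>f x\<bar> \<le> 1" for c :: "'b \<Rightarrow> real" and f :: "'a \<Rightarrow> real" and j
  proof (rule M.integrable_const_bound[where B=1])
    show "AE \<omega> in M. norm (c \<omega> * f (X j \<omega>)) \<le> 1"
      using mult_mono[OF that(3) that(4)] by (auto simp: abs_mult)
  qed measurable
  have step: "G (Suc j) m = G j (Suc m)" for j m
  proof -
    let ?S = "partial_sum \<theta> X (Suc j)"
    have S: "?S \<omega> = partial_sum \<theta> X j \<omega> + \<theta> (X j \<omega>)" for \<omega> by (simp add: partial_sum_def)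
    have [measurable]: "?S \<in> borel_measurable (past j)" by (rule ps) simp
    have Tb: "\<bar>T (char_re \<theta> m) x\<bar> \<le> 1" "\<bar>T (char_im \<theta> m) x\<bar> \<le> 1" for x
      by (rule T_bounded; use bnd in simp)+
    have "G (Suc j) m = (\<integral>\<omega>. cos (?S \<omega>) * char_re \<theta> m (X (Suc j) \<omega>) \<partial>M)
        - (\<integral>\<omega>. sin (?S \<omega>) * char_im \<theta> m (X (Suc j) \<omega>) \<partial>M)"
      unfolding G_def by (intro Bochner_Integration.integral_diff ib bnd) auto
    also have "(\<integral>\<omega>. cos (?S \<omega>) * char_re \<theta> m (X (Suc j) \<omega>) \<partial>M)
        = (\<integral>\<omega>. cos (?S \<omega>) * T (char_re \<theta> m) (X j \<omega>) \<partial>M)"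
      by (intro markov_step ib bnd L2_integrable L) auto
    also have "(\<integral>\<omega>. sin (?S \<omega>) * char_im \<theta> m (X (Suc j) \<omega>) \<partial>M)
        = (\<integral>\<omega>. sin (?S \<omega>) * T (char_im \<theta> m) (X j \<omega>) \<partial>M)"
      by (intro markov_step ib bnd L2_integrable L) auto
    also have "(\<integral>\<omega>. cos (?S \<omega>) * T (char_re \<theta> m) (X j \<omega>) \<partial>M)
          - (\<integral>\<omega>. sin (?S \<omega>) * T (char_im \<theta> m) (X j \<omega>) \<partial>M)
        = (\<integral>\<omega>. cos (?S \<omega>) * T (char_re \<theta> m) (X j \<omega>) - sin (?S \<omega>) * T (char_im \<theta> m) (X j \<omega>) \<partial>M)"
      by (intro Bochner_Integration.integral_diff[symmetric] ib Tb) auto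
    also have "\<dots> = G j (Suc m)"
      unfolding G_def by (simp add: S cos_add sin_add algebra_simps)
    finally show ?thesis .
  qed
  have "G j m = G 0 (j + m)" for j m
    by (induction j arbitrary: m) (simp_all add: step)
  from this[of k 0] have "G k 0 = G 0 k" by simp
  then show ?thesis
    using integral_X[of "char_re \<theta> k" 0] by (simp add: G_def partial_sum_def)
qed

text \<open>Off an event of probability below 1/8 the angle is at most 1/2 and the cosine at least
  7/8, leaving 7/8 - 15/8 * 1/8 > 1/2. Tightness of S_k / sqrt k covers all k \<le> n because sqrt k
  \<le> sqrt n.\<close>

lemma integral_cos_ge:
  assumes h [measurable]: "h \<in> borel_measurable borel"
    and "sqrt_bounded_in_probability M (partial_sum h X)"
  obtains t where "t > 0"
    "\<And>n k. k \<le> n \<Longrightarrow> n > 0 \<Longrightarrow> 1 / 2 \<le> (\<integral>\<omega>. cos (t / sqrt (real n) * partial_sum h X k \<omega>) \<partial>M)"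
proof -
  let ?p = "\<lambda>N n. measure M {\<omega> \<in> space M. \<bar>partial_sum h X n \<omega> / sqrt (real n)\<bar> \<ge> N}"
  have psM [measurable]: "partial_sum h X j \<in> borel_measurable M" for j
    unfolding partial_sum_def[abs_def] by measurable
  have "\<forall>\<^sub>F N in at_top. dist (SUP n\<in>{1..}. ?p N n) 0 < 1 / 8"
    using assms(2) unfolding sqrt_bounded_in_probability_def by (rule tendstoD) simp
  then have "\<forall>\<^sub>F N in at_top. (SUP n\<in>{1..}. ?p N n) < 1 / 8 \<and> N > (0::real)"
    using eventually_gt_at_top[of 0] by eventually_elim (auto simp: dist_real_def)
  then obtain N :: real where N: "(SUP n\<in>{1..}. ?p N n) < 1 / 8" "N > 0"
    by (auto dest: eventually_happens)
  have p: "?p N n < 1 / 8" if "n \<ge> 1" for n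
  proof -
    \<comment> \<open>A real supremum dominates its members only when they are bounded
      above.\<close>
    have "bdd_above (?p N ` {1..})" by (rule bdd_aboveI[of _ 1]) auto
    then have "?p N n \<le> (SUP n\<in>{1..}. ?p N n)" using that by (intro cSUP_upper) auto
    then show ?thesis using N by simp
  qed
  \<comment> \<open>Chosen so that |S_k| < N sqrt k makes the angle at most 1/2.\<close>
  define t where "t = 1 / (2 * N)"
  have t: "t > 0" "t * N = 1 / 2" using N by (simp_all add: t_def)
  show thesis
  proof
    show "t > 0" by (rule t)
    fix n k :: nat assume kn: "k \<le> n" "n > 0"
    show "1 / 2 \<le> (\<integral>\<omega>. cos (t / sqrt (real n) * partial_sum h X k \<omega>) \<partial>M)"
    \<comment> \<open>The tightness bound covers positive times only; the empty sum has cosine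
      1.\<close>
    proof (cases "k = 0")
      case True
      then show ?thesis using M.prob_space by (simp add: partial_sum_def)
    next
      case False
      define E where "E = {\<omega> \<in> space M. \<bar>partial_sum h X k \<omega> / sqrt (real k)\<bar> \<ge> N}"
      have [measurable]: "E \<in> sets M" unfolding E_def by measurable
      \<comment> \<open>On the bad event this equals -1, the least value of the cosine.\<close>
      have "7 / 8 - 15 / 8 * indicator E \<omega> \<le> cos (t / sqrt (real n) * partial_sum h X k \<omega>)"
        if "\<omega> \<in> space M" for \<omega>
      proof (cases "\<omega> \<in> E")
        case True
        then show ?thesis using cos_ge_minus_one[of "t / sqrt (real n) * partial_sum h X k \<omega>"] by simp
      next
        case nE: False
        define y where "y = t / sqrt (real n) * partial_sum h X k \<omega>"
        have "\<bar>partial_sum h X k \<omega>\<bar> < N * sqrt (real k)"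
          using nE that False by (simp add: E_def not_le divide_less_eq)
        also have "\<dots> \<le> N * sqrt (real n)" using kn N by simp
        finally have "t * \<bar>partial_sum h X k \<omega>\<bar> \<le> t * (N * sqrt (real n))"
          using t by (intro mult_left_mono) auto
        then have "t * \<bar>partial_sum h X k \<omega>\<bar> \<le> 1 / 2 * sqrt (real n)"
          using t by (simp add: mult.assoc[symmetric])
        then have "\<bar>y\<bar> \<le> 1 / 2"
          using t kn by (simp add: y_def abs_mult field_simps)
        then have "y\<^sup>2 \<le> (1 / 2)\<^sup>2"
          by (subst abs_le_square_iff[symmetric]) simp
        then have "7 / 8 \<le> cos y"
          using one_minus_cos_le_square[of y] by (simp add: power2_eq_square)
        then show ?thesis using nE by (simp add: y_def)
      qed
      then have "(\<integral>\<omega>. 7 / 8 - 15 / 8 * indicator E \<omega> \<partial>M) \<le> (\<integral>\<omega>. cos (t / sqrt (real n) * partial_sum h X k \<omega>) \<partial>M)"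
        by (intro integral_mono M.integrable_const_bound[where B=1] Bochner_Integration.integrable_diff
             integrable_mult_right integrable_real_indicator) (auto simp: M.emeasure_eq_measure)
      moreover have "(\<integral>\<omega>. 7 / 8 - 15 / 8 * indicator E \<omega> \<partial>M) = 7 / 8 - 15 / 8 * measure M E"
        using M.prob_space
        by (subst Bochner_Integration.integral_diff) (auto simp: M.emeasure_eq_measure)
      moreover have "measure M E < 1 / 8" unfolding E_def using False by (intro p) auto
      ultimately show ?thesis by simp
    qed
  qed
qed

text \<open>The variance is the sum of its increments, and these converge by summability; hence the
  variance divided by n is a Cesaro mean with the same limit.\<close>

lemma variance_tendsto:
  assumes h: "h \<in> L2" and mean: "(\<integral>x. h x \<partial>\<pi>) = 0" and summable: "summable (\<lambda>k. \<bar>autocov h k\<bar>)"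
  shows "(\<lambda>n. ext_variance M (partial_sum h X n) / of_nat n)
     \<longlonglongrightarrow> ennreal (autocov h 0 + 2 * (\<Sum>k. autocov h (Suc k)))"
proof -
  have [measurable]: "h \<in> borel_measurable borel" using h by auto
  define S where "S = partial_sum h X"
  have S_eq: "S n \<omega> = (\<Sum>k<n. h (X k \<omega>))" for n \<omega> by (simp add: S_def partial_sum_def)
  have [measurable]: "S n \<in> borel_measurable M" for n
    unfolding S_def partial_sum_def[abs_def] by measurable
  have h_int: "integrable M (\<lambda>\<omega>. h (X k \<omega>))" for k
    using L2_integrable[OF h] by (simp add: integrable_X)
  have S_mean: "(\<integral>\<omega>. S n \<omega> \<partial>M) = 0" for n
    using h_int by (simp add: S_eq integral_X mean)
  have h_sq: "integrable M (\<lambda>\<omega>. (h (X k \<omega>))\<^sup>2)" for k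
    using L2_square[OF h] integrable_X[of "\<lambda>x. (h x)\<^sup>2"] by simp
  have S_h: "integrable M (\<lambda>\<omega>. S n \<omega> * h (X m \<omega>))" for n m
    unfolding S_eq sum_distrib_right by (intro Bochner_Integration.integrable_sum integrable_X_product h)
  have S_sq: "integrable M (\<lambda>\<omega>. (S n \<omega>)\<^sup>2)" for n
    unfolding power2_eq_square S_eq[of n] sum_product
    by (intro Bochner_Integration.integrable_sum integrable_X_product h)
  \<comment> \<open>The increment on adding the state at time n: its own variance and twice its
    covariances with all earlier ones.\<close>
  define c where "c = (\<lambda>n. autocov h 0 + 2 * (\<Sum>k<n. autocov h (Suc k)))"
  have S_Suc: "(\<integral>\<omega>. (S (Suc n) \<omega>)\<^sup>2 \<partial>M) = (\<integral>\<omega>. (S n \<omega>)\<^sup>2 \<partial>M) + c n" for n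
  proof -
    have "(\<integral>\<omega>. (S (Suc n) \<omega>)\<^sup>2 \<partial>M) = (\<integral>\<omega>. (S n \<omega>)\<^sup>2 + 2 * (S n \<omega> * h (X n \<omega>)) + (h (X n \<omega>))\<^sup>2 \<partial>M)"
      by (simp add: S_eq power2_sum algebra_simps)
    also have "\<dots> = (\<integral>\<omega>. (S n \<omega>)\<^sup>2 \<partial>M) + 2 * (\<integral>\<omega>. S n \<omega> * h (X n \<omega>) \<partial>M) + (\<integral>\<omega>. (h (X n \<omega>))\<^sup>2 \<partial>M)"
      using S_sq S_h h_sq by simp
    also have "(\<integral>\<omega>. (h (X n \<omega>))\<^sup>2 \<partial>M) = autocov h 0"
      using integral_X[of "\<lambda>x. (h x)\<^sup>2" n] by (simp add: autocov_def power2_eq_square)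
    also have "(\<integral>\<omega>. S n \<omega> * h (X n \<omega>) \<partial>M) = (\<Sum>k<n. \<integral>\<omega>. h (X k \<omega>) * h (X n \<omega>) \<partial>M)"
      unfolding S_eq sum_distrib_right by (intro Bochner_Integration.integral_sum integrable_X_product h)
    also have "\<dots> = (\<Sum>k<n. autocov h (n - k))"
    proof (rule sum.cong[OF refl])
      fix k assume "k \<in> {..<n}"
      then show "(\<integral>\<omega>. h (X k \<omega>) * h (X n \<omega>) \<partial>M) = autocov h (n - k)"
        using integral_X_product[OF h h, of k "n - k"] by (simp add: autocov_def)
    qed
    also have "\<dots> = (\<Sum>k<n. autocov h (Suc k))"
      by (rule sum.reindex_bij_witness[of _ "\<lambda>k. n - Suc k" "\<lambda>k. n - Suc k"]) (auto simp: Suc_diff_Suc)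
    finally show ?thesis by (simp add: c_def)
  qed
  have S_var: "(\<integral>\<omega>. (S n \<omega>)\<^sup>2 \<partial>M) = (\<Sum>j<n. c j)" for n
    by (induction n) (simp_all add: S_Suc, simp add: S_eq)
  have ext: "ext_variance M (S n) = ennreal (\<Sum>j<n. c j)" for n
    unfolding ext_variance_def S_mean S_var[symmetric]
    using S_sq by (simp add: nn_integral_eq_integral)
  have "summable (autocov h)" using summable by (rule summable_rabs_cancel)
  then have "summable (\<lambda>k. autocov h (Suc k))" by (simp add: summable_Suc_iff)
  then have "c \<longlonglongrightarrow> autocov h 0 + 2 * (\<Sum>k. autocov h (Suc k))"
    unfolding c_def by (intro tendsto_intros summable_LIMSEQ)
  from tendsto_ennrealI[OF cesaro_mean[OF this]]
  have lim: "(\<lambda>n. ennreal ((\<Sum>j<n. c j) / real n)) \<longlonglongrightarrow> ennreal (autocov h 0 + 2 * (\<Sum>k. autocov h (Suc k)))" .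
  have "\<forall>\<^sub>F n in sequentially. ennreal ((\<Sum>j<n. c j) / real n) = ext_variance M (S n) / of_nat n"
    using eventually_gt_at_top[of 0]
  proof eventually_elim
    case (elim n)
    have "0 \<le> (\<Sum>j<n. c j)" unfolding S_var[symmetric] by simp
    then show ?case
      using elim by (simp add: ext divide_ennreal ennreal_of_nat_eq_real_of_nat)
  qed
  from Lim_transform_eventually[OF lim this] show ?thesis by (simp add: S_def)
qed

end

theorem corollary4p3:
  fixes P :: "'a::polish_space \<Rightarrow> 'a measure"
    and \<pi> :: "'a measure"
    and M :: "'b measure"
    and X :: "nat \<Rightarrow> 'b \<Rightarrow> 'a"
    and h :: "'a \<Rightarrow> real"
    and \<delta> :: real
  assumes "markov_kernel P"
    and "stationary_distribution P \<pi>"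
    and "reversible P \<pi>"
    and "ergodic P \<pi>"
    and "stationary_markov_chain M X P \<pi>"
    and "integrable \<pi> h"
    and "(\<integral>x. h x \<partial>\<pi>) = 0"
    and "sqrt_bounded_in_probability M (partial_sum h X)"
    and "\<delta> > 0"
    and "(INF x. measure (P x) {x}) \<ge> \<delta>"
  shows "\<exists>A::ennreal. A < \<infinity> \<and>
           (\<lambda>n. ext_variance M (partial_sum h X n) / of_nat n) \<longlonglongrightarrow> A"
proof -
  \<comment> \<open>A real infimum lies below its members only when they are bounded below, here by
    0.\<close>
  have "\<delta> \<le> measure (P x) {x}" for x
    using assms(10) by (rule order_trans) (auto intro!: cINF_lower bdd_belowI[of _ 0])
  then interpret stationary_reversible_chain P \<pi> \<delta> M X
    using assms by unfold_locales
  have h [measurable]: "h \<in> borel_measurable borel"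
    using borel_measurable_integrable[OF assms(6)] by simp
  obtain t where t: "t > 0"
    and cos_ge: "\<And>n k. k \<le> n \<Longrightarrow> n > 0 \<Longrightarrow> 1 / 2 \<le> (\<integral>\<omega>. cos (t / sqrt (real n) * partial_sum h X k \<omega>) \<partial>M)"
    using integral_cos_ge[OF h assms(8)] by blast
  interpret char_fun_bounded_below P \<pi> \<delta> h t
  proof
    show "phi_irreducible P" using assms(4) by (simp add: ergodic_def)
    fix n k :: nat assume "k \<le> n" "n > 0"
    then show "1 / 2 \<le> (\<integral>x. char_re (\<lambda>x. t / sqrt (real n) * h x) k x \<partial>\<pi>)"
      using cos_ge by (simp add: integral_char_re partial_sum_def sum_distrib_left)
  qed (use h t in auto)
  show ?thesis
    using variance_tendsto[OF h_L2 assms(7) summable_autocov] by (intro exI conjI) auto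
qed

end
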